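(* The following conditions are equivalent for a hereditary, weakly sparse graph class $\mathcal C$: (1) $\mathcal C$ is nowhere dense; (2) $\mathcal C$ has almost bounded merge-width; (3) $\mathcal C$ has almost bounded flip-width.
   Context: Graphs are finite, simple and undirected: $G=(V,E(G))$ with $E(G)\subseteq\binom V2$. A graph class is hereditary if it is closed under taking induced subgraphs, and weakly sparse if there is $t\in\mathbb N$ such that no graph in the class contains the biclique $K_{t,t}$ as a (not necessarily induced) subgraph. A graph class $\mathcal C$ is nowhere dense if for every $r\in\mathbb N$ there is $k\in\mathbb N$ such that the $r$-subdivision of the $k$-clique (obtained by replacing each of its edges with a path with $r$ inner vertices) is not a subgraph of any graph in $\mathcal C$. Merge-width. A construction sequence on $V$ is a sequence of steps maintaining a partition $\mathcal P$ of $V$ and a partition of $\binom V2$ into edges $E$, non-edges $N$, and unresolved pairs $U$. Initially $\mathcal P$ is the partition into singletons and $U=\binom V2$. In each step one of three operations is performed: merge two parts $A,B\in\mathcal P$, replacing them by $A\cup B$; resolve positively a pair of parts $A,B\in\mathcal P$ (possibly $A=B$), moving all $\{a,b\}\in U$ with $a\in A,b\in B$ from $U$ to $E$; or resolve negatively such a pair of parts, moving these pairs from $U$ to $N$. In the end $\mathcal P$ has one part and $U=\emptyset$; it is then a construction sequence of the graph $(V,E)$. Its radius-$r$ width is the least $k$ such that at every step, for every $v\in V$, at most $k$ parts of the current $\mathcal P$ contain a vertex reachable from $v$ by a path of length at most $r$ in the graph $(V,E\cup N)$ for the current $E,N$. The radius-$r$ merge-width $\mathrm{mw}_r(G)$ is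 the least radius-$r$ width of a construction sequence of $G$. Flip-width. For $A,B\subseteq V(G)$ let $AB=\{\{a,b\}:a\in A,b\in B,a\neq b\}$. For a partition $\mathcal P$ of $V(G)$, a $\mathcal P$-flip of $G$ is a graph $G'$ on $V(G)$ such that for all $A,B\in\mathcal P$ (possibly $A=B$), either $E(G')\cap AB=E(G)\cap AB$ or $E(G')\cap AB=AB\setminus E(G)$. A $k$-flip is a $\mathcal P$-flip for some $\mathcal P$ with $|\mathcal P|\le k$. The flip-width game of radius $r$ and width $k$ on $G$ is played by flipper and runner. Set $G_0=G$. Initially runner picks $v_0\in V(G)$. In round $t=1,2,\dots$, flipper announces a $k$-flip $G_t$ of $G$; then runner picks $v_t$ at distance at most $r$ from $v_{t-1}$ in the previous graph $G_{t-1}$. Flipper wins if $v_t$ is isolated in $G_t$. The radius-$r$ flip-width $\mathrm{fw}_r(G)$ is the least $k$ such that flipper has a winning strategy in this game. A graph class $\mathcal C$ has almost bounded merge-width (resp. almost bounded flip-width) if for every $r\in\mathbb N$ and $\varepsilon>0$ we have $\mathrm{mw}_r(G)\le O_{\mathcal C,r,\varepsilon}(|V(G)|^{\varepsilon})$ (resp. $\mathrm{fw}_r(G)\le O_{\mathcal C,r,\varepsilon}(|V(G)|^{\varepsilon})$) for all $G\in\mathcal C$, where the hidden constants depend only on $\mathcal C,r,\varepsilon$. *)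

theory Defs
  imports Complex_Main "HOL-Library.Ramsey" "HOL-Library.Disjoint_Sets"
begin

section \<open>Graphs and graph classes\<close>

datatype 'a graph = Graph (verts: "'a set") (edges: "'a set set")

text \<open>The set of all two-element subsets of \<open>V\<close> is \<open>nsets V 2\<close>, written \<open>[V]\<^bsup>2\<^esup>\<close>.
  The graph without vertices is allowed.\<close>

definition simple_graph :: "'a graph \<Rightarrow> bool" where
  "simple_graph G \<longleftrightarrow> finite (verts G) \<and> edges G \<subseteq> [verts G]\<^bsup>2\<^esup>"

definition induced_subgraph :: "'a graph \<Rightarrow> 'a set \<Rightarrow> 'a graph" where
  "induced_subgraph G S = Graph S {e \<in> edges G. e \<subseteq> S}"

definition contains_subgraph :: "'a graph \<Rightarrow> 'b graph \<Rightarrow> bool" where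
  "contains_subgraph G H \<longleftrightarrow>
     (\<exists>f. inj_on f (verts H) \<and> f ` verts H \<subseteq> verts G \<and> (\<forall>e\<in>edges H. f ` e \<in> edges G))"

text \<open>Classes are sets of graphs over an arbitrary vertex type; closure under isomorphism
  is not required.\<close>

definition hereditary :: "'a graph set \<Rightarrow> bool" where
  "hereditary C \<longleftrightarrow> (\<forall>G\<in>C. \<forall>S. S \<subseteq> verts G \<longrightarrow> induced_subgraph G S \<in> C)"

definition biclique :: "nat \<Rightarrow> (bool \<times> nat) graph" where
  "biclique t = Graph (UNIV \<times> {..<t}) {{(False, i), (True, j)} | i j. i < t \<and> j < t}"

definition weakly_sparse :: "'a graph set \<Rightarrow> bool" where
  "weakly_sparse C \<longleftrightarrow> (\<exists>t. \<forall>G\<in>C. \<not> contains_subgraph G (biclique t))"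

text \<open>In the \<open>r\<close>-subdivision of the clique on \<open>{..<k}\<close>, the edge between \<open>i < j\<close> is replaced
  by the path \<open>Branch i, Inner i j 1, \<dots>, Inner i j r, Branch j\<close>, whose vertex at position
  \<open>p \<le> r + 1\<close> is \<open>subdivision_vertex r i j p\<close>.\<close>

datatype subdiv_vertex = Branch nat | Inner nat nat nat

definition subdivision_vertex :: "nat \<Rightarrow> nat \<Rightarrow> nat \<Rightarrow> nat \<Rightarrow> subdiv_vertex" where
  "subdivision_vertex r i j p =
     (if p = 0 then Branch i else if p = r + 1 then Branch j else Inner i j p)"

definition subdivided_clique :: "nat \<Rightarrow> nat \<Rightarrow> subdiv_vertex graph" where
  "subdivided_clique r k = Graph
     (Branch ` {..<k} \<union> {Inner i j p | i j p. i < j \<and> j < k \<and> 1 \<le> p \<and> p \<le> r})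
     {{subdivision_vertex r i j p, subdivision_vertex r i j (p + 1)} | i j p.
        i < j \<and> j < k \<and> p \<le> r}"

definition nowhere_dense :: "'a graph set \<Rightarrow> bool" where
  "nowhere_dense C \<longleftrightarrow> (\<forall>r. \<exists>k. \<forall>G\<in>C. \<not> contains_subgraph G (subdivided_clique r k))"

definition is_path :: "'a graph \<Rightarrow> 'a list \<Rightarrow> bool" where
  "is_path G xs \<longleftrightarrow> xs \<noteq> [] \<and> set xs \<subseteq> verts G \<and> distinct xs \<and>
     successively (\<lambda>u v. {u, v} \<in> edges G) xs"

definition within_dist :: "'a graph \<Rightarrow> nat \<Rightarrow> 'a \<Rightarrow> 'a \<Rightarrow> bool" where
  "within_dist G r u v \<longleftrightarrow>
     (\<exists>xs. is_path G xs \<and> hd xs = u \<and> last xs = v \<and> length xs - 1 \<le> r)"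

definition pairs_between :: "'a set \<Rightarrow> 'a set \<Rightarrow> 'a set set" where
  "pairs_between A B = {{a, b} | a b. a \<in> A \<and> b \<in> B \<and> a \<noteq> b}"


section \<open>Merge-width\<close>

text \<open>A state \<open>(P, E, N, U)\<close> consists of the current partition, the edges, the non-edges and
  the unresolved pairs.\<close>

type_synonym 'a cstate = "'a set set \<times> 'a set set \<times> 'a set set \<times> 'a set set"

inductive construction_step :: "'a cstate \<Rightarrow> 'a cstate \<Rightarrow> bool" where
  merge: "A \<in> P \<Longrightarrow> B \<in> P \<Longrightarrow> A \<noteq> B \<Longrightarrow>
    construction_step (P, E, N, U) (insert (A \<union> B) (P - {A, B}), E, N, U)"
| resolve_positively: "A \<in> P \<Longrightarrow> B \<in> P \<Longrightarrow>
    construction_step (P, E, N, U)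
      (P, E \<union> (U \<inter> pairs_between A B), N, U - pairs_between A B)"
| resolve_negatively: "A \<in> P \<Longrightarrow> B \<in> P \<Longrightarrow>
    construction_step (P, E, N, U)
      (P, E, N \<union> (U \<inter> pairs_between A B), U - pairs_between A B)"

definition initial_state :: "'a set \<Rightarrow> 'a cstate" where
  "initial_state V = ((\<lambda>v. {v}) ` V, {}, {}, [V]\<^bsup>2\<^esup>)"

text \<open>A construction sequence is represented by the list of all its states. The final partition
  has one part; \<open>card P \<le> 1\<close> rather than \<open>card P = 1\<close> only serves to admit the graph without
  vertices, whose partition is empty.\<close>

definition construction_sequence :: "'a graph \<Rightarrow> 'a cstate list \<Rightarrow> bool" where
  "construction_sequence G ss \<longleftrightarrow>
     ss \<noteq> [] \<and> hd ss = initial_state (verts G) \<and> successively construction_step ss \<and>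
     (\<exists>P N. last ss = (P, edges G, N, {}) \<and> card P \<le> 1)"

definition reachable_parts :: "'a set \<Rightarrow> nat \<Rightarrow> 'a cstate \<Rightarrow> 'a \<Rightarrow> 'a set set" where
  "reachable_parts V r s v =
     (case s of (P, E, N, U) \<Rightarrow> {A \<in> P. \<exists>w\<in>A. within_dist (Graph V (E \<union> N)) r v w})"

definition sequence_width :: "'a set \<Rightarrow> nat \<Rightarrow> 'a cstate list \<Rightarrow> nat" where
  "sequence_width V r ss = (LEAST k. \<forall>s\<in>set ss. \<forall>v\<in>V. card (reachable_parts V r s v) \<le> k)"

definition merge_width :: "nat \<Rightarrow> 'a graph \<Rightarrow> nat" where
  "merge_width r G =
     (LEAST k. \<exists>ss. construction_sequence G ss \<and> sequence_width (verts G) r ss = k)"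


section \<open>Flip-width\<close>

definition partition_flip :: "'a graph \<Rightarrow> 'a set set \<Rightarrow> 'a graph \<Rightarrow> bool" where
  "partition_flip G P G' \<longleftrightarrow> simple_graph G' \<and> verts G' = verts G \<and>
     (\<forall>A\<in>P. \<forall>B\<in>P.
        edges G' \<inter> pairs_between A B = edges G \<inter> pairs_between A B \<or>
        edges G' \<inter> pairs_between A B = pairs_between A B - edges G)"

definition k_flip :: "nat \<Rightarrow> 'a graph \<Rightarrow> 'a graph \<Rightarrow> bool" where
  "k_flip k G G' \<longleftrightarrow> (\<exists>P. partition_on (verts G) P \<and> card P \<le> k \<and> partition_flip G P G')"

definition isolated :: "'a graph \<Rightarrow> 'a \<Rightarrow> bool" where
  "isolated G v \<longleftrightarrow> (\<forall>e\<in>edges G. v \<notin> e)"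

text \<open>A strategy of flipper maps the list \<open>[v\<^sub>0, \<dots>, v\<^sub>t\<^sub>-\<^sub>1]\<close> of the previous positions of runner
  to the graph \<open>G\<^sub>t\<close>. Against runner's moves \<open>v\<close>, the play uses the graphs
  \<open>announced_graph G \<sigma> v t\<close>. Since runner can always stay where she is, plays may be taken to be
  infinite; flipper wins once the winning condition holds in some round \<open>t \<ge> 1\<close>.\<close>

definition announced_graph ::
    "'a graph \<Rightarrow> ('a list \<Rightarrow> 'a graph) \<Rightarrow> (nat \<Rightarrow> 'a) \<Rightarrow> nat \<Rightarrow> 'a graph" where
  "announced_graph G \<sigma> v t = (if t = 0 then G else \<sigma> (map v [0..<t]))"

definition flipper_wins :: "nat \<Rightarrow> nat \<Rightarrow> 'a graph \<Rightarrow> bool" where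
  "flipper_wins r k G \<longleftrightarrow>
     (\<exists>\<sigma>. (\<forall>h. k_flip k G (\<sigma> h)) \<and>
        (\<forall>v. v 0 \<in> verts G \<and>
             (\<forall>t\<ge>1. within_dist (announced_graph G \<sigma> v (t - 1)) r (v (t - 1)) (v t)) \<longrightarrow>
             (\<exists>t\<ge>1. isolated (announced_graph G \<sigma> v t) (v t))))"

definition flip_width :: "nat \<Rightarrow> 'a graph \<Rightarrow> nat" where
  "flip_width r G = (LEAST k. flipper_wins r k G)"


section \<open>Almost bounded parameters\<close>

definition almost_bounded_merge_width :: "'a graph set \<Rightarrow> bool" where
  "almost_bounded_merge_width C \<longleftrightarrow>
     (\<forall>r. \<forall>\<epsilon>::real. \<epsilon> > 0 \<longrightarrow> (\<exists>c::real. \<forall>G\<in>C.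
        real (merge_width r G) \<le> c * real (card (verts G)) powr \<epsilon>))"

definition almost_bounded_flip_width :: "'a graph set \<Rightarrow> bool" where
  "almost_bounded_flip_width C \<longleftrightarrow>
     (\<forall>r. \<forall>\<epsilon>::real. \<epsilon> > 0 \<longrightarrow> (\<exists>c::real. \<forall>G\<in>C.
        real (flip_width r G) \<le> c * real (card (verts G)) powr \<epsilon>))"

end

theory Submission
  imports Defs
begin

text \<open>
  Both widths are compared with shallow topological minors. Throughout, \<open>n\<close> is the number of vertices.

  From nowhere density to small widths. A fan from a vertex \<open>v\<close> to a set is a family of short paths that are
  disjoint outside \<open>v\<close>. If each vertex of some set \<open>S\<close> had a fan to the rest of \<open>S\<close> of size \<open>n powr \<epsilon>\<close>,
  the graph would contain a shallow subdivision of a graph of polynomial density (\<open>fans_give_dense_minor\<close>). If it is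
  large, such a dense graph contains a subdivision of a clique of any prescribed size in which the number of
  subdivision vertices per edge depends on the density exponent only (\<open>dense_graph_clique_subdivision\<close>), and Ramsey's theorem makes
  this number the same for all edges; this contradicts nowhere density. So every set \<open>S\<close> has a vertex without a
  large fan. Removing such vertices one by one orders the vertices in such a way that, for every initial segment
  \<open>L\<close>, short walks outside \<open>L\<close> lead from any vertex to few vertices of \<open>L\<close>
  (\<open>fan_bounded_reach_ordering\<close>). In graphs without large bicliques, a set of \<open>K\<close> vertices has only
  polynomially many traces of neighbourhoods, so grouping the vertices outside \<open>L\<close> by their neighbourhood in
  \<open>L\<close> yields few groups near any vertex. Letting \<open>L\<close> shrink gives a construction sequence
  (\<open>merge_width_sequence\<close>), and letting \<open>L\<close> grow gives a winning strategy of flipper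
  (\<open>flipper_wins_ordering\<close>), both of a width polynomial in the size of the fans.

  From small widths to nowhere density. If the class is not nowhere dense, then for some \<open>r\<close> and all \<open>m\<close>
  heredity yields a graph in the class that is spanned by an \<open>r\<close>-subdivision of the \<open>m\<close>-clique, possibly with
  additional edges. In the absence of large bicliques, a flip with \<open>k\<close> parts does not increase distances much once
  a set of order \<open>k\<close> of vertices is deleted: an edge that it removes between two large parts is replaced by a
  path of three nonedges (\<open>unobstructed_edge_detour\<close>). After the deletion of few vertices, the surviving branch
  vertices of the subdivided clique are still close to each other. So runner escapes if \<open>k\<close> is small compared to
  \<open>m\<close> (\<open>flipper_wins_card\<close>). The same argument, run backwards through a construction sequence of small width,
  would keep the core of the subdivided clique close together up to the beginning, where nothing is resolved
  (\<open>construction_sequence_card\<close>). So both widths are at least linear in \<open>m\<close>, hence of order at least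
  \<open>sqrt n\<close>, and not almost bounded.
\<close>

section \<open>Walks and linkages\<close>

definition linked :: "'a set set \<Rightarrow> 'a set \<Rightarrow> 'a \<Rightarrow> 'a \<Rightarrow> bool" where
  "linked E I u v \<longleftrightarrow> (\<exists>xs. set xs \<subseteq> I \<and> successively (\<lambda>x y. {x, y} \<in> E) (u # xs @ [v]))"

abbreviation walk :: "'a set set \<Rightarrow> 'a list \<Rightarrow> bool" where
  "walk E \<equiv> successively (\<lambda>x y. {x, y} \<in> E)"

lemma walk_rev: "walk E (rev xs) \<longleftrightarrow> walk E xs"
  by (simp add: insert_commute)

lemma walk_append: "walk E (xs @ x # ys) \<longleftrightarrow> walk E (xs @ [x]) \<and> walk E (x # ys)"
  by (cases ys) (auto simp: successively_append_iff)

lemma walk_mono: "walk E xs \<Longrightarrow> E \<subseteq> E' \<Longrightarrow> walk E' xs"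
  by (erule successively_mono) auto

lemma edge_ends: "E \<subseteq> [V]\<^bsup>2\<^esup> \<Longrightarrow> {x, y} \<in> E \<Longrightarrow> x \<in> V \<and> y \<in> V \<and> x \<noteq> y"
  by (drule (1) subsetD) simp

lemma finite_edges: "finite V \<Longrightarrow> E \<subseteq> [V]\<^bsup>2\<^esup> \<Longrightarrow> finite E"
  using finite_imp_finite_nsets finite_subset by blast

lemma incident_edges:
  assumes "E \<subseteq> [X]\<^bsup>2\<^esup>"
  shows "{e \<in> E. e \<inter> {a} \<noteq> {}} \<subseteq> (\<lambda>x. {a, x}) ` {x \<in> X. {a, x} \<in> E}"
proof
  fix e assume e: "e \<in> {e \<in> E. e \<inter> {a} \<noteq> {}}"
  then have "e \<in> [X]\<^bsup>2\<^esup>" using assms by auto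
  then obtain u v where "e = {u, v}" "u \<in> X" "v \<in> X" by (auto elim: nsets2_E)
  then show "e \<in> (\<lambda>x. {a, x}) ` {x \<in> X. {a, x} \<in> E}" using e by (auto simp: insert_commute)
qed

lemma walk_subset:
  assumes "walk E (u # xs @ [v])" "E \<subseteq> [V]\<^bsup>2\<^esup>"
  shows "set xs \<subseteq> V" "u \<in> V" "v \<in> V"
proof -
  have "walk E (u # xs @ [v]) \<Longrightarrow> set xs \<subseteq> V \<and> u \<in> V \<and> v \<in> V"
  proof (induction xs arbitrary: u)
    case Nil
    then have "{u, v} \<in> E" by simp
    then have "{u, v} \<in> [V]\<^bsup>2\<^esup>" using assms(2) by (rule rev_subsetD)
    then show ?case by simp
  next
    case (Cons x xs)
    then have "{u, x} \<in> E" "walk E (x # xs @ [v])" by auto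
    then have "{u, x} \<in> [V]\<^bsup>2\<^esup>" "walk E (x # xs @ [v])" using assms(2) rev_subsetD by blast+
    with Cons.IH[of x] show ?case by simp
  qed
  then show "set xs \<subseteq> V" "u \<in> V" "v \<in> V" using assms(1) by auto
qed

lemma linked_mono: "linked E I u v \<Longrightarrow> I \<subseteq> J \<Longrightarrow> linked E J u v"
  unfolding linked_def by blast

lemma linked_sym: "linked E I u v \<Longrightarrow> linked E I v u"
proof -
  assume "linked E I u v"
  then obtain xs where "set xs \<subseteq> I" "walk E (u # xs @ [v])" unfolding linked_def by blast
  then have "set (rev xs) \<subseteq> I" "walk E (v # rev xs @ [u])"
    using walk_rev[of E "u # xs @ [v]"] by auto
  then show ?thesis unfolding linked_def by blast
qed

lemma linked_trans:
  assumes "linked E I u v" "linked E J v w"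
  shows "linked E (I \<union> J \<union> {v}) u w"
proof -
  obtain xs ys where "set xs \<subseteq> I" "walk E (u # xs @ [v])" "set ys \<subseteq> J" "walk E (v # ys @ [w])"
    using assms unfolding linked_def by blast
  then have "set (xs @ v # ys) \<subseteq> I \<union> J \<union> {v}" "walk E (u # (xs @ v # ys) @ [w])"
    using walk_append[of E "u # xs" v "ys @ [w]"] by auto
  then show ?thesis unfolding linked_def by blast
qed

text \<open>Cutting out the segment between two visits of the same vertex shortens a walk, so walks may be
  taken to be paths.\<close>

lemma walk_shorten:
  assumes "walk E xs" "xs \<noteq> []"
  obtains ys where "walk E ys" "distinct ys" "ys \<noteq> []" "hd ys = hd xs" "last ys = last xs"
    "set ys \<subseteq> set xs" "length ys \<le> length xs"
proof -
  have "\<exists>ys. walk E ys \<and> distinct ys \<and> ys \<noteq> [] \<and> hd ys = hd xs \<and> last ys = last xs \<and>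
    set ys \<subseteq> set xs \<and> length ys \<le> length xs"
    using assms
  proof (induction "length xs" arbitrary: xs rule: less_induct)
    case less
    show ?case
    proof (cases "distinct xs")
      case True
      then show ?thesis using less.prems by blast
    next
      case False
      then obtain as a bs cs where xs: "xs = as @ [a] @ bs @ [a] @ cs"
        using not_distinct_decomp by blast
      define zs where "zs = as @ a # cs"
      have "walk E zs" using less.prems(1) unfolding xs zs_def
        by (metis append_Cons append_Nil append_assoc walk_append)
      moreover have "length zs < length xs" "zs \<noteq> []" "hd zs = hd xs" "last zs = last xs" "set zs \<subseteq> set xs"
        unfolding xs zs_def by (cases as; auto)+
      ultimately show ?thesis using less.hyps[of zs]
        by (metis (no_types, lifting) dual_order.trans less_imp_le_nat)
    qed
  qed
  then show ?thesis using that by blast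
qed

lemma linked_path:
  assumes "linked E I u v" "u \<noteq> v" "u \<notin> I" "v \<notin> I"
  obtains xs where "set xs \<subseteq> I" "distinct (u # xs @ [v])" "walk E (u # xs @ [v])"
proof -
  obtain zs where zs: "set zs \<subseteq> I" "walk E (u # zs @ [v])" using assms unfolding linked_def by blast
  obtain ys where ys: "walk E ys" "distinct ys" "ys \<noteq> []" "hd ys = u" "last ys = v"
    "set ys \<subseteq> set (u # zs @ [v])"
    using walk_shorten[OF zs(2)] by auto
  obtain ws where ws: "ys = u # ws" using ys by (cases ys) auto
  have "ws \<noteq> []" using ys ws assms(2) by auto
  then obtain xs where xs: "ws = xs @ [v]" using ys(5) ws by (metis append_butlast_last_id last_ConsR)
  have "set xs \<subseteq> I" using ys(2,6) zs(1) unfolding ws xs by auto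
  then show ?thesis using ys ws xs that by auto
qed

section \<open>Shallow topological minors\<close>

text \<open>A subgraph that is a subdivision of the graph with vertex set \<open>B\<close> and edge set \<open>H\<close>, whose
  edges are subdivided at most \<open>q\<close> times, is recorded by the sets \<open>I e\<close> of inner vertices
  available to the path that replaces the edge \<open>e\<close>; the path itself need not be chosen.\<close>

definition subdivision_model ::
  "nat \<Rightarrow> 'a set set \<Rightarrow> 'a set \<Rightarrow> 'a set set \<Rightarrow> ('a set \<Rightarrow> 'a set) \<Rightarrow> bool" where
  "subdivision_model q E B H I \<longleftrightarrow> H \<subseteq> [B]\<^bsup>2\<^esup> \<and>
     (\<forall>e\<in>H. finite (I e) \<and> card (I e) \<le> q \<and> I e \<inter> B = {}) \<and>
     (\<forall>e\<in>H. \<forall>f\<in>H. e \<noteq> f \<longrightarrow> I e \<inter> I f = {}) \<and>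
     (\<forall>u v. {u, v} \<in> H \<longrightarrow> linked E (I {u, v}) u v)"

lemma subdivision_modelD:
  assumes "subdivision_model q E B H I"
  shows "H \<subseteq> [B]\<^bsup>2\<^esup>" "e \<in> H \<Longrightarrow> finite (I e)" "e \<in> H \<Longrightarrow> card (I e) \<le> q" "e \<in> H \<Longrightarrow> I e \<inter> B = {}"
    "e \<in> H \<Longrightarrow> f \<in> H \<Longrightarrow> e \<noteq> f \<Longrightarrow> I e \<inter> I f = {}" "{u, v} \<in> H \<Longrightarrow> linked E (I {u, v}) u v"
  using assms by (simp_all add: subdivision_model_def)

text \<open>Concatenating the walks of the first model along a walk of the second one.\<close>

lemma linked_compose:
  assumes "walk H (u # xs @ [v])" and "\<And>x y. {x, y} \<in> H \<Longrightarrow> linked E (I {x, y}) x y"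
  shows "linked E (set xs \<union> \<Union>(I ` {f \<in> H. f \<subseteq> set xs \<union> {u, v}})) u v"
  using assms(1)
proof (induction xs arbitrary: u)
  case Nil
  then have "linked E (I {u, v}) u v" using assms(2) by auto
  then show ?case by (rule linked_mono) (use Nil in auto)
next
  case (Cons x xs)
  then have "{u, x} \<in> H" "walk H (x # xs @ [v])" by auto
  then have "linked E (I {u, x} \<union> (set xs \<union> \<Union>(I ` {f \<in> H. f \<subseteq> set xs \<union> {x, v}})) \<union> {x}) u v"
    using linked_trans[OF assms(2) Cons.IH] by blast
  then show ?case by (rule linked_mono) (use \<open>{u, x} \<in> H\<close> in auto)
qed

text \<open>A path of the second model uses only edges of the first one that lie inside its own vertex set;
  there are at most \<open>2 ^ (q2 + 2)\<close> of these, and no edge of the first model lies inside the vertex sets of two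
  paths, because two such sets share at most one vertex.\<close>

lemma subdivision_model_compose:
  assumes 1: "subdivision_model q1 E B H I" and 2: "subdivision_model q2 H B' H' I'"
    and "B' \<subseteq> B" "\<And>e. e \<in> H' \<Longrightarrow> I' e \<subseteq> B"
  shows "\<exists>J. subdivision_model (q2 + 2 ^ (q2 + 2) * q1) E B' H' J"
proof -
  define F where "F e = {f \<in> H. f \<subseteq> I' e \<union> e}" for e
  define J where "J e = I' e \<union> \<Union>(I ` F e)" for e
  note m1 = subdivision_modelD[OF 1] and m2 = subdivision_modelD[OF 2]
  have e2: "finite e \<and> card e = 2 \<and> e \<subseteq> B'" if "e \<in> H'" for e
    using m2(1) that by (auto simp: nsets_def)
  have f2: "card f = 2 \<and> f \<subseteq> B" if "f \<in> H" for f
    using m1(1) that by (auto simp: nsets_def)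
  have sub: "F e \<subseteq> Pow (I' e \<union> e)" for e unfolding F_def by auto
  have finF: "finite (F e) \<and> card (F e) \<le> 2 ^ (q2 + 2)" if "e \<in> H'" for e
  proof -
    have fin: "finite (I' e \<union> e)" using that e2 m2(2) by simp
    have "card (I' e \<union> e) \<le> q2 + 2" using card_Un_le[of "I' e" e] m2(3)[OF that] e2[OF that] by simp
    then have "card (Pow (I' e \<union> e)) \<le> 2 ^ (q2 + 2)" 
      using fin power_increasing[of _ "q2 + 2" "2::nat"] by (simp add: card_Pow)
    then show ?thesis using sub[of e] fin card_mono[OF _ sub[of e]]
      by (meson finite_Pow_iff finite_subset le_trans)
  qed
  have disjF: "F e \<inter> F e' = {}" if "e \<in> H'" "e' \<in> H'" "e \<noteq> e'" for e e'
  proof (rule ccontr)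
    assume "F e \<inter> F e' \<noteq> {}"
    then obtain f where f: "f \<in> H" "f \<subseteq> I' e \<union> e" "f \<subseteq> I' e' \<union> e'" unfolding F_def by blast
    have "I' e \<inter> I' e' = {}" "I' e \<inter> B' = {}" "I' e' \<inter> B' = {}" using m2(4,5) that by auto
    then have "f \<subseteq> e \<inter> e'" using f(2,3) e2[OF that(1)] e2[OF that(2)] by blast
    then have "f = e" "f = e'" using f2[OF f(1)] e2[OF that(1)] e2[OF that(2)]
      by (metis card_subset_eq le_inf_iff)+
    then show False using that by simp
  qed
  have "J e \<inter> J e' = {}" if "e \<in> H'" "e' \<in> H'" "e \<noteq> e'" for e e'
  proof -
    have a: "I' e \<inter> I' e' = {}" using m2(5) that by auto
    have b: "I f \<inter> I' g = {}" if "f \<in> H" "g \<in> H'" for f g using m1(4)[OF that(1)] assms(4)[OF that(2)] by blast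
    have c: "I f \<inter> I g = {}" if "f \<in> F e" "g \<in> F e'" for f g
    proof -
      have "f \<noteq> g" using disjF \<open>e \<in> H'\<close> \<open>e' \<in> H'\<close> \<open>e \<noteq> e'\<close> that by blast
      then show ?thesis using m1(5) that unfolding F_def by blast
    qed
    have "F e \<subseteq> H" "F e' \<subseteq> H" unfolding F_def by auto
    then show ?thesis unfolding J_def using a b c that(1,2) by blast
  qed
  moreover have "finite (J e) \<and> card (J e) \<le> q2 + 2 ^ (q2 + 2) * q1 \<and> J e \<inter> B' = {}" if "e \<in> H'" for e
  proof (intro conjI)
    show "finite (J e)" unfolding J_def using finF[OF that] m2(2)[OF that] m1(2) by (auto simp: F_def)
    have "card (\<Union>(I ` F e)) \<le> (\<Sum>f\<in>F e. card (I f))" using card_UN_le finF[OF that] by blast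
    also have "\<dots> \<le> (\<Sum>f\<in>F e. q1)" using m1(3) by (intro sum_mono) (auto simp: F_def)
    also have "\<dots> \<le> 2 ^ (q2 + 2) * q1" using finF[OF that] by simp
    finally show "card (J e) \<le> q2 + 2 ^ (q2 + 2) * q1"
      unfolding J_def using card_Un_le[of "I' e" "\<Union>(I ` F e)"] m2(3)[OF that] by linarith
    show "J e \<inter> B' = {}" unfolding J_def F_def using m2(4)[OF that] m1(4) assms(3) by fastforce
  qed
  moreover have "linked E (J {u, v}) u v" if uv: "{u, v} \<in> H'" for u v
  proof -
    obtain xs where xs: "set xs \<subseteq> I' {u, v}" "walk H (u # xs @ [v])"
      using m2(6)[OF uv] unfolding linked_def by blast
    have "linked E (set xs \<union> \<Union>(I ` {f \<in> H. f \<subseteq> set xs \<union> {u, v}})) u v"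
      using linked_compose[OF xs(2)] m1(6) by blast
    then show ?thesis by (rule linked_mono) (use xs(1) in \<open>auto simp: J_def F_def\<close>)
  qed
  ultimately show ?thesis using m2(1) unfolding subdivision_model_def by blast
qed

lemma subdivision_model_mono:
  assumes "subdivision_model q F B H I" "F \<subseteq> E"
  shows "subdivision_model q E B H I"
proof -
  have lk: "linked F J u v \<Longrightarrow> linked E J u v" for J u v
    using walk_mono[OF _ assms(2)] unfolding linked_def by metis
  show ?thesis unfolding subdivision_model_def
    by (intro conjI ballI allI impI) (use subdivision_modelD[OF assms(1)] lk in simp_all)
qed

lemma subdivision_model_insert:
  assumes I: "subdivision_model q E B H I" and "u \<in> B" "v \<in> B" "u \<noteq> v" "{u, v} \<notin> H"
    and J: "finite J" "card J \<le> q" "J \<inter> B = {}" "J \<inter> \<Union>(I ` H) = {}" "linked E J u v"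
  shows "subdivision_model q E B (insert {u, v} H) (I({u, v} := J))"
proof -
  note m = subdivision_modelD[OF I]
  define I' where "I' = I({u, v} := J)"
  have "linked E (I' {x, y}) x y" if "{x, y} \<in> insert {u, v} H" for x y
  proof (cases "{x, y} = {u, v}")
    case True
    then have "x = u \<and> y = v \<or> x = v \<and> y = u" by (auto simp: doubleton_eq_iff)
    then show ?thesis using J(5) linked_sym True unfolding I'_def by fastforce
  next
    case False
    then show ?thesis using that m(6) unfolding I'_def by auto
  qed
  moreover have "I' f \<inter> I' g = {}" if "f \<in> insert {u, v} H" "g \<in> insert {u, v} H" "f \<noteq> g" for f g
    using that m(5) J(4) assms(5) unfolding I'_def by auto
  moreover have "\<forall>f\<in>insert {u, v} H. finite (I' f) \<and> card (I' f) \<le> q \<and> I' f \<inter> B = {}"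
    using m(2-4) J assms(5) unfolding I'_def by auto
  moreover have "insert {u, v} H \<subseteq> [B]\<^bsup>2\<^esup>" using assms m(1) by simp
  ultimately show ?thesis unfolding subdivision_model_def I'_def by blast
qed

lemma subdivision_model_restrict:
  assumes "subdivision_model q E B H I" "E \<subseteq> [V]\<^bsup>2\<^esup>"
  shows "subdivision_model q E B H (\<lambda>e. I e \<inter> V)"
proof -
  note m = subdivision_modelD[OF assms(1)]
  have "linked E (I {u, v} \<inter> V) u v" if uv: "{u, v} \<in> H" for u v
  proof -
    obtain xs where "set xs \<subseteq> I {u, v}" "walk E (u # xs @ [v])"
      using m(6)[OF uv] unfolding linked_def by blast
    then show ?thesis using walk_subset(1)[OF _ assms(2)] unfolding linked_def by blast
  qed
  moreover have "card (I e \<inter> V) \<le> q" if "e \<in> H" for e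
    using card_mono[of "I e" "I e \<inter> V"] m(2,3)[OF that] by auto
  ultimately show ?thesis using m(1,2,4,5) unfolding subdivision_model_def by blast
qed

text \<open>The paths are chosen one after the other. The branch vertices and the paths chosen earlier form a
  small set, which the next path has to avoid.\<close>

lemma greedy_model:
  assumes "finite H" "H \<subseteq> [B]\<^bsup>2\<^esup>" "finite B"
    and robust: "\<And>u v Z. {u, v} \<in> H \<Longrightarrow> finite Z \<Longrightarrow> card Z \<le> card B + q * card H \<Longrightarrow> 
      \<exists>J. finite J \<and> card J \<le> q \<and> J \<inter> Z = {} \<and> linked E J u v"
  shows "\<exists>I. subdivision_model q E B H I"
proof -
  have "\<exists>I. subdivision_model q E B H' I" if "H' \<subseteq> H" for H'
    using finite_subset[OF that assms(1)] that
  proof (induction H' rule: finite_induct)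
    case empty
    then show ?case unfolding subdivision_model_def by simp
  next
    case (insert e H')
    then obtain I where I: "subdivision_model q E B H' I" by auto
    note m = subdivision_modelD[OF I]
    have "e \<in> [B]\<^bsup>2\<^esup>" using insert assms(2) by auto
    then obtain u v where e: "e = {u, v}" "u \<noteq> v" by (auto elim: nsets2_E)
    define Z where "Z = B \<union> \<Union>(I ` H')"
    have "card (\<Union>(I ` H')) \<le> (\<Sum>f\<in>H'. card (I f))" using card_UN_le insert by blast
    also have "\<dots> \<le> (\<Sum>f\<in>H'. q)" using m(3) by (intro sum_mono)
    also have "\<dots> \<le> q * card H" using card_mono[of H H'] insert assms(1) by (simp add: mult.commute)
    finally have "card Z \<le> card B + q * card H" unfolding Z_def using card_Un_le[of B "\<Union>(I ` H')"] by linarith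
    moreover have "finite Z" unfolding Z_def using assms(3) insert(1) m(2) by auto
    ultimately obtain J where J: "finite J" "card J \<le> q" "J \<inter> Z = {}" "linked E J u v"
      using robust[of u v Z] e insert by auto
    have "subdivision_model q E B (insert e H') (I(e := J))"
      using subdivision_model_insert[OF I, of u v J] J e insert \<open>e \<in> [B]\<^bsup>2\<^esup>\<close> unfolding Z_def by auto
    then show ?case by blast
  qed
  then show ?thesis by blast
qed

section \<open>Dense graphs contain shallow subdivisions of large cliques\<close>

subsection \<open>Averaging\<close>

lemma exists_le_average:
  fixes f :: "'a \<Rightarrow> real"
  assumes "finite A" "A \<noteq> {}" "(\<Sum>a\<in>A. f a) \<le> real (card A) * m"
  shows "\<exists>a\<in>A. f a \<le> m"
proof (rule ccontr)
  assume "\<not> ?thesis"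
  then have "(\<Sum>a\<in>A. m) < (\<Sum>a\<in>A. f a)" using assms by (intro sum_strict_mono) auto
  then show False using assms(3) by simp
qed

text \<open>Markov's inequality for the uniform distribution on \<open>A\<close>.\<close>

lemma markov_card:
  fixes f :: "'a \<Rightarrow> nat"
  assumes "finite A" "real (\<Sum>a\<in>A. f a) \<le> real (card A) * m" "m > 0"
  shows "real (card A) \<le> 2 * real (card {a \<in> A. real (f a) \<le> 2 * m})"
proof -
  let ?B = "{a \<in> A. \<not> real (f a) \<le> 2 * m}"
  have "real (card ?B) * (2 * m) = (\<Sum>a\<in>?B. 2 * m)" by simp
  also have "\<dots> \<le> (\<Sum>a\<in>?B. real (f a))" by (intro sum_mono) auto
  also have "\<dots> \<le> (\<Sum>a\<in>A. real (f a))" using assms(1) by (intro sum_mono2) auto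
  also have "\<dots> \<le> real (card A) * m" using assms(2) by simp
  finally have "real (card ?B) * 2 \<le> real (card A)" using assms(3) by (simp add: mult.assoc[symmetric])
  moreover have "card A = card {a \<in> A. real (f a) \<le> 2 * m} + card ?B"
    using assms(1) by (subst card_Un_disjoint[symmetric]) (auto intro: arg_cong[where f=card])
  ultimately show ?thesis by linarith
qed

text \<open>A maximal independent subset dominates \<open>A\<close>.\<close>

lemma independent_set_greedy:
  fixes D :: real
  assumes "finite A" and "symp R"
    and deg: "\<And>a. a \<in> A \<Longrightarrow> real (card {b \<in> A. b \<noteq> a \<and> R a b}) \<le> D"
  shows "\<exists>I\<subseteq>A. (\<forall>a\<in>I. \<forall>b\<in>I. a \<noteq> b \<longrightarrow> \<not> R a b) \<and> real (card A) \<le> real (card I) * (D + 1)"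
proof -
  define F where "F = {I. I \<subseteq> A \<and> (\<forall>a\<in>I. \<forall>b\<in>I. a \<noteq> b \<longrightarrow> \<not> R a b)}"
  have "finite F" unfolding F_def using assms(1) by (auto intro: finite_subset[of _ "Pow A"])
  moreover have "{} \<in> F" unfolding F_def by simp
  ultimately obtain I where I: "I \<in> F" and max: "\<And>J. J \<in> F \<Longrightarrow> I \<subseteq> J \<Longrightarrow> I = J"
    using finite_has_maximal[of F] by blast
  have finI: "finite I" "I \<subseteq> A" using I assms(1) finite_subset unfolding F_def by auto
  have cover: "A \<subseteq> (\<Union>a\<in>I. insert a {b \<in> A. b \<noteq> a \<and> R a b})"
  proof
    fix x assume x: "x \<in> A"
    show "x \<in> (\<Union>a\<in>I. insert a {b \<in> A. b \<noteq> a \<and> R a b})"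
    proof (rule ccontr)
      assume no: "x \<notin> (\<Union>a\<in>I. insert a {b \<in> A. b \<noteq> a \<and> R a b})"
      then have "x \<notin> I" "\<forall>a\<in>I. \<not> R a x" using x by auto
      then have "insert x I \<in> F" using I x assms(2) unfolding F_def by (auto dest: sympD)
      then show False using max[of "insert x I"] \<open>x \<notin> I\<close> by auto
    qed
  qed
  have "card A \<le> (\<Sum>a\<in>I. card (insert a {b \<in> A. b \<noteq> a \<and> R a b}))"
    by (rule order.trans[OF card_mono[OF _ cover] card_UN_le[OF finI(1)]]) (use finI assms(1) in auto)
  also have "\<dots> = (\<Sum>a\<in>I. Suc (card {b \<in> A. b \<noteq> a \<and> R a b}))" using assms(1) by simp
  finally have "real (card A) \<le> (\<Sum>a\<in>I. real (Suc (card {b \<in> A. b \<noteq> a \<and> R a b})))"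
    unfolding of_nat_sum[symmetric] of_nat_le_iff .
  also have "\<dots> \<le> (\<Sum>a\<in>I. D + 1)" using deg finI by (intro sum_mono) (auto simp: subset_iff)
  finally show ?thesis using I unfolding F_def by auto
qed

subsection \<open>Subgraphs of extremal density\<close>

definition spanned :: "'a set set \<Rightarrow> 'a set \<Rightarrow> 'a set set" where
  "spanned E X = {e \<in> E. e \<subseteq> X}"

text \<open>Both conditions hold if \<open>X\<close> maximises the ratio \<open>c\<close> of the number of spanned edges to the
  \<open>(1 + \<epsilon>)\<close>-th power of the number of vertices: no subset has a larger ratio, and deleting a subset does
  not increase the ratio. They say that small sets are sparse and that every set meets many edges.\<close>

definition extremal :: "real \<Rightarrow> real \<Rightarrow> 'a set set \<Rightarrow> 'a set \<Rightarrow> bool" where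
  "extremal \<epsilon> c E X \<longleftrightarrow> finite X \<and> X \<noteq> {} \<and> E \<subseteq> [X]\<^bsup>2\<^esup> \<and> 
     (\<forall>Y\<subseteq>X. real (card (spanned E Y)) \<le> c * real (card Y) powr (1 + \<epsilon>)) \<and>
     (\<forall>Y\<subseteq>X. real (card {e \<in> E. e \<inter> Y \<noteq> {}}) \<ge> c * real (card Y) * real (card X) powr \<epsilon>)"

text \<open>For the lower bound on the edges that meet \<open>Y\<close>, compare \<open>X\<close> with \<open>X - Y\<close>: the ratio of the latter is at
  most \<open>c\<close>, and \<open>x powr (1 + \<epsilon>)\<close> has slope at least \<open>n powr \<epsilon>\<close> on average between \<open>n - y\<close> and \<open>n\<close>.\<close>

lemma extremal_subgraph:
  assumes "finite V" "V \<noteq> {}" "E \<subseteq> [V]\<^bsup>2\<^esup>" "\<epsilon> > 0" "C > 0"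
    and dense: "real (card E) \<ge> C * real (card V) powr (1 + \<epsilon>)"
  obtains X c where "X \<subseteq> V" "c \<ge> C" "extremal \<epsilon> c (spanned E X) X"
proof -
  define \<phi> where "\<phi> Y = real (card (spanned E Y)) / real (card Y) powr (1 + \<epsilon>)" for Y
  have "finite (\<phi> ` (Pow V - {{}}))" "\<phi> ` (Pow V - {{}}) \<noteq> {}" using assms by auto
  then have "Max (\<phi> ` (Pow V - {{}})) \<in> \<phi> ` (Pow V - {{}})" by (rule Max_in)
  then obtain X where "X \<in> Pow V - {{}}" "\<phi> X = Max (\<phi> ` (Pow V - {{}}))" by (metis imageE)
  then have X: "X \<subseteq> V" "X \<noteq> {}" and max: "\<And>Y. Y \<subseteq> V \<Longrightarrow> Y \<noteq> {} \<Longrightarrow> \<phi> Y \<le> \<phi> X"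
    using assms(1) by (auto intro!: Max_ge)
  define c where "c = \<phi> X"
  have finX: "finite X" using X(1) assms(1) finite_subset by auto
  have sV: "spanned E V = E" using assms(3) by (auto simp: spanned_def nsets_def)
  have "C \<le> \<phi> V" using dense assms(1,2) sV unfolding \<phi>_def 
    by (simp add: le_divide_eq card_gt_0_iff)
  then have c: "c \<ge> C" "c > 0" using max[of V] assms unfolding c_def by auto
  have sp: "real (card (spanned E Y)) \<le> c * real (card Y) powr (1 + \<epsilon>)" if "Y \<subseteq> V" for Y
  proof (cases "Y = {}")
    case True
    then have "spanned E Y = {}" using assms(3) by (auto simp: spanned_def nsets_def)
    then show ?thesis using c by simp
  next
    case False
    then have "card Y > 0" using that assms(1) finite_subset card_gt_0_iff by blast
    then show ?thesis using max[OF that False] unfolding c_def[symmetric] \<phi>_def[of Y]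
      by (simp add: divide_le_eq)
  qed
  have eq: "real (card (spanned E X)) = c * real (card X) powr (1 + \<epsilon>)"
    unfolding c_def \<phi>_def using X finX by simp
  have finE: "finite E" using assms finite_edges by blast
  have inc: "real (card {e \<in> spanned E X. e \<inter> Y \<noteq> {}}) \<ge> c * real (card Y) * real (card X) powr \<epsilon>"
    if Y: "Y \<subseteq> X" for Y
  proof -
    let ?n = "real (card X)" and ?y = "real (card Y)"
    have "spanned E X - {e \<in> spanned E X. e \<inter> Y \<noteq> {}} = spanned E (X - Y)"
      by (auto simp: spanned_def)
    then have f1: "card (spanned E X) = card {e \<in> spanned E X. e \<inter> Y \<noteq> {}} + card (spanned E (X - Y))"
      using finE by (metis (no_types, lifting) card_Diff_subset card_mono finite_subset le_add_diff_inverse mem_Collect_eq spanned_def subsetI)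
    have f2: "real (card (spanned E (X - Y))) \<le> c * real (card (X - Y)) powr (1 + \<epsilon>)"
      using sp[of "X - Y"] X(1) by auto
    have f3: "real (card (X - Y)) = ?n - ?y"
      using Y finX by (metis card_Diff_subset card_mono finite_subset of_nat_diff)
    have f4: "(?n - ?y) powr (1 + \<epsilon>) \<le> (?n - ?y) * ?n powr \<epsilon>"
    proof -
      have "0 \<le> ?n - ?y" using card_mono[OF finX Y] by simp
      then have "(?n - ?y) powr (1 + \<epsilon>) = (?n - ?y) * (?n - ?y) powr \<epsilon>" 
        by (metis powr_mult_base)
      also have "\<dots> \<le> (?n - ?y) * ?n powr \<epsilon>" using \<open>0 \<le> ?n - ?y\<close> assms(4)
        by (intro mult_left_mono powr_mono2) auto
      finally show ?thesis .
    qed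
    have f5: "?n powr (1 + \<epsilon>) = ?n * ?n powr \<epsilon>" by (simp add: powr_mult_base)
    have "c * (?n - ?y) powr (1 + \<epsilon>) \<le> c * ((?n - ?y) * ?n powr \<epsilon>)"
      using f4 c(2) by (intro mult_left_mono) auto
    moreover have "real (card (spanned E X)) = c * (?n * ?n powr \<epsilon>)" using eq f5 by simp
    moreover have "real (card (spanned E (X - Y))) \<le> c * (?n - ?y) powr (1 + \<epsilon>)" using f2 f3 by simp
    ultimately have "c * (?n * ?n powr \<epsilon>) - c * ((?n - ?y) * ?n powr \<epsilon>)
        \<le> real (card {e \<in> spanned E X. e \<inter> Y \<noteq> {}})"
      using f1 by linarith
    then show ?thesis by (simp add: algebra_simps)
  qed
  have sub: "spanned E X \<subseteq> [X]\<^bsup>2\<^esup>" using assms(3) by (auto simp: spanned_def nsets_def)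
  have ss: "spanned (spanned E X) Y = spanned E Y" if "Y \<subseteq> X" for Y
    using that by (auto simp: spanned_def)
  have "extremal \<epsilon> c (spanned E X) X"
    unfolding extremal_def
  proof (intro conjI allI impI)
    fix Y assume "Y \<subseteq> X"
    then show "real (card (spanned (spanned E X) Y)) \<le> c * real (card Y) powr (1 + \<epsilon>)"
      using sp[of Y] X(1) ss[of Y] by simp
  qed (use finX X sub inc in auto)
  then show ?thesis using that X(1) c(1) by blast
qed

subsection \<open>Balls grow even when a small set is deleted\<close>

definition grow :: "'a set set \<Rightarrow> 'a set \<Rightarrow> 'a set \<Rightarrow> 'a set" where
  "grow E Z Y = (Y \<union> {y. \<exists>x\<in>Y. {x, y} \<in> E}) - Z"

lemma grow_subset: "E \<subseteq> [X]\<^bsup>2\<^esup> \<Longrightarrow> Y \<subseteq> X \<Longrightarrow> grow E Z Y \<subseteq> X"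
  unfolding grow_def using edge_ends[of E X] by blast

text \<open>At least \<open>c * |Y| * n powr \<epsilon>\<close> edges meet \<open>Y\<close>. Few of them end in \<open>Z\<close>, because the small set
  \<open>Y \<union> Z\<close> is sparse. All others lie inside the grown set, which for this has to be larger than \<open>Y\<close> by a
  factor that is a fixed power of \<open>n\<close>.\<close>

lemma extremal_grow:
  assumes ex: "extremal \<epsilon> c E X" and "0 < \<epsilon>" "\<epsilon> \<le> 1/2" "c > 0"
    and Y: "Y \<subseteq> X" "Y \<noteq> {}" "Y \<inter> Z = {}" "finite Z" "card Z \<le> card Y"
    and small: "real (card Y) \<le> real (card X) powr (1 - \<epsilon> / 2)"
    and large: "real (card X) powr (\<epsilon> ^ 2 / 4) \<ge> 8"
  shows "real (card (grow E Z Y)) \<ge> real (card X) powr (\<epsilon> ^ 2 / 8) * real (card Y)"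
proof (rule ccontr)
  let ?n = "real (card X)" and ?y = "real (card Y)"
  define y' where "y' = real (card (grow E Z Y))"
  assume "\<not> ?thesis"
  then have less: "y' < ?n powr (\<epsilon> ^ 2 / 8) * ?y" unfolding y'_def by simp
  have fin: "finite X" "E \<subseteq> [X]\<^bsup>2\<^esup>" using ex unfolding extremal_def by auto
  then have fin: "finite X" "finite Y" "E \<subseteq> [X]\<^bsup>2\<^esup>" "finite E" 
    using Y(1) finite_subset finite_edges[of X E] by auto
  have y1: "?y \<ge> 1" using Y(2) fin by (simp add: Suc_leI card_gt_0_iff)
  have n1: "?n \<ge> 1" using card_mono[OF fin(1) Y(1)] y1 by linarith
  have gX: "grow E Z Y \<subseteq> X" using grow_subset fin Y by blast
  have cover: "{e \<in> E. e \<inter> Y \<noteq> {}} \<subseteq> spanned E (grow E Z Y) \<union> spanned E ((Y \<union> Z) \<inter> X)"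
  proof
    fix e assume e: "e \<in> {e \<in> E. e \<inter> Y \<noteq> {}}"
    then have "e \<in> [X]\<^bsup>2\<^esup>" using fin by auto
    then obtain a b where ab: "e = {a, b}" "a \<in> X" "b \<in> X" by (auto elim: nsets2_E)
    obtain x y where xy: "e = {x, y}" "x \<in> Y" "y \<in> X"
    proof (cases "a \<in> Y")
      case True
      then show ?thesis using that ab by blast
    next
      case False
      then show ?thesis using that[of b a] ab e by auto
    qed
    then show "e \<in> spanned E (grow E Z Y) \<union> spanned E ((Y \<union> Z) \<inter> X)"
      using e Y by (cases "y \<in> Z") (auto simp: spanned_def grow_def)
  qed
  have "card {e \<in> E. e \<inter> Y \<noteq> {}} \<le> card (spanned E (grow E Z Y)) + card (spanned E ((Y \<union> Z) \<inter> X))"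
    by (rule order.trans[OF card_mono[OF _ cover] card_Un_le]) (use fin in \<open>auto simp: spanned_def\<close>)
  then have "real (card {e \<in> E. e \<inter> Y \<noteq> {}}) \<le> real (card (spanned E (grow E Z Y))) + real (card (spanned E ((Y \<union> Z) \<inter> X)))"
    by linarith
  also have "real (card (spanned E (grow E Z Y))) \<le> c * y' powr (1 + \<epsilon>)"
    using ex gX unfolding extremal_def y'_def by blast
  also have "real (card (spanned E ((Y \<union> Z) \<inter> X))) \<le> c * real (card ((Y \<union> Z) \<inter> X)) powr (1 + \<epsilon>)"
    using ex unfolding extremal_def by blast
  also have "\<dots> \<le> c * (2 * ?y) powr (1 + \<epsilon>)"
  proof -
    have "card ((Y \<union> Z) \<inter> X) \<le> card (Y \<union> Z)" using fin Y by (intro card_mono) auto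
    also have "\<dots> \<le> 2 * card Y" using card_Un_le[of Y Z] Y by linarith
    finally show ?thesis using assms(2,4) by (intro mult_left_mono powr_mono2) auto
  qed
  finally have "c * ?y * ?n powr \<epsilon> \<le> c * (y' powr (1 + \<epsilon>) + (2 * ?y) powr (1 + \<epsilon>))"
    using ex Y unfolding extremal_def by (simp add: algebra_simps) (meson order_trans)
  then have main: "?y * ?n powr \<epsilon> \<le> y' powr (1 + \<epsilon>) + (2 * ?y) powr (1 + \<epsilon>)"
    using assms(4) by (simp add: mult.assoc)
  have ye: "?y powr \<epsilon> \<le> ?n powr (\<epsilon> - \<epsilon> ^ 2 / 2)"
  proof -
    have "?y powr \<epsilon> \<le> (?n powr (1 - \<epsilon> / 2)) powr \<epsilon>" using small y1 assms(2) by (intro powr_mono2) auto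
    also have "\<dots> = ?n powr (\<epsilon> - \<epsilon> ^ 2 / 2)" by (simp add: powr_powr algebra_simps power2_eq_square)
    finally show ?thesis .
  qed
  define w where "w = ?n powr (\<epsilon> ^ 2 / 4)"
  have w: "w \<ge> 8" using large w_def by simp
  have nw: "?n powr \<epsilon> = ?n powr (\<epsilon> - \<epsilon> ^ 2 / 2) * (w * w)" "?n powr (\<epsilon> - \<epsilon> ^ 2 / 2) > 0"
    unfolding w_def using n1 by (auto simp: powr_add[symmetric])
  have "(2 * ?y) powr (1 + \<epsilon>) = (2 powr (1 + \<epsilon>)) * (?y * ?y powr \<epsilon>)"
    using y1 by (simp add: powr_mult powr_mult_base)
  also have "\<dots> \<le> 4 * (?y * ?n powr (\<epsilon> - \<epsilon> ^ 2 / 2))"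
  proof -
    have "(2::real) powr (1 + \<epsilon>) \<le> 2 powr 2" using assms(3) by (intro powr_mono) auto
    then show ?thesis using ye y1 by (intro mult_mono) auto
  qed
  finally have a: "(2 * ?y) powr (1 + \<epsilon>) \<le> 4 * (?y * ?n powr (\<epsilon> - \<epsilon> ^ 2 / 2))" .
  have "y' powr (1 + \<epsilon>) \<le> (?n powr (\<epsilon> ^ 2 / 8) * ?y) powr (1 + \<epsilon>)"
    using less assms(2) by (intro powr_mono2) (auto simp: y'_def)
  also have "\<dots> = (?n powr (\<epsilon> ^ 2 / 8)) powr (1 + \<epsilon>) * (?y * ?y powr \<epsilon>)"
    using y1 n1 by (simp add: powr_mult powr_mult_base)
  also have "\<dots> \<le> w * (?y * ?n powr (\<epsilon> - \<epsilon> ^ 2 / 2))"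
  proof -
    have "(?n powr (\<epsilon> ^ 2 / 8)) powr (1 + \<epsilon>) = ?n powr (\<epsilon> ^ 2 / 8 * (1 + \<epsilon>))" by (simp add: powr_powr)
    also have "\<dots> \<le> ?n powr (\<epsilon> ^ 2 / 4)"
    proof (rule powr_mono)
      have "\<epsilon> ^ 2 / 8 * (1 + \<epsilon>) \<le> \<epsilon> ^ 2 / 8 * 2" using assms by (intro mult_left_mono) auto
      then show "\<epsilon> ^ 2 / 8 * (1 + \<epsilon>) \<le> \<epsilon> ^ 2 / 4" by simp
    qed (use n1 in auto)
    finally show ?thesis using ye y1 unfolding w_def by (intro mult_mono) auto
  qed
  finally have b: "y' powr (1 + \<epsilon>) \<le> w * (?y * ?n powr (\<epsilon> - \<epsilon> ^ 2 / 2))" .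
  define m where "m = ?y * ?n powr (\<epsilon> - \<epsilon> ^ 2 / 2)"
  have "m > 0" using nw(2) y1 m_def by auto
  have "m * (w * w) \<le> w * m + 4 * m" using main a b nw(1) unfolding m_def by (simp add: algebra_simps)
  then have "w * w \<le> w + 4" using \<open>m > 0\<close> by (simp add: algebra_simps flip: distrib_left)
  moreover have "w * w \<ge> 8 * w" using w by (intro mult_right_mono) auto
  ultimately show False using w by linarith
qed

text \<open>The \<open>i\<close>-fold iteration of \<^term>\<open>grow E Z\<close> on a singleton is the ball of radius \<open>i\<close> in the graph
  without \<open>Z\<close>, except that its centre may belong to \<open>Z\<close>.\<close>

lemma ball_walk:
  assumes "y \<in> (grow E Z ^^ Suc i) {a}"
  shows "y \<notin> Z \<and> (y = a \<or> (\<exists>xs. length xs \<le> i \<and> set xs \<inter> Z = {} \<and> walk E (a # xs @ [y])))"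
  using assms
proof (induction i arbitrary: y)
  case 0
  have "y = a \<or> walk E (a # [] @ [y])" using 0 by (auto simp: grow_def)
  moreover have "y \<notin> Z" using 0 by (simp add: grow_def)
  ultimately show ?case by (intro conjI) (auto intro!: exI[of _ "[]"])
next
  case (Suc i)
  then have y: "y \<in> grow E Z ((grow E Z ^^ Suc i) {a})" by simp
  show ?case
  proof (cases "y \<in> (grow E Z ^^ Suc i) {a}")
    case True
    then show ?thesis using Suc.IH[OF True] by (metis le_Suc_eq)
  next
    case False
    then obtain x where x: "x \<in> (grow E Z ^^ Suc i) {a}" "{x, y} \<in> E" "y \<notin> Z"
      using y unfolding grow_def by blast
    from Suc.IH[OF x(1)] show ?thesis
    proof (elim conjE disjE exE)
      assume "x = a"
      then have "length [] \<le> Suc i \<and> set [] \<inter> Z = {} \<and> walk E (a # [] @ [y])" using x by auto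
      then show ?thesis using x(3) by blast
    next
      fix xs assume xs: "x \<notin> Z" "length xs \<le> i" "set xs \<inter> Z = {}" "walk E (a # xs @ [x])"
      have "walk E (a # (xs @ [x]) @ [y])" using xs x walk_append[of E "a # xs" x "[y]"] by auto
      moreover have "length (xs @ [x]) \<le> Suc i" "set (xs @ [x]) \<inter> Z = {}" using xs by auto
      ultimately show ?thesis using x(3) by blast
    qed
  qed
qed

lemma ball_subset: "E \<subseteq> [X]\<^bsup>2\<^esup> \<Longrightarrow> a \<in> X \<Longrightarrow> (grow E Z ^^ i) {a} \<subseteq> X"
  by (induction i) (simp_all add: grow_subset)

text \<open>The degree of \<open>a\<close> makes the ball of radius 1 at least as large as \<open>Z\<close>. From then on each step multiplies
  the size by \<open>n powr (\<epsilon>\<^sup>2 / 8)\<close>, so that a bounded number of steps suffices.\<close>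

lemma ball_large:
  assumes ex: "extremal \<epsilon> c E X" and "0 < \<epsilon>" "\<epsilon> \<le> 1/2" "c > 0"
    and "finite Z" "real (card Z) \<le> c / 2 * real (card X) powr \<epsilon>" "a \<in> X"
    and large: "real (card X) powr (\<epsilon> ^ 2 / 4) \<ge> 8"
    and p: "real p * (\<epsilon> ^ 2 / 8) \<ge> 1"
  shows "real (card ((grow E Z ^^ Suc p) {a})) \<ge> real (card X) powr (1 - \<epsilon> / 2)"
proof -
  let ?n = "real (card X)"
  define S where "S i = (grow E Z ^^ Suc i) {a}" for i
  have X: "finite X" "E \<subseteq> [X]\<^bsup>2\<^esup>" "card X > 0" "finite E" 
    using ex finite_edges[of X E] unfolding extremal_def by (auto simp: card_gt_0_iff)
  have n1: "?n \<ge> 1" using X(3) by linarith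
  have SX: "S i \<subseteq> X" for i unfolding S_def by (rule ball_subset[OF X(2) assms(7)])
  have finS: "finite (S i)" for i by (rule finite_subset[OF SX X(1)])
  have SZ: "S i \<inter> Z = {}" for i unfolding S_def by (simp add: grow_def) blast
  have Ssuc: "S (Suc i) = grow E Z (S i)" for i unfolding S_def by simp
  have mono: "S i \<subseteq> S (Suc i)" for i using SZ[of i] unfolding Ssuc by (auto simp: grow_def)
  have S0: "real (card (S 0)) \<ge> c / 2 * ?n powr \<epsilon>"
  proof -
    define N where "N = {x \<in> X. {a, x} \<in> E}"
    have "{e \<in> E. e \<inter> {a} \<noteq> {}} \<subseteq> (\<lambda>x. {a, x}) ` N"
      unfolding N_def by (rule incident_edges[OF X(2)])
    then have g1: "card {e \<in> E. e \<inter> {a} \<noteq> {}} \<le> card N"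
      using X(1) by (intro surj_card_le) (auto simp: N_def)
    have "c * real (card {a}) * ?n powr \<epsilon> \<le> real (card {e \<in> E. e \<inter> {a} \<noteq> {}})"
      using ex assms(7) unfolding extremal_def by blast
    then have g2: "c * ?n powr \<epsilon> \<le> real (card {e \<in> E. e \<inter> {a} \<noteq> {}})" by simp
    have "N \<subseteq> S 0 \<union> Z" by (auto simp: N_def S_def grow_def)
    then have g3: "card N \<le> card (S 0) + card Z"
      using card_mono[of "S 0 \<union> Z" N] card_Un_le[of "S 0" Z] finS[of 0] assms(5) by auto
    show ?thesis using assms(6) g1 g2 g3 by linarith
  qed
  have pos: "c / 2 * ?n powr \<epsilon> > 0" using assms(4) n1 by simp
  have inv: "card Z \<le> card (S i) \<and> S i \<noteq> {}" for i
  proof (induction i)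
    case 0
    have "real (card Z) \<le> real (card (S 0))" "real (card (S 0)) > 0" using S0 assms(6) pos by linarith+
    then show ?case by auto
  next
    case (Suc i)
    then show ?case using card_mono[OF finS mono, of i] mono[of i] by (auto intro: order.trans)
  qed
  have "real (card (S i)) \<ge> ?n powr (1 - \<epsilon> / 2) \<or> real (card (S i)) \<ge> ?n powr (real i * (\<epsilon> ^ 2 / 8))" for i
  proof (induction i)
    case 0
    have "card (S 0) > 0" using inv[of 0] finS[of 0] by (simp add: card_gt_0_iff)
    then show ?case using n1 by simp
  next
    case (Suc i)
    show ?case
    proof (cases "real (card (S i)) \<ge> ?n powr (1 - \<epsilon> / 2)")
      case True
      then show ?thesis using card_mono[OF finS mono, of i] by linarith
    next
      case False
      then have "real (card (S (Suc i))) \<ge> ?n powr (\<epsilon> ^ 2 / 8) * real (card (S i))"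
        unfolding Ssuc using extremal_grow[OF ex assms(2-4) SX _ SZ assms(5) _ _ large, of i] inv[of i] by auto
      moreover have "?n powr (\<epsilon> ^ 2 / 8) * real (card (S i)) \<ge> ?n powr (\<epsilon> ^ 2 / 8) * ?n powr (real i * (\<epsilon> ^ 2 / 8))"
        using Suc False by (intro mult_left_mono) auto
      ultimately have "real (card (S (Suc i))) \<ge> ?n powr (\<epsilon> ^ 2 / 8) * ?n powr (real i * (\<epsilon> ^ 2 / 8))"
        by linarith
      also have "?n powr (\<epsilon> ^ 2 / 8) * ?n powr (real i * (\<epsilon> ^ 2 / 8)) = ?n powr (real (Suc i) * (\<epsilon> ^ 2 / 8))"
        unfolding powr_add[symmetric] by (rule arg_cong[where f = "\<lambda>x. ?n powr x"]) (simp add: field_simps)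
      finally show ?thesis by blast
    qed
  qed
  from this[of p] have "real (card (S p)) \<ge> ?n powr (1 - \<epsilon> / 2)"
  proof
    assume "?n powr (real p * (\<epsilon> ^ 2 / 8)) \<le> real (card (S p))"
    moreover have "?n powr (1 - \<epsilon> / 2) \<le> ?n powr (real p * (\<epsilon> ^ 2 / 8))"
      using p assms(2) n1 by (intro powr_mono) auto
    ultimately show ?thesis by linarith
  qed
  then show ?thesis unfolding S_def .
qed

subsection \<open>Robustly linked pairs\<close>

text \<open>The walk may depend on the deleted set \<open>Z\<close>. Robustly linked pairs are almost as good as edges: many of
  them can be replaced by disjoint paths.\<close>

definition robust :: "'a set set \<Rightarrow> nat \<Rightarrow> nat \<Rightarrow> 'a \<Rightarrow> 'a \<Rightarrow> bool" where
  "robust E q z a b \<longleftrightarrow> (\<forall>Z. finite Z \<and> card Z \<le> z \<longrightarrow> 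
     (\<exists>xs. length xs \<le> q \<and> set xs \<inter> Z = {} \<and> walk E (a # xs @ [b])))"

lemma robust_sym: "robust E q z a b \<Longrightarrow> robust E q z b a"
proof -
  have "walk E (b # rev xs @ [a]) \<longleftrightarrow> walk E (a # xs @ [b])" for xs
    using walk_rev[of E "a # xs @ [b]"] by simp
  moreover assume "robust E q z a b"
  ultimately show ?thesis unfolding robust_def by (metis length_rev set_rev)
qed

text \<open>Otherwise delete, for every pair in \<open>A\<close>, a set that separates it. The union of these sets is still so small
  that the balls around the vertices of \<open>A\<close> remain large. A common vertex of two balls would link a separated
  pair, so the balls are disjoint, but there are too many of them to fit into \<open>X\<close>.\<close>

lemma robust_pair_exists:
  assumes ex: "extremal \<epsilon> c E X" and "0 < \<epsilon>" "\<epsilon> \<le> 1/2" "c > 0"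
    and large: "real (card X) powr (\<epsilon> ^ 2 / 4) \<ge> 8"
    and p: "real p * (\<epsilon> ^ 2 / 8) \<ge> 1"
    and A: "A \<subseteq> X" "real (card A) * real (card X) powr (1 - \<epsilon> / 2) > real (card X)"
    and z: "real (card A * card A * z) \<le> c / 2 * real (card X) powr \<epsilon>"
  shows "\<exists>a\<in>A. \<exists>b\<in>A. a \<noteq> b \<and> robust E (2 * p + 1) z a b"
proof (rule ccontr)
  assume no: "\<not> ?thesis"
  have "\<forall>a b. a \<in> A \<and> b \<in> A \<and> a \<noteq> b \<longrightarrow> (\<exists>Z. finite Z \<and> card Z \<le> z \<and>
     (\<forall>xs. length xs \<le> 2 * p + 1 \<longrightarrow> set xs \<inter> Z = {} \<longrightarrow> \<not> walk E (a # xs @ [b])))"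
    using no unfolding robust_def by meson
  then obtain Zf where Zf: "\<And>a b. a \<in> A \<Longrightarrow> b \<in> A \<Longrightarrow> a \<noteq> b \<Longrightarrow> finite (Zf a b) \<and> card (Zf a b) \<le> z \<and>
     (\<forall>xs. length xs \<le> 2 * p + 1 \<longrightarrow> set xs \<inter> Zf a b = {} \<longrightarrow> \<not> walk E (a # xs @ [b]))"
    by metis
  define Q where "Q = {(a, b) \<in> A \<times> A. a \<noteq> b}"
  define Z where "Z = (\<Union>(a, b)\<in>Q. Zf a b)"
  have X: "finite X" "E \<subseteq> [X]\<^bsup>2\<^esup>" using ex unfolding extremal_def by auto
  have finA: "finite A" using A X finite_subset by auto
  have Q: "finite Q" "card Q \<le> card A * card A"
    using finA finite_subset[of Q "A \<times> A"] card_mono[of "A \<times> A" Q] unfolding Q_def 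
    by (auto simp: card_cartesian_product)
  have finZ: "finite Z" unfolding Z_def using Q Zf by (auto simp: Q_def)
  have "card Z \<le> (\<Sum>(a, b)\<in>Q. card (Zf a b))" unfolding Z_def
    using card_UN_le[OF Q(1), of "\<lambda>(a, b). Zf a b"] by (simp add: case_prod_unfold)
  also have "\<dots> \<le> (\<Sum>(a, b)\<in>Q. z)" using Zf by (intro sum_mono) (auto simp: Q_def)
  also have "\<dots> \<le> card A * card A * z" using Q by simp
  finally have cZ: "real (card Z) \<le> c / 2 * real (card X) powr \<epsilon>" using z by linarith
  define R where "R a = (grow E Z ^^ Suc p) {a}" for a
  have R: "R a \<subseteq> X" "real (card (R a)) \<ge> real (card X) powr (1 - \<epsilon> / 2)" if "a \<in> A" for a
    using ball_subset[OF X(2)] ball_large[OF ex assms(2-4) finZ cZ _ large p] A that unfolding R_def by blast+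
  have "R a \<inter> R b = {}" if ab: "a \<in> A" "b \<in> A" "a \<noteq> b" for a b
  proof (rule ccontr)
    assume "R a \<inter> R b \<noteq> {}"
    then obtain y where y: "y \<in> R a" "y \<in> R b" by blast
    have sub: "Zf a b \<subseteq> Z" unfolding Z_def using that by (auto simp: Q_def)
    have rv: "walk E (y # rev ys @ [b]) \<longleftrightarrow> walk E (b # ys @ [y])" for ys
      using walk_rev[of E "b # ys @ [y]"] by simp
    have "\<exists>xs. length xs \<le> 2 * p + 1 \<and> set xs \<inter> Z = {} \<and> walk E (a # xs @ [b])"
    proof (cases "y = a \<or> y = b")
      case True
      then show ?thesis
      proof
        assume "y = a"
        then obtain ys where "length ys \<le> p" "set ys \<inter> Z = {}" "walk E (b # ys @ [a])"
          using ball_walk[OF y(2)[unfolded R_def]] ab by auto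
        then show ?thesis using rv[of ys] \<open>y = a\<close> by (intro exI[of _ "rev ys"]) auto
      next
        assume "y = b"
        then obtain ys where "length ys \<le> p" "set ys \<inter> Z = {}" "walk E (a # ys @ [b])"
          using ball_walk[OF y(1)[unfolded R_def]] ab by auto
        then show ?thesis by (intro exI[of _ ys]) auto
      qed
    next
      case False
      then obtain xs ys where xs: "length xs \<le> p" "set xs \<inter> Z = {}" "walk E (a # xs @ [y])"
        and ys: "length ys \<le> p" "set ys \<inter> Z = {}" "walk E (b # ys @ [y])" and "y \<notin> Z"
        using ball_walk[OF y(1)[unfolded R_def]] ball_walk[OF y(2)[unfolded R_def]] by auto
      have "walk E ((a # xs) @ y # rev ys @ [b])"
        using xs(3) rv[of ys] ys(3) walk_append[of E "a # xs" y "rev ys @ [b]"] by simp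
      then show ?thesis using xs ys \<open>y \<notin> Z\<close> by (intro exI[of _ "xs @ y # rev ys"]) auto
    qed
    then show False using Zf[OF ab] sub by blast
  qed
  then have "card (\<Union>(R ` A)) = (\<Sum>a\<in>A. card (R a))"
    using finA finite_subset[OF R(1) X(1)] by (intro card_UN_disjoint) auto
  moreover have "card (\<Union>(R ` A)) \<le> card X" using R(1) X(1) by (intro card_mono) auto
  moreover have "(\<Sum>a\<in>A. real (card (R a))) \<ge> (\<Sum>a\<in>A. real (card X) powr (1 - \<epsilon> / 2))"
    using R(2) by (intro sum_mono)
  ultimately have "real (card A) * real (card X) powr (1 - \<epsilon> / 2) \<le> real (card X)"
    unfolding of_nat_sum[symmetric] sum_constant by linarith
  then show False using A(2) by simp
qed

subsection \<open>Cliques in the graph of robustly linked pairs\<close>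

text \<open>Double counting of the pairs with few common neighbours inside the neighbourhood of a
  single vertex: for some vertex of large degree they are so few that a large subset of the
  neighbourhood avoids them altogether.\<close>

lemma large_codegree_set:
  fixes X :: "'a set" and M D :: real
  assumes "finite X" "X \<noteq> {}" "symp R" "D > 0" "L > 0" "M > 0"
    and indep: "\<And>I. I \<subseteq> X \<Longrightarrow> (\<And>a b. a \<in> I \<Longrightarrow> b \<in> I \<Longrightarrow> a \<noteq> b \<Longrightarrow> \<not> R a b) \<Longrightarrow> real (card I) < M"
    and D: "M * (D + 1) \<le> real (card X) / 2"
    and t: "real t * 10 * real L * real (card X) \<le> D ^ 2"
  shows "\<exists>B\<subseteq>X. card B = t \<and> (\<forall>a\<in>B. \<forall>b\<in>B. a \<noteq> b \<longrightarrow> 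
    card {w \<in> X. w \<noteq> a \<and> w \<noteq> b \<and> R w a \<and> R w b} \<ge> L)"
proof -
  let ?n = "real (card X)"
  define N where "N w = {a \<in> X. a \<noteq> w \<and> R w a}" for w
  define W where "W = {w \<in> X. real (card (N w)) > D}"
  define bad where "bad a b \<longleftrightarrow> card {w \<in> X. w \<noteq> a \<and> w \<noteq> b \<and> R w a \<and> R w b} < L" for a b
  have n0: "?n > 0" using assms(1,2) by (simp add: card_gt_0_iff)
  have finN: "finite (N w)" for w unfolding N_def using assms(1) by simp
  have "\<exists>I\<subseteq>X - W. (\<forall>a\<in>I. \<forall>b\<in>I. a \<noteq> b \<longrightarrow> \<not> R a b) \<and> real (card (X - W)) \<le> real (card I) * (D + 1)"
  proof (rule independent_set_greedy)
    fix a assume a: "a \<in> X - W"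
    have "card {b \<in> X - W. b \<noteq> a \<and> R a b} \<le> card (N a)"
      using finN by (intro card_mono) (auto simp: N_def)
    then show "real (card {b \<in> X - W. b \<noteq> a \<and> R a b}) \<le> D" using a by (auto simp: W_def)
  qed (use assms in auto)
  then obtain I where I: "I \<subseteq> X - W" "\<forall>a\<in>I. \<forall>b\<in>I. a \<noteq> b \<longrightarrow> \<not> R a b"
    "real (card (X - W)) \<le> real (card I) * (D + 1)" by blast
  have "real (card I) \<le> M" using indep[of I] I by fastforce
  then have "real (card I) * (D + 1) \<le> M * (D + 1)" using assms(4) by (intro mult_right_mono) auto
  then have "real (card (X - W)) \<le> ?n / 2" using I(3) D by linarith
  moreover have WX: "W \<subseteq> X" unfolding W_def by auto
  then have "real (card (X - W)) = ?n - real (card W)"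
    using assms(1) by (metis card_Diff_subset card_mono finite_subset of_nat_diff)
  ultimately have cW: "real (card W) \<ge> ?n / 2" by linarith
  have finW: "finite W" "W \<noteq> {}" using cW n0 WX assms(1) finite_subset by auto
  define P where "P w = {(a, b) \<in> N w \<times> N w. bad a b}" for w
  have finP: "finite (P w)" for w unfolding P_def using finN by (auto intro: finite_subset[of _ "N w \<times> N w"])
  have "(\<Sum>w\<in>W. card (P w)) = card (SIGMA w:W. P w)" using finW finP by simp
  also have "\<dots> \<le> card (SIGMA p:X \<times> X. if bad (fst p) (snd p) then {w \<in> X. w \<noteq> fst p \<and> w \<noteq> snd p \<and> R w (fst p) \<and> R w (snd p)} else {})"
    (is "_ \<le> card ?T")
  proof (rule card_inj_on_le[where f = "\<lambda>(w, p). (p, w)"])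
    show "finite ?T" using assms(1) by (intro finite_SigmaI) auto
  qed (auto simp: inj_on_def P_def N_def W_def)
  also have "\<dots> = (\<Sum>p\<in>X \<times> X. card (if bad (fst p) (snd p) then {w \<in> X. w \<noteq> fst p \<and> w \<noteq> snd p \<and> R w (fst p) \<and> R w (snd p)} else {}))"
    using assms(1) by (intro card_SigmaI) auto
  also have "\<dots> \<le> (\<Sum>p\<in>X \<times> X. L)" by (intro sum_mono) (auto simp: bad_def)
  finally have "(\<Sum>w\<in>W. card (P w)) \<le> card X * card X * L" by (simp add: card_cartesian_product)
  then have "real (\<Sum>w\<in>W. card (P w)) \<le> real (card X * card X * L)" by (simp only: of_nat_le_iff)
  also have "\<dots> = ?n / 2 * (2 * ?n * real L)" by simp
  also have "\<dots> \<le> real (card W) * (2 * ?n * real L)" using cW by (intro mult_right_mono) auto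
  finally obtain w where w: "w \<in> W" "real (card (P w)) \<le> 2 * ?n * real L"
    using exists_le_average[OF finW, of "\<lambda>w. real (card (P w))"] by auto
  define \<nu> where "\<nu> = real (card (N w))"
  have \<nu>: "\<nu> > D" "\<nu> \<le> ?n" using w(1) card_mono[OF assms(1), of "N w"] unfolding \<nu>_def W_def N_def by auto
  define m where "m = 2 * ?n * real L / \<nu>"
  have m: "m > 0" unfolding m_def using n0 \<nu> assms(4,5) by simp
  define d where "d a = card {b \<in> N w. bad a b}" for a
  have "card (P w) = (\<Sum>a\<in>N w. d a)"
  proof -
    have "P w = (SIGMA a:N w. {b \<in> N w. bad a b})" unfolding P_def by auto
    then show ?thesis unfolding d_def using finN by simp
  qed
  then have "real (\<Sum>a\<in>N w. d a) \<le> real (card (N w)) * m" using w(2) \<nu> assms(4) unfolding m_def \<nu>_def by auto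
  from markov_card[OF finN this m] have half: "\<nu> \<le> 2 * real (card {a \<in> N w. real (d a) \<le> 2 * m})" 
    unfolding \<nu>_def .
  define A where "A = {a \<in> N w. real (d a) \<le> 2 * m}"
  have "\<exists>J\<subseteq>A. (\<forall>a\<in>J. \<forall>b\<in>J. a \<noteq> b \<longrightarrow> \<not> bad a b) \<and> real (card A) \<le> real (card J) * (2 * m + 1)"
  proof (rule independent_set_greedy)
    show "finite A" unfolding A_def using finN by simp
    have "{w \<in> X. w \<noteq> a \<and> w \<noteq> b \<and> R w a \<and> R w b} = {w \<in> X. w \<noteq> b \<and> w \<noteq> a \<and> R w b \<and> R w a}" for a b
      by auto
    then show "symp bad" unfolding bad_def by (auto simp: symp_def)
    fix a assume "a \<in> A"
    moreover have "card {b \<in> A. b \<noteq> a \<and> bad a b} \<le> d a"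
      unfolding d_def using finN by (intro card_mono) (auto simp: A_def)
    ultimately show "real (card {b \<in> A. b \<noteq> a \<and> bad a b}) \<le> 2 * m" unfolding A_def by auto
  qed
  then obtain J where J: "J \<subseteq> A" "\<forall>a\<in>J. \<forall>b\<in>J. a \<noteq> b \<longrightarrow> \<not> bad a b" 
    "real (card A) \<le> real (card J) * (2 * m + 1)" by blast
  have "\<nu> / 2 \<le> real (card J) * (2 * m + 1)" using half J(3) unfolding A_def by linarith
  moreover have "2 * m + 1 \<le> 5 * ?n * real L / \<nu>"
  proof -
    have "?n * 1 \<le> ?n * real L" using assms(5) by (intro mult_left_mono) auto
    then have "\<nu> \<le> ?n * real L" using \<nu> by linarith
    then show ?thesis unfolding m_def using \<nu> assms(4) by (simp add: field_simps)
  qed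
  then have "real (card J) * (2 * m + 1) \<le> real (card J) * (5 * ?n * real L / \<nu>)" by (intro mult_left_mono) auto
  ultimately have "\<nu> / 2 \<le> real (card J) * (5 * ?n * real L / \<nu>)" by linarith
  then have "\<nu> ^ 2 \<le> real (card J) * (10 * real L * ?n)" using \<nu> assms(4) by (simp add: field_simps power2_eq_square)
  moreover have "D ^ 2 \<le> \<nu> ^ 2" using \<nu> assms(4) by (intro power_mono) auto
  ultimately have "real t * (10 * real L * ?n) \<le> real (card J) * (10 * real L * ?n)" using t by (simp add: mult.assoc)
  then have "t \<le> card J" using n0 assms(5) by simp
  then obtain B where B: "B \<subseteq> J" "card B = t" by (meson obtain_subset_with_card_n)
  have "B \<subseteq> X" using B J unfolding A_def N_def by auto
  moreover have "\<forall>a\<in>B. \<forall>b\<in>B. a \<noteq> b \<longrightarrow> \<not> bad a b" using B(1) J(2) by (meson subsetD)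
  ultimately show ?thesis using B(2) unfolding bad_def not_less by (intro exI[of _ B] conjI)
qed

text \<open>A common neighbour outside \<open>Z\<close> survives, and so do the two links through it.\<close>

lemma robust_common_neighbours:
  assumes "card {w \<in> X. w \<noteq> a \<and> w \<noteq> b \<and> robust E q z w a \<and> robust E q z w b} \<ge> Suc z"
    and Z: "finite Z" "card Z \<le> z"
  shows "\<exists>J. finite J \<and> card J \<le> 2 * q + 1 \<and> J \<inter> Z = {} \<and> linked E J a b"
proof -
  let ?W = "{w \<in> X. w \<noteq> a \<and> w \<noteq> b \<and> robust E q z w a \<and> robust E q z w b}"
  have "\<not> ?W \<subseteq> Z" using assms card_mono[of Z ?W] by linarith
  then obtain w where w: "w \<notin> Z" "robust E q z a w" "robust E q z w b" using robust_sym by fast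
  obtain xs where xs: "length xs \<le> q" "set xs \<inter> Z = {}" "walk E (a # xs @ [w])"
    using w(2) Z unfolding robust_def by blast
  obtain ys where ys: "length ys \<le> q" "set ys \<inter> Z = {}" "walk E (w # ys @ [b])"
    using w(3) Z unfolding robust_def by blast
  have "linked E (set xs \<union> set ys \<union> {w}) a b"
    using linked_trans[of E "set xs" a w "set ys" b] xs ys unfolding linked_def by blast
  moreover have "card (set xs \<union> set ys \<union> {w}) \<le> card (set xs) + card (set ys) + 1"
    using card_Un_le[of "set xs \<union> set ys" "{w}"] card_Un_le[of "set xs" "set ys"] by simp
  then have "card (set xs \<union> set ys \<union> {w}) \<le> 2 * q + 1"
    using card_length[of xs] card_length[of ys] xs(1) ys(1) by linarith
  ultimately show ?thesis using xs(2) ys(2) w(1)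
    by (intro exI[of _ "set xs \<union> set ys \<union> {w}"]) auto
qed

text \<open>The point is that \<open>q\<close> does not depend on \<open>t\<close>. In an extremal subgraph on \<open>n\<close> vertices, any
  \<open>2 * n powr (\<epsilon> / 2)\<close> vertices contain a robustly linked pair, so the graph of robustly linked pairs has no
  large independent set and is dense: for \<open>\<epsilon> \<le> 1/2\<close> at least half of its
  degrees are of order at least \<open>n powr (3/4)\<close>. In a graph that dense there are
  \<open>t\<close> vertices with many common neighbours for every pair; only the required value of \<open>n\<close>, but not the length of the links, grows with \<open>t\<close>.\<close>

theorem dense_graph_clique_subdivision:
  fixes \<epsilon> :: real
  assumes \<epsilon>: "0 < \<epsilon>" "\<epsilon> \<le> 1/2"
  shows "\<exists>q. \<forall>t. \<exists>C>0. \<forall>(V :: 'a set) E. finite V \<and> V \<noteq> {} \<and> E \<subseteq> [V]\<^bsup>2\<^esup> \<and> 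
    real (card E) \<ge> C * real (card V) powr (1 + \<epsilon>) \<longrightarrow>
    (\<exists>B I. B \<subseteq> V \<and> card B = t \<and> subdivision_model q E B ([B]\<^bsup>2\<^esup>) I)"
proof -
  obtain p :: nat where "1 / (\<epsilon> ^ 2 / 8) \<le> real p" using real_arch_simple by blast
  then have p: "real p * (\<epsilon> ^ 2 / 8) \<ge> 1" using \<epsilon> by (simp add: field_simps)
  define q where "q = 2 * (2 * p + 1) + 1"
  show ?thesis
  proof (intro exI[of _ q] allI)
    fix t :: nat
    define z where "z = t + q * (t * t)"
    define L where "L = Suc z"
    \<comment> \<open>In this order, the bounds on \<open>C\<close> are used for the growth of balls, for deleting the separating
      sets, for comparing powers of \<open>n\<close>, and for finding \<open>t\<close> vertices with large codegrees.\<close>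
    define C where "C = Max {8 powr (4 / \<epsilon> ^ 2), 8 * real z, 4096, (2560 * real t * real L) ^ 2}"
    have C: "C \<ge> 8 powr (4 / \<epsilon> ^ 2)" "C \<ge> 8 * real z" "C \<ge> 4096" "C \<ge> (2560 * real t * real L) ^ 2"
      unfolding C_def by (intro Max_ge; simp)+
    show "\<exists>C>0. \<forall>(V :: 'a set) E. finite V \<and> V \<noteq> {} \<and> E \<subseteq> [V]\<^bsup>2\<^esup> \<and> 
      real (card E) \<ge> C * real (card V) powr (1 + \<epsilon>) \<longrightarrow>
      (\<exists>B I. B \<subseteq> V \<and> card B = t \<and> subdivision_model q E B ([B]\<^bsup>2\<^esup>) I)"
    proof (intro exI[of _ C] conjI allI impI; (elim conjE)?)
      show "C > 0" using C(3) by simp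
      fix V :: "'a set" and E
      assume V: "finite V" "V \<noteq> {}" "E \<subseteq> [V]\<^bsup>2\<^esup>" and dense: "C * real (card V) powr (1 + \<epsilon>) \<le> real (card E)"
      obtain X c where X: "X \<subseteq> V" "c \<ge> C" "extremal \<epsilon> c (spanned E X) X"
        using extremal_subgraph[OF V \<epsilon>(1) _ dense] C(3) by auto
      define F where "F = spanned E X"
      let ?n = "real (card X)"
      have F: "finite X" "X \<noteq> {}" "F \<subseteq> [X]\<^bsup>2\<^esup>" and ex: "extremal \<epsilon> c F X" using X(3) unfolding extremal_def F_def by auto
      have n0: "?n > 0" using F by (simp add: card_gt_0_iff)
      then have n1: "?n \<ge> 1" by (simp add: Suc_leI)
      have c0: "c > 0" using X(2) C(3) by linarith
      \<comment> \<open>The edges at a single vertex already force \<open>X\<close> to be large.\<close>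
      have nc: "?n \<ge> c"
      proof -
        obtain a where a: "a \<in> X" using F by blast
        have "{e \<in> F. e \<inter> {a} \<noteq> {}} \<subseteq> (\<lambda>x. {a, x}) ` X"
          using incident_edges[OF F(3), of a] by blast
        then have "card {e \<in> F. e \<inter> {a} \<noteq> {}} \<le> card X" using F(1) by (intro surj_card_le) auto
        moreover have "c * real (card {a}) * ?n powr \<epsilon> \<le> real (card {e \<in> F. e \<inter> {a} \<noteq> {}})"
          using ex a unfolding extremal_def by blast
        moreover have "c * 1 \<le> c * ?n powr \<epsilon>" using c0 n1 \<epsilon> by (intro mult_left_mono ge_one_powr_ge_zero) auto
        ultimately show ?thesis by simp
      qed
      then have nC: "?n \<ge> C" using X(2) by linarith
      have large: "?n powr (\<epsilon> ^ 2 / 4) \<ge> 8"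
      proof -
        have "8 = (8 powr (4 / \<epsilon> ^ 2)) powr (\<epsilon> ^ 2 / 4)" using \<epsilon> by (simp add: powr_powr)
        also have "\<dots> \<le> ?n powr (\<epsilon> ^ 2 / 4)" using nC C(1) by (intro powr_mono2) auto
        finally show ?thesis .
      qed
      \<comment> \<open>Independent sets in the graph of robustly linked pairs have fewer than \<open>m\<close> elements, where \<open>m\<close> is
        the next integer above \<open>d\<close>.\<close>
      define d where "d = ?n powr (\<epsilon> / 2)"
      have d1: "d \<ge> 1" unfolding d_def using n1 \<epsilon> by (intro ge_one_powr_ge_zero) auto
      have split: "?n = d * ?n powr (1 - \<epsilon> / 2)" unfolding d_def using n0 by (simp add: powr_add[symmetric])
      have dd: "d * d = ?n powr \<epsilon>" unfolding d_def by (simp add: powr_add[symmetric])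
      have sq: "?n powr \<epsilon> \<le> sqrt ?n" using \<epsilon> n1 powr_mono[of \<epsilon> "1/2" ?n] by (simp add: powr_half_sqrt)
      define m where "m = nat \<lfloor>d\<rfloor> + 1"
      have m: "real m > d" "real m \<le> 2 * d" unfolding m_def using d1 by linarith+
      define R where "R = robust F (2 * p + 1) z"
      have indep: "real (card I) < real m" if I: "I \<subseteq> X" "\<And>a b. a \<in> I \<Longrightarrow> b \<in> I \<Longrightarrow> a \<noteq> b \<Longrightarrow> \<not> R a b" for I
      proof (rule ccontr)
        assume "\<not> ?thesis"
        then have "m \<le> card I" by simp
        then obtain A where A: "A \<subseteq> I" "card A = m" by (meson obtain_subset_with_card_n)
        have "?n < real m * ?n powr (1 - \<epsilon> / 2)"
          using m(1) n0 by (subst split) simp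
        moreover have "real (card A * card A * z) \<le> c / 2 * ?n powr \<epsilon>"
        proof -
          have "real m * real m \<le> (2 * d) * (2 * d)" using m d1 by (intro mult_mono) auto
          then have "real (m * m * z) \<le> 4 * ?n powr \<epsilon> * real z" using dd by (simp add: mult_right_mono)
          also have "\<dots> \<le> c / 2 * ?n powr \<epsilon>" using C(2) X(2) mult_right_mono[of "8 * real z" c "?n powr \<epsilon>"] by (simp add: algebra_simps)
          finally show ?thesis using A by simp
        qed
        ultimately have "\<exists>a\<in>A. \<exists>b\<in>A. a \<noteq> b \<and> R a b"
          unfolding R_def using robust_pair_exists[OF ex \<epsilon> c0 large p, of A z] A I(1) by auto
        then show False using A I(2) by blast
      qed
      define D where "D = ?n / (8 * d)"
      have D0: "D > 0" unfolding D_def using n0 d1 by simp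
      have ddn: "16 * (d * d) \<le> ?n"
      proof -
        have "64 * sqrt ?n \<le> sqrt ?n * sqrt ?n" using nC C(3) real_le_rsqrt[of 64 ?n] by (intro mult_right_mono) auto
        then show ?thesis using sq dd n0 real_sqrt_ge_zero[of ?n] by simp
      qed
      have "16 * d \<le> 16 * (d * d)" using d1 by simp
      then have d8: "8 * d \<le> ?n / 2" using ddn by simp
      have MD: "real m * (D + 1) \<le> ?n / 2"
      proof -
        have "real m * (D + 1) \<le> 2 * d * (D + 1)" using m D0 by (intro mult_right_mono) auto
        also have "\<dots> = ?n / 4 + 2 * d" unfolding D_def using d1 by (simp add: field_simps)
        also have "\<dots> \<le> ?n / 2" using d8 by simp
        finally show ?thesis .
      qed
      have t: "real t * 10 * real L * ?n \<le> D ^ 2"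
      proof -
        have "(2560 * real t * real L) ^ 2 \<le> ?n" using nC C(4) by linarith
        then have "2560 * real t * real L \<le> sqrt ?n" by (rule real_le_rsqrt)
        moreover have "640 * real t * real L \<le> 2560 * real t * real L" by (intro mult_right_mono) auto
        ultimately have "640 * real t * real L \<le> sqrt ?n" by linarith
        then have "640 * real t * real L * (d * d) \<le> sqrt ?n * sqrt ?n"
          using dd sq n0 by (intro mult_mono) auto
        then have "640 * real t * real L * (d * d) * ?n \<le> ?n * ?n"
          using n0 by simp
        then have "real t * 10 * real L * ?n * (64 * (d * d)) \<le> ?n * ?n" by (simp add: algebra_simps)
        then show ?thesis unfolding D_def using d1 by (simp add: power2_eq_square le_divide_eq algebra_simps)
      qed
      have "symp R" unfolding R_def using robust_sym by (auto simp: symp_def)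
      from large_codegree_set[OF F(1,2) this D0 _ _ indep MD t] obtain B where
        B: "B \<subseteq> X" "card B = t" and cod: "\<forall>a\<in>B. \<forall>b\<in>B. a \<noteq> b \<longrightarrow> 
          card {w \<in> X. w \<noteq> a \<and> w \<noteq> b \<and> R w a \<and> R w b} \<ge> L"
        unfolding L_def using m d1 by auto
      have finB: "finite B" using B F finite_subset by auto
      have "\<exists>I. subdivision_model q F B ([B]\<^bsup>2\<^esup>) I"
      proof (rule greedy_model)
        show "finite ([B]\<^bsup>2\<^esup>)" using finB finite_imp_finite_nsets by blast
        fix u v and Z :: "'a set" assume uv: "{u, v} \<in> [B]\<^bsup>2\<^esup>" and Z: "finite Z" "card Z \<le> card B + q * card ([B]\<^bsup>2\<^esup>)"
        have "t * (t - 1) div 2 \<le> t * (t - 1)" by simp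
        also have "\<dots> \<le> t * t" by (intro mult_le_mono2) simp
        finally have "card ([B]\<^bsup>2\<^esup>) \<le> t * t" using B(2) by (simp add: choose_two)
        then have "q * card ([B]\<^bsup>2\<^esup>) \<le> q * (t * t)" by (rule mult_le_mono2)
        then have "card Z \<le> z" unfolding z_def using Z(2) B(2) by linarith
        moreover have "card {w \<in> X. w \<noteq> u \<and> w \<noteq> v \<and> R w u \<and> R w v} \<ge> Suc z" using cod uv unfolding L_def by auto
        ultimately show "\<exists>J. finite J \<and> card J \<le> q \<and> J \<inter> Z = {} \<and> linked F J u v"
          unfolding q_def R_def using robust_common_neighbours[of z X u v F "2 * p + 1" Z] Z(1) by simp
      qed (use finB in auto)
      then obtain I where I: "subdivision_model q F B ([B]\<^bsup>2\<^esup>) I" by blast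
      have "F \<subseteq> E" unfolding F_def spanned_def by auto
      with I have "subdivision_model q E B ([B]\<^bsup>2\<^esup>) I" by (rule subdivision_model_mono)
      then show "\<exists>B I. B \<subseteq> V \<and> card B = t \<and> subdivision_model q E B ([B]\<^bsup>2\<^esup>) I" using B X(1) by blast
    qed
  qed
qed

section \<open>Fans\<close>

definition fan :: "'a set set \<Rightarrow> nat \<Rightarrow> 'a set \<Rightarrow> 'a \<Rightarrow> 'a list set \<Rightarrow> bool" where
  "fan E r T v F \<longleftrightarrow> finite F \<and>
     (\<forall>xs\<in>F. xs \<noteq> [] \<and> length xs \<le> r \<and> last xs \<in> T \<and> set (butlast xs) \<inter> T = {} \<and>
        v \<notin> set xs \<and> walk E (v # xs)) \<and>
     (\<forall>xs\<in>F. \<forall>ys\<in>F. xs \<noteq> ys \<longrightarrow> set xs \<inter> set ys = {})"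

text \<open>A bound on the \<open>r\<close>-admissibility of the graph, in a form that does not mention an ordering.\<close>

definition fan_bounded :: "'a set set \<Rightarrow> 'a set \<Rightarrow> nat \<Rightarrow> nat \<Rightarrow> bool" where
  "fan_bounded E V r k \<longleftrightarrow>
     (\<forall>S\<subseteq>V. S \<noteq> {} \<longrightarrow> (\<exists>v\<in>S. \<forall>F. fan E r (S - {v}) v F \<longrightarrow> card F < k))"

text \<open>Cut each path at its first vertex in \<open>T\<close>.\<close>

lemma fan_truncate:
  assumes "finite F" 
    and F: "\<And>xs. xs \<in> F \<Longrightarrow> length xs \<le> r \<and> v \<notin> set xs \<and> walk E (v # xs) \<and> set xs \<inter> T \<noteq> {}"
    and disj: "\<And>xs ys. xs \<in> F \<Longrightarrow> ys \<in> F \<Longrightarrow> xs \<noteq> ys \<Longrightarrow> set xs \<inter> set ys = {}"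
  shows "\<exists>F'. fan E r T v F' \<and> card F' = card F \<and> (\<forall>ys\<in>F'. \<exists>xs\<in>F. \<exists>zs. xs = ys @ zs)"
proof -
  have "\<exists>ys zs. xs = ys @ zs \<and> ys \<noteq> [] \<and> last ys \<in> T \<and> set (butlast ys) \<inter> T = {}" if "xs \<in> F" for xs
  proof -
    have "\<exists>x\<in>set xs. x \<in> T" using F[OF that] by blast
    then obtain as x bs where "xs = as @ x # bs" "x \<in> T" "\<forall>a\<in>set as. a \<notin> T"
      by (rule split_list_first_propE)
    then show ?thesis by (intro exI[of _ "as @ [x]"] exI[of _ bs]) auto
  qed
  then obtain g h where g: "\<And>xs. xs \<in> F \<Longrightarrow> xs = g xs @ h xs \<and> g xs \<noteq> [] \<and> last (g xs) \<in> T \<and> set (butlast (g xs)) \<inter> T = {}"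
    by metis
  have sub: "set (g xs) \<subseteq> set xs" "length (g xs) \<le> length xs" if "xs \<in> F" for xs
    using g[OF that] by (metis set_append sup_ge1, metis length_append le_add1)
  have inj: "inj_on g F"
  proof (rule inj_onI, rule ccontr)
    fix xs ys assume a: "xs \<in> F" "ys \<in> F" "g xs = g ys" "xs \<noteq> ys"
    then have "set (g xs) \<subseteq> set xs \<inter> set ys" using sub by (metis le_inf_iff)
    then show False using disj[OF a(1,2,4)] g[OF a(1)] by simp
  qed
  have "fan E r T v (g ` F)"
    unfolding fan_def
  proof (intro conjI ballI impI)
    fix ys assume "ys \<in> g ` F"
    then obtain xs where xs: "xs \<in> F" "ys = g xs" by blast
    have "walk E ((v # g xs) @ h xs)" using F[OF xs(1)] g[OF xs(1)] by simp
    then show "walk E (v # ys)" unfolding xs successively_append_iff by blast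
    show "ys \<noteq> []" "length ys \<le> r" "last ys \<in> T" "set (butlast ys) \<inter> T = {}" "v \<notin> set ys"
      using g[OF xs(1)] sub[OF xs(1)] F[OF xs(1)] xs(2) by auto
  next
    fix xs ys assume a: "xs \<in> g ` F" "ys \<in> g ` F" "xs \<noteq> ys"
    then obtain xs' ys' where b: "xs' \<in> F" "ys' \<in> F" "xs = g xs'" "ys = g ys'" by auto
    then have "set xs' \<inter> set ys' = {}" using disj a(3) by metis
    then show "set xs \<inter> set ys = {}" using sub(1)[OF b(1)] sub(1)[OF b(2)] b(3,4) by blast
  qed (use assms(1) in simp)
  moreover have "\<exists>xs\<in>F. \<exists>zs. xs = ys @ zs" if "ys \<in> g ` F" for ys using that g by blast
  ultimately show ?thesis using card_image[OF inj] by blast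
qed

lemma walk_Cons_subset:
  assumes "walk E (v # xs)" "xs \<noteq> []" "E \<subseteq> [V]\<^bsup>2\<^esup>"
  shows "v \<in> V" "set xs \<subseteq> V"
proof -
  have xs: "xs = butlast xs @ [last xs]" using assms(2) by simp
  then have "walk E (v # butlast xs @ [last xs])" using assms(1) by simp
  from walk_subset[OF this assms(3)] show "v \<in> V" "set xs \<subseteq> V" by (simp, subst xs, simp)
qed

lemma walk_prefix: "walk E (v # as @ z # bs) \<Longrightarrow> linked E (set as) v z"
  using walk_append[of E "v # as" z bs] unfolding linked_def by auto

text \<open>Start from a maximal shallow topological minor on \<open>S\<close>. If it is sparse, there is a large set of vertices of
  \<open>S\<close> that have small degree in it and are pairwise nonadjacent. By maximality, most paths of the fan of such a
  vertex run into the inner vertices \<open>W\<close> of the minor, and the initial segments up to \<open>W\<close> of the fans of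
  different vertices are disjoint. These segments form a dense minor on the chosen vertices and \<open>W\<close>.\<close>

lemma fans_give_dense_minor:
  assumes V: "finite V" "E \<subseteq> [V]\<^bsup>2\<^esup>" "S \<subseteq> V" "S \<noteq> {}" and x: "x \<ge> 1"
    and k: "k \<ge> 20 * (2 * r + 1) * x ^ 3"
    and fans: "\<And>v. v \<in> S \<Longrightarrow> \<exists>F. fan E r (S - {v}) v F \<and> card F \<ge> k"
  shows "\<exists>B H I. B \<subseteq> V \<and> B \<noteq> {} \<and> subdivision_model (2 * r) E B H I \<and> card H \<ge> x * card B"
proof -
  define M where "M = {H. H \<subseteq> [S]\<^bsup>2\<^esup> \<and> (\<exists>I. subdivision_model (2 * r) E S H I)}"
  have finS: "finite S" using V finite_subset by auto
  then have fin2: "finite ([S]\<^bsup>2\<^esup>)" using finite_imp_finite_nsets by blast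
  then have "finite M" unfolding M_def by (auto intro: finite_subset[of _ "Pow ([S]\<^bsup>2\<^esup>)"])
  moreover have "{} \<in> M" unfolding M_def subdivision_model_def by simp
  ultimately obtain H where H: "H \<in> M" and max: "\<And>H'. H' \<in> M \<Longrightarrow> H \<subseteq> H' \<Longrightarrow> H = H'"
    using finite_has_maximal[of M] by blast
  obtain I0 where "subdivision_model (2 * r) E S H I0" using H unfolding M_def by blast
  then obtain I where I: "subdivision_model (2 * r) E S H I" and IV: "\<And>e. I e \<subseteq> V"
    using subdivision_model_restrict[OF _ V(2)] by (metis inf_le2)
  note m = subdivision_modelD[OF I]
  have finH: "finite H" using m(1) fin2 finite_subset by blast
  define W where "W = \<Union>(I ` H)"
  have WS: "W \<inter> S = {}" "W \<subseteq> V" unfolding W_def using m(4) IV by auto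
  have finW: "finite W" by (rule finite_subset[OF WS(2) V(1)])
  have "card W \<le> (\<Sum>e\<in>H. card (I e))" unfolding W_def by (rule card_UN_le[OF finH])
  also have "\<dots> \<le> (\<Sum>e\<in>H. 2 * r)" using m(3) by (intro sum_mono)
  finally have cW: "card W \<le> 2 * r * card H" by (simp add: mult.commute)
  have adj: "{u, v} \<in> H" if "u \<in> S" "v \<in> S" "u \<noteq> v" "finite J" "card J \<le> 2 * r" "J \<inter> S = {}" "J \<inter> W = {}" "linked E J u v" for u v J
  proof (rule ccontr)
    assume no: "{u, v} \<notin> H"
    have "subdivision_model (2 * r) E S (insert {u, v} H) (I({u, v} := J))"
      using subdivision_model_insert[OF I that(1-3) no that(4-6)] that(7,8) unfolding W_def by blast
    then have "insert {u, v} H \<in> M" unfolding M_def using m(1) that(1-3) by auto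
    then show False using max[of "insert {u, v} H"] no by blast
  qed
  show ?thesis
  proof (cases "card H \<ge> x * card S")
    case True
    then show ?thesis using I V by blast
  next
    case False
    define d where "d v = card {e \<in> H. v \<in> e}" for v
    have "(\<Sum>v\<in>S. d v) = (\<Sum>e\<in>H. 2)" unfolding d_def
    proof (rule sum_multicount_gen[OF finS finH], intro ballI)
      fix e assume "e \<in> H"
      then have "e \<subseteq> S" "card e = 2" using m(1) by (auto simp: nsets_def)
      moreover have "{i \<in> S. i \<in> e} = S \<inter> e" by auto
      ultimately show "card {i \<in> S. i \<in> e} = 2" by (simp add: Int_absorb1)
    qed
    then have "(\<Sum>v\<in>S. d v) \<le> card S * (2 * x)" using False by (simp add: mult.commute)
    then have "real (\<Sum>v\<in>S. d v) \<le> real (card S * (2 * x))" by (simp only: of_nat_le_iff)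
    then have "real (card S) \<le> 2 * real (card {v \<in> S. real (d v) \<le> 2 * real (2 * x)})"
      using markov_card[OF finS, of d "real (2 * x)"] x by simp
    moreover define S0 where "S0 = {v \<in> S. d v \<le> 4 * x}"
    have "{v \<in> S. real (d v) \<le> 2 * real (2 * x)} = S0" unfolding S0_def by auto
    ultimately have cS0: "real (card S) \<le> 2 * real (card S0)" by simp
    have "\<exists>S'\<subseteq>S0. (\<forall>a\<in>S'. \<forall>b\<in>S'. a \<noteq> b \<longrightarrow> {a, b} \<notin> H) \<and> real (card S0) \<le> real (card S') * (real (4 * x) + 1)"
    proof (rule independent_set_greedy)
      show "finite S0" unfolding S0_def using finS by simp
      show "symp (\<lambda>a b. {a, b} \<in> H)" by (auto simp: symp_def insert_commute)
      fix a assume a: "a \<in> S0"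
      have "card {b \<in> S0. b \<noteq> a \<and> {a, b} \<in> H} \<le> d a" unfolding d_def
        by (rule card_inj_on_le[where f = "\<lambda>b. {a, b}"]) (use finH in \<open>auto simp: inj_on_def doubleton_eq_iff\<close>)
      then show "real (card {b \<in> S0. b \<noteq> a \<and> {a, b} \<in> H}) \<le> real (4 * x)" using a unfolding S0_def by auto
    qed
    then obtain S' where S': "S' \<subseteq> S0" and indep: "\<And>a b. a \<in> S' \<Longrightarrow> b \<in> S' \<Longrightarrow> a \<noteq> b \<Longrightarrow> {a, b} \<notin> H"
      and cS': "real (card S0) \<le> real (card S') * (real (4 * x) + 1)" by blast
    have S'S: "S' \<subseteq> S" using S' S0_def by auto
    have finS': "finite S'" using S'S finS finite_subset by auto
    have "\<exists>F. fan E r W v F \<and> card F + 4 * x \<ge> k \<and> (\<forall>ys\<in>F. set ys \<inter> S = {})" if v: "v \<in> S'" for v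
    proof -
      obtain F where F: "fan E r (S - {v}) v F" "card F \<ge> k" using fans v S'S by blast
      define A where "A = {xs \<in> F. set xs \<inter> W = {}}"
      have finF: "finite F" using F(1) unfolding fan_def by blast
      have "card A \<le> d v" unfolding d_def
      proof (rule card_inj_on_le[where f = "\<lambda>xs. {v, last xs}"])
        show "inj_on (\<lambda>xs. {v, last xs}) A"
        proof (rule inj_onI, rule ccontr)
          fix xs ys assume a: "xs \<in> A" "ys \<in> A" "{v, last xs} = {v, last ys}" "xs \<noteq> ys"
          then have ne: "xs \<noteq> []" "ys \<noteq> []" "set xs \<inter> set ys = {}" using F(1) unfolding A_def fan_def by auto
          have "last xs \<noteq> v" "last ys \<noteq> v" using a F(1) unfolding A_def fan_def by auto
          then have "last xs = last ys" using a(3) by (auto simp: doubleton_eq_iff)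
          then show False using ne by (metis disjoint_iff last_in_set)
        qed
        show "(\<lambda>xs. {v, last xs}) ` A \<subseteq> {e \<in> H. v \<in> e}"
        proof
          fix e assume "e \<in> (\<lambda>xs. {v, last xs}) ` A"
          then obtain xs where xs: "xs \<in> A" "e = {v, last xs}" by blast
          then have f: "xs \<noteq> []" "length xs \<le> r" "last xs \<in> S - {v}" "set (butlast xs) \<inter> (S - {v}) = {}"
            "v \<notin> set xs" "walk E (v # xs)" using F(1) unfolding A_def fan_def by auto
          have "walk E (v # butlast xs @ [last xs])" using f by simp
          then have "linked E (set (butlast xs)) v (last xs)" unfolding linked_def by blast
          moreover have sb: "set (butlast xs) \<subseteq> set xs" by (auto dest: in_set_butlastD)
          moreover have "card (set (butlast xs)) \<le> 2 * r" 
            using card_length[of "butlast xs"] f(2) by simp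
          ultimately have "{v, last xs} \<in> H"
            using f xs(1) v S'S unfolding A_def by (intro adj[of v "last xs" "set (butlast xs)"]) auto
          then show "e \<in> {e \<in> H. v \<in> e}" using xs by simp
        qed
      qed (use finH in simp)
      also have "d v \<le> 4 * x" using v S' unfolding S0_def by auto
      finally have "card (F - A) + 4 * x \<ge> k" using F(2) finF card_Diff_subset[of A F] unfolding A_def by auto
      moreover have "\<exists>F'. fan E r W v F' \<and> card F' = card (F - A) \<and> (\<forall>ys\<in>F'. \<exists>xs\<in>F - A. \<exists>zs. xs = ys @ zs)"
        by (rule fan_truncate) (use F(1) finF in \<open>auto simp: fan_def A_def\<close>)
      then obtain F' where F': "fan E r W v F'" "card F' = card (F - A)" "\<forall>ys\<in>F'. \<exists>xs\<in>F - A. \<exists>zs. xs = ys @ zs"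
        by blast
      moreover have "set ys \<inter> S = {}" if ys: "ys \<in> F'" for ys
      proof -
        obtain xs zs where xs: "xs \<in> F" "xs = ys @ zs" using F' ys by blast
        have f: "last xs \<in> S - {v}" "set (butlast xs) \<inter> (S - {v}) = {}" "v \<notin> set xs"
          using F(1) xs(1) unfolding fan_def by auto
        have "last ys \<in> W" using F'(1) ys unfolding fan_def by blast
        then have "zs \<noteq> []" using xs f WS by auto
        then have "set ys \<subseteq> set (butlast xs)" using xs by (simp add: butlast_append)
        moreover have "v \<notin> set ys" using f(3) xs by simp
        ultimately show ?thesis using f(2) by blast
      qed
      ultimately show ?thesis by (intro exI[of _ F']) simp
    qed
    then obtain F where F: "\<And>v. v \<in> S' \<Longrightarrow> fan E r W v (F v) \<and> card (F v) + 4 * x \<ge> k \<and> (\<forall>ys\<in>F v. set ys \<inter> S = {})"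
      by metis
    define Q where "Q = (SIGMA v:S'. F v)"
    define h where "h = (\<lambda>(v, ys). {v, last ys :: 'a})"
    have Q: "v \<in> S" "v \<in> S'" "ys \<in> F v" "ys \<noteq> []" "length ys \<le> r" "last ys \<in> W" "set (butlast ys) \<inter> W = {}" "v \<notin> set ys"
      "walk E (v # ys)" "set ys \<inter> S = {}" if "(v, ys) \<in> Q" for v ys
      using that F[of v] S'S unfolding Q_def fan_def by auto
    have inj: "inj_on h Q"
    proof (rule inj_onI)
      fix p p' assume a: "p \<in> Q" "p' \<in> Q" "h p = h p'"
      obtain v ys v' ys' where p: "p = (v, ys)" "p' = (v', ys')" by (metis surj_pair)
      have "{v, last ys} = {v', last ys'}" using a p unfolding h_def by auto
      then have e: "v = v'" "last ys = last ys'" 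
        using Q(1,6)[of v ys] Q(1,6)[of v' ys'] a p WS by (auto simp: doubleton_eq_iff)
      have "set ys \<inter> set ys' \<noteq> {}" using Q(4)[of v ys] Q(4)[of v' ys'] a p e by (metis disjoint_iff last_in_set)
      then have "ys = ys'" using Q(3)[of v ys] Q(3)[of v' ys'] a p e F[of v] Q(2)[of v ys] unfolding fan_def by blast
      then show "p = p'" using p e by simp
    qed
    have finF: "finite (F v)" if "v \<in> S'" for v using F[OF that] unfolding fan_def by blast
    have finQ: "finite Q" unfolding Q_def using finS' finF by blast
    define H' where "H' = h ` Q"
    define B' where "B' = S' \<union> W"
    define I' where "I' e = set (butlast (snd (inv_into Q h e)))" for e
    have I': "I' {v, last ys} = set (butlast ys)" if "(v, ys) \<in> Q" for v ys
    proof -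
      have "h (v, ys) = {v, last ys}" unfolding h_def by simp
      then have "inv_into Q h {v, last ys} = (v, ys)" using inv_into_f_f[OF inj that] by simp
      then show ?thesis unfolding I'_def by simp
    qed
    have H'E: "\<exists>v ys. (v, ys) \<in> Q \<and> e = {v, last ys}" if "e \<in> H'" for e
      using that unfolding H'_def h_def by auto
    have disj: "set (butlast ys) \<inter> set (butlast ys') = {}" if a: "(v, ys) \<in> Q" "(v', ys') \<in> Q" "(v, ys) \<noteq> (v', ys')" for v ys v' ys'
    proof (cases "v = v'")
      case True
      then have "set ys \<inter> set ys' = {}" using F[of v] Q(2,3)[OF a(1)] Q(2,3)[OF a(2)] a(3) unfolding fan_def by blast
      then show ?thesis by (meson disjoint_iff in_set_butlastD)
    next
      case False
      show ?thesis
      proof (rule ccontr)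
        assume "\<not> ?thesis"
        then obtain z where z: "z \<in> set (butlast ys)" "z \<in> set (butlast ys')" by blast
        have lk: "linked E (set (butlast ys)) v z" if "(v, ys) \<in> Q" "z \<in> set (butlast ys)" for v ys
        proof -
          obtain as bs where ab: "butlast ys = as @ z # bs" using \<open>z \<in> set (butlast ys)\<close> by (meson split_list)
          then have "ys = as @ z # bs @ [last ys]" using Q(4)[OF that(1)] append_butlast_last_id[of ys] by simp
          then have "walk E (v # as @ z # bs @ [last ys])" using Q(9)[OF that(1)] by metis
          then have "linked E (set as) v z" by (rule walk_prefix)
          then show ?thesis by (rule linked_mono) (use ab in auto)
        qed
        define J where "J = set (butlast ys) \<union> set (butlast ys') \<union> {z}"
        have "linked E J v v'" unfolding J_def
          using linked_trans[OF lk[OF a(1) z(1)] linked_sym[OF lk[OF a(2) z(2)]]] .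
        moreover have "J = set (butlast ys) \<union> set (butlast ys')" using z J_def by auto
        then have "card J \<le> 2 * r" 
          using card_Un_le[of "set (butlast ys)" "set (butlast ys')"] card_length[of "butlast ys"] card_length[of "butlast ys'"]
            Q(5)[OF a(1)] Q(5)[OF a(2)] by simp
        moreover have "J \<inter> S = {}" "J \<inter> W = {}" "finite J"
          using Q(7,10)[OF a(1)] Q(7,10)[OF a(2)] z unfolding J_def by (auto dest: in_set_butlastD)
        ultimately have "{v, v'} \<in> H" using adj[of v v' J] Q(1)[OF a(1)] Q(1)[OF a(2)] False by blast
        then show False using indep Q(2)[OF a(1)] Q(2)[OF a(2)] False by blast
      qed
    qed
    have "subdivision_model (2 * r) E B' H' I'"
      unfolding subdivision_model_def
    proof (intro conjI ballI impI allI)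
      show "H' \<subseteq> [B']\<^bsup>2\<^esup>"
      proof
        fix e assume "e \<in> H'"
        then obtain v ys where "(v, ys) \<in> Q" "e = {v, last ys}" using H'E by blast
        then show "e \<in> [B']\<^bsup>2\<^esup>" using Q(1,2,6)[of v ys] WS unfolding B'_def by auto
      qed
    next
      fix e assume "e \<in> H'"
      then obtain v ys where vy: "(v, ys) \<in> Q" "e = {v, last ys}" using H'E by blast
      have "set (butlast ys) \<subseteq> set ys" by (auto dest: in_set_butlastD)
      then show "I' e \<inter> B' = {}" using I'[OF vy(1)] vy(2) Q(7,10)[OF vy(1)] S'S unfolding B'_def by auto
      show "finite (I' e)" unfolding I'_def by simp
      show "card (I' e) \<le> 2 * r" using I'[OF vy(1)] vy(2) card_length[of "butlast ys"] Q(5)[OF vy(1)] by simp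
    next
      fix e f assume ef: "e \<in> H'" "f \<in> H'" "e \<noteq> f"
      obtain v ys where 1: "(v, ys) \<in> Q" "e = {v, last ys}" using H'E[OF ef(1)] by blast
      obtain v' ys' where 2: "(v', ys') \<in> Q" "f = {v', last ys'}" using H'E[OF ef(2)] by blast
      have "(v, ys) \<noteq> (v', ys')" using ef(3) 1(2) 2(2) by auto
      then show "I' e \<inter> I' f = {}" unfolding 1(2) 2(2) I'[OF 1(1)] I'[OF 2(1)] by (rule disj[OF 1(1) 2(1)])
    next
      fix u w assume "{u, w} \<in> H'"
      then obtain v ys where vy: "(v, ys) \<in> Q" "{u, w} = {v, last ys}" using H'E by blast
      have "walk E (v # butlast ys @ [last ys])" using Q(4,9)[OF vy(1)] by simp
      then have "linked E (I' {u, w}) v (last ys)" unfolding vy(2) I'[OF vy(1)] linked_def by blast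
      moreover have "u = v \<and> w = last ys \<or> u = last ys \<and> w = v" using vy(2) by (auto simp: doubleton_eq_iff)
      ultimately show "linked E (I' {u, w}) u w" using linked_sym by fast
    qed
    moreover have "B' \<subseteq> V" unfolding B'_def using S'S V WS by auto
    moreover have "card S' > 0"
    proof (rule ccontr)
      assume "\<not> ?thesis"
      then have "real (card S) \<le> 0" using cS0 cS' by simp
      then show False using finS V(4) by (simp add: card_gt_0_iff)
    qed
    then have "B' \<noteq> {}" unfolding B'_def by auto
    moreover have "card H' \<ge> x * card B'"
    proof -
      have "card H' = (\<Sum>v\<in>S'. card (F v))" unfolding H'_def card_image[OF inj] unfolding Q_def
        using finS' finF by simp
      also have "\<dots> \<ge> (\<Sum>v\<in>S'. k - 4 * x)" using F by (intro sum_mono) (simp add: le_diff_conv)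
      finally have a: "card H' \<ge> card S' * (k - 4 * x)" by simp
      have "real (card S) \<le> 2 * (real (card S') * (real (4 * x) + 1))" using cS0 cS' by linarith
      also have "\<dots> \<le> 2 * (real (card S') * real (5 * x))" using x by (intro mult_left_mono) auto
      finally have "real (card S) \<le> real (10 * x * card S')" by (simp add: algebra_simps)
      then have b: "card S \<le> 10 * x * card S'" by (simp only: of_nat_le_iff)
      have "card B' \<le> card S + 2 * r * card H"
        using card_Un_le[of S' W] card_mono[OF finS S'S] cW unfolding B'_def by linarith
      also have "\<dots> \<le> card S + 2 * r * (x * card S)" using False by (intro add_left_mono mult_le_mono) auto
      also have "\<dots> \<le> x * card S + 2 * r * (x * card S)" using x by (intro add_right_mono) simp
      also have "\<dots> = (2 * r + 1) * x * card S" by (simp add: algebra_simps)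
      also have "\<dots> \<le> (2 * r + 1) * x * (10 * x * card S')" using b by (intro mult_le_mono2)
      finally have "x * card B' \<le> x * ((2 * r + 1) * x * (10 * x * card S'))" by (rule mult_le_mono2)
      also have "\<dots> = card S' * (10 * (2 * r + 1) * x ^ 3)" by (simp add: power3_eq_cube algebra_simps)
      also have "\<dots> \<le> card S' * (k - 4 * x)"
      proof -
        have "x \<le> x ^ 3" using x by (simp add: self_le_power)
        then have "4 * x \<le> 10 * (2 * r + 1) * x ^ 3" using mult_le_mono[of 4 "10 * (2 * r + 1)" x "x ^ 3"] by simp
        moreover have "20 * (2 * r + 1) * x ^ 3 = 2 * (10 * (2 * r + 1) * x ^ 3)" by simp
        ultimately have "10 * (2 * r + 1) * x ^ 3 \<le> k - 4 * x" using k by linarith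
        then show ?thesis by (rule mult_le_mono2)
      qed
      finally show ?thesis using a by linarith
    qed
    ultimately show ?thesis by blast
  qed
qed

section \<open>Orderings with few reachable predecessors\<close>

text \<open>The last vertex is one without a large fan to the others; the others are ordered recursively.\<close>

lemma fan_bounded_ordering:
  assumes "finite V" "fan_bounded E V r k"
  shows "\<exists>vs. set vs = V \<and> distinct vs \<and>
    (\<forall>i<length vs. \<forall>F. fan E r (set (take i vs)) (vs ! i) F \<longrightarrow> card F < k)"
proof -
  have "\<exists>vs. set vs = S \<and> distinct vs \<and>
    (\<forall>i<length vs. \<forall>F. fan E r (set (take i vs)) (vs ! i) F \<longrightarrow> card F < k)" if "S \<subseteq> V" for S
    using finite_subset[OF that assms(1)] that
  proof (induction S rule: finite_psubset_induct)
    case (psubset S)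
    show ?case
    proof (cases "S = {}")
      case False
      then obtain v where v: "v \<in> S" "\<And>F. fan E r (S - {v}) v F \<Longrightarrow> card F < k"
        using assms(2) psubset.prems unfolding fan_bounded_def by metis
      have "S - {v} \<subset> S" "S - {v} \<subseteq> V" using v(1) psubset.prems by auto
      from psubset.IH[OF this] obtain vs where "set vs = S - {v} \<and> distinct vs \<and>
        (\<forall>i<length vs. \<forall>F. fan E r (set (take i vs)) (vs ! i) F \<longrightarrow> card F < k)" by (elim exE)
      then have vs: "set vs = S - {v}" "distinct vs"
        "\<And>i F. i < length vs \<Longrightarrow> fan E r (set (take i vs)) (vs ! i) F \<Longrightarrow> card F < k" by simp_all
      have "card F < k" if "i < length (vs @ [v])" "fan E r (set (take i (vs @ [v]))) ((vs @ [v]) ! i) F" for i F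
        using that v(2)[of F] vs(3)[of i F] vs(1) by (cases "i = length vs") (auto simp: nth_append)
      then show ?thesis using vs v(1) by (intro exI[of _ "vs @ [v]"]) auto
    qed simp
  qed
  then show ?thesis by blast
qed

text \<open>The paths of a fan of \<open>w\<close> into a prefix can be cut at the vertices that precede \<open>w\<close>.\<close>

lemma prefix_fan_bounded:
  assumes "set vs = V" "distinct vs"
    and vs: "\<And>i F. i < length vs \<Longrightarrow> fan E r (set (take i vs)) (vs ! i) F \<Longrightarrow> card F < k"
    and w: "w \<in> V - set (take i vs)" and F: "fan E r (set (take i vs)) w F"
  shows "card F < k"
proof -
  obtain j where j: "j < length vs" "w = vs ! j" using w assms(1) by (metis DiffD1 in_set_conv_nth)
  have "i \<le> j"
  proof (rule ccontr)
    assume "\<not> i \<le> j"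
    then have "w \<in> set (take i vs)" using j by (metis in_set_conv_nth length_take min_less_iff_conj not_le nth_take)
    then show False using w by simp
  qed
  then have sub: "set (take i vs) \<subseteq> set (take j vs)" by (rule set_take_subset_set_take)
  have "\<exists>F'. fan E r (set (take j vs)) w F' \<and> card F' = card F \<and> (\<forall>ys\<in>F'. \<exists>xs\<in>F. \<exists>zs. xs = ys @ zs)"
  proof (rule fan_truncate)
    fix xs assume "xs \<in> F"
    then have x: "xs \<noteq> []" "last xs \<in> set (take i vs)" "length xs \<le> r" "w \<notin> set xs" "walk E (w # xs)"
      using F unfolding fan_def by auto
    then have "last xs \<in> set xs \<inter> set (take j vs)" using sub by auto
    then show "length xs \<le> r \<and> w \<notin> set xs \<and> walk E (w # xs) \<and> set xs \<inter> set (take j vs) \<noteq> {}"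
      using x by blast
  qed (use F in \<open>auto simp: fan_def\<close>)
  then show ?thesis using vs[OF j(1)] unfolding j(2) by metis
qed

text \<open>If \<open>L\<close> consists of all predecessors of \<open>v\<close> in an ordering, these are the strongly reachable vertices of
  \<open>v\<close>; here \<open>L\<close> may be any initial segment that does not contain \<open>v\<close>.\<close>

definition reach :: "'a set set \<Rightarrow> nat \<Rightarrow> 'a set \<Rightarrow> 'a \<Rightarrow> 'a set" where
  "reach E r L v = {u \<in> L. \<exists>xs. xs \<noteq> [] \<and> length xs \<le> r \<and> last xs = u \<and> set (butlast xs) \<inter> L = {} \<and> walk E (v # xs)}"

lemma reach_subset: "reach E r L v \<subseteq> L"
  unfolding reach_def by blast

lemma reach_mono:
  assumes "q \<le> r"
  shows "reach E q L v \<subseteq> reach E r L v"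
proof
  fix u assume "u \<in> reach E q L v"
  then obtain xs where "u \<in> L" "xs \<noteq> []" "length xs \<le> q" "last xs = u" "set (butlast xs) \<inter> L = {}" "walk E (v # xs)"
    unfolding reach_def by auto
  then show "u \<in> reach E r L v" unfolding reach_def using assms by (intro CollectI conjI exI[of _ xs]) auto
qed

text \<open>Induction on the length of the walks: every walk to \<open>L\<close> meets a vertex of a maximal fan, from where it
  continues with fewer steps.\<close>

lemma reach_card:
  assumes V: "finite V" "E \<subseteq> [V]\<^bsup>2\<^esup>" and L: "L \<subseteq> V"
    and bd: "\<And>w F. w \<in> V - L \<Longrightarrow> fan E R L w F \<Longrightarrow> card F < k"
    and "v \<in> V - L" "r \<le> R"
  shows "card (reach E r L v) \<le> (k * (R + 1)) ^ r"
  using assms(5,6)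
proof (induction r arbitrary: v)
  case 0
  then have "reach E 0 L v = {}" unfolding reach_def by simp
  then show ?case by simp
next
  case (Suc r)
  define Q where "Q F \<longleftrightarrow> fan E R L v F" for F
  have "Q {}" unfolding Q_def fan_def by simp
  then obtain F where F: "Q F" and max: "\<And>F'. Q F' \<Longrightarrow> card F' \<le> card F"
    using ex_has_greatest_nat[of Q "{}" card k] bd[OF Suc.prems(1)] unfolding Q_def by (metis less_imp_le)
  have F': "fan E R L v F" "card F < k" "finite F" using F bd[OF Suc.prems(1)] unfolding Q_def fan_def by auto
  define W where "W = \<Union>(set ` F)"
  have k0: "k > 0" using F'(2) by simp
  have finW: "finite W" unfolding W_def using F'(3) by auto
  have "card W \<le> (\<Sum>xs\<in>F. card (set xs))" unfolding W_def by (rule card_UN_le[OF F'(3)])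
  also have "\<dots> \<le> (\<Sum>xs\<in>F. R)"
  proof (rule sum_mono)
    fix xs assume "xs \<in> F"
    then have "length xs \<le> R" using F'(1) unfolding fan_def by blast
    then show "card (set xs) \<le> R" using card_length[of xs] by linarith
  qed
  also have "\<dots> \<le> k * R" using F'(2) by simp
  finally have cW: "card W \<le> k * R" .
  have WV: "W \<subseteq> V"
  proof
    fix w assume "w \<in> W"
    then obtain xs where xs: "xs \<in> F" "w \<in> set xs" unfolding W_def by blast
    then have "xs \<noteq> []" "walk E (v # xs)" using F'(1) unfolding fan_def by blast+
    then show "w \<in> V" using walk_Cons_subset(2)[OF _ _ V(2)] xs(2) by blast
  qed
  define g where "g w = (if w \<in> L then {w} else reach E r L w)" for w
  have "reach E (Suc r) L v \<subseteq> (\<Union>w\<in>W. g w)"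
  proof
    fix u assume u: "u \<in> reach E (Suc r) L v"
    then obtain xs0 where x0: "xs0 \<noteq> []" "length xs0 \<le> Suc r" "last xs0 = u" "set (butlast xs0) \<inter> L = {}" "walk E (v # xs0)"
      and uL: "u \<in> L" unfolding reach_def by blast
    \<comment> \<open>Cut off everything before the last visit to \<open>v\<close>.\<close>
    obtain xs where x: "xs \<noteq> []" "length xs \<le> Suc r" "last xs = u" "set (butlast xs) \<inter> L = {}" "walk E (v # xs)" "v \<notin> set xs"
    proof (cases "v \<in> set xs0")
      case True
      then obtain as bs where ab: "xs0 = as @ v # bs" "v \<notin> set bs" by (meson split_list_last)
      have "bs \<noteq> []" using ab x0(3) uL Suc.prems(1) by auto
      moreover have "walk E (v # bs)" using x0(5) ab walk_append[of E "v # as" v bs] by simp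
      moreover have "last bs = u" using ab x0 \<open>bs \<noteq> []\<close> by simp
      moreover have "set (butlast bs) \<subseteq> set (butlast xs0)" using ab \<open>bs \<noteq> []\<close> by (auto simp: butlast_append)
      moreover have "length bs \<le> Suc r" using ab x0(2) by simp
      ultimately show ?thesis using that[of bs] x0 ab(2) by blast
    next
      case False
      then show ?thesis using that x0 by blast
    qed
    have "set xs \<inter> W \<noteq> {}"
    proof (rule ccontr)
      assume "\<not> ?thesis"
      then have d: "\<And>ys. ys \<in> F \<Longrightarrow> set xs \<inter> set ys = {}" unfolding W_def by blast
      then have "xs \<notin> F" using x(1) by fastforce
      moreover have "Q (insert xs F)" unfolding Q_def fan_def
      proof (intro conjI ballI impI)
        fix as bs assume "as \<in> insert xs F" "bs \<in> insert xs F" "as \<noteq> bs"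
        then show "set as \<inter> set bs = {}" using d F'(1) unfolding fan_def by (metis Int_commute insertE)
      qed (use F' x uL Suc.prems in \<open>auto simp: fan_def\<close>)
      ultimately show False using max[of "insert xs F"] F'(3) by simp
    qed
    then obtain w where w: "w \<in> set xs" "w \<in> W" by blast
    then obtain as bs where ab: "xs = as @ w # bs" by (meson split_list)
    have "u \<in> g w"
    proof (cases "bs = []")
      case True
      then show ?thesis using ab x uL unfolding g_def by auto
    next
      case False
      then have wL: "w \<notin> L" using ab x(4) by (auto simp: butlast_append)
      have "walk E (w # bs)" using x(5) ab walk_append[of E "v # as" w bs] by simp
      moreover have "set (butlast bs) \<inter> L = {}" using x(4) ab False by (auto simp: butlast_append)
      moreover have "length bs \<le> r" "last bs = u" using x(2,3) ab False by auto
      ultimately have "u \<in> reach E r L w" unfolding reach_def using uL False by blast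
      then show ?thesis using wL unfolding g_def by simp
    qed
    then show "u \<in> (\<Union>w\<in>W. g w)" using w(2) by blast
  qed
  moreover have finL: "finite L" using L V(1) by (rule finite_subset)
  have fing: "finite (g w)" for w unfolding g_def reach_def using finL by simp
  ultimately have "card (reach E (Suc r) L v) \<le> card (\<Union>w\<in>W. g w)" using finW by (intro card_mono) auto
  also have "\<dots> \<le> (\<Sum>w\<in>W. card (g w))" by (rule card_UN_le[OF finW])
  also have "\<dots> \<le> (\<Sum>w\<in>W. (k * (R + 1)) ^ r)"
  proof (rule sum_mono)
    fix w assume "w \<in> W"
    then show "card (g w) \<le> (k * (R + 1)) ^ r"
      using Suc.IH[of w] Suc.prems(2) WV k0 unfolding g_def by (auto simp: Suc_le_eq)
  qed
  also have "\<dots> \<le> (k * R) * (k * (R + 1)) ^ r" using cW by simp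
  also have "\<dots> \<le> (k * (R + 1)) ^ Suc r" by simp
  finally show ?case .
qed

theorem fan_bounded_reach_ordering:
  assumes "finite V" "E \<subseteq> [V]\<^bsup>2\<^esup>" "fan_bounded E V r k"
  shows "\<exists>vs. set vs = V \<and> distinct vs \<and>
    (\<forall>i. \<forall>v\<in>V - set (take i vs). card (reach E r (set (take i vs)) v) \<le> (k * (r + 1)) ^ r)"
proof -
  obtain vs where vs: "set vs = V" "distinct vs"
    "\<And>i F. i < length vs \<Longrightarrow> fan E r (set (take i vs)) (vs ! i) F \<Longrightarrow> card F < k"
    using fan_bounded_ordering[OF assms(1,3)] by metis
  have "card (reach E r (set (take i vs)) v) \<le> (k * (r + 1)) ^ r" if "v \<in> V - set (take i vs)" for i v
  proof (rule reach_card[OF assms(1,2) _ _ that le_refl])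
    show "set (take i vs) \<subseteq> V" using vs(1) set_take_subset[of i vs] by simp
    show "card F < k" if "w \<in> V - set (take i vs)" "fan E r (set (take i vs)) w F" for w F
      by (rule prefix_fan_bounded[OF vs(1,2) _ that]) (rule vs(3))
  qed
  then show ?thesis using vs(1,2) by blast
qed

section \<open>Nowhere dense classes have small fans\<close>

text \<open>Colour the pairs of branch vertices by the number of inner vertices of the path between them. Ramsey's theorem
  gives branch vertices between which all paths have the same length.\<close>

lemma model_gives_subdivided_clique:
  assumes G: "simple_graph G" and B: "finite B" "B \<subseteq> verts G" "card B = N"
    and I: "subdivision_model q (edges G) B ([B]\<^bsup>2\<^esup>) I"
    and ramsey: "partn_lst {..<N} ks 2" "length ks = Suc q"
  shows "\<exists>i\<le>q. contains_subgraph G (subdivided_clique i (ks ! i))"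
proof -
  note m = subdivision_modelD[OF I]
  have EG: "edges G \<subseteq> [verts G]\<^bsup>2\<^esup>" using G unfolding simple_graph_def by simp
  obtain b where b: "bij_betw b {0..<N} B" using ex_bij_betw_nat_finite[OF B(1)] B(3) by blast
  then have bj: "inj_on b {..<N}" "b ` {..<N} = B" unfolding bij_betw_def by (auto simp: atLeast0LessThan)
  have pair: "{b i, b j} \<in> [B]\<^bsup>2\<^esup>" if "i < j" "j < N" for i j
    using that bj inj_onD[OF bj(1), of i j] by auto
  have "\<exists>xs. set xs \<subseteq> I {b i, b j} \<and> distinct (b i # xs @ [b j]) \<and> walk (edges G) (b i # xs @ [b j])" if ij: "i < j" "j < N" for i j
  proof -
    have "b i \<noteq> b j" "b i \<notin> I {b i, b j}" "b j \<notin> I {b i, b j}" "linked (edges G) (I {b i, b j}) (b i) (b j)"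
      using pair[OF ij] m(4)[OF pair[OF ij]] m(6)[OF pair[OF ij]] by auto
    then show ?thesis using linked_path by metis
  qed
  then obtain P where P: "\<And>i j. i < j \<Longrightarrow> j < N \<Longrightarrow> set (P i j) \<subseteq> I {b i, b j} \<and> distinct (b i # P i j @ [b j]) \<and> walk (edges G) (b i # P i j @ [b j])"
    by metis
  have len: "length (P i j) \<le> q" if "i < j" "j < N" for i j
  proof -
    have "length (P i j) = card (set (P i j))" using P[OF that] by (simp add: distinct_card)
    also have "\<dots> \<le> card (I {b i, b j})" using P[OF that] m(2)[OF pair[OF that]] by (intro card_mono) auto
    finally show ?thesis using m(3)[OF pair[OF that]] by simp
  qed
  define f where "f e = length (P (Min e) (Max e))" for e
  have "f \<in> [{..<N}]\<^bsup>2\<^esup> \<rightarrow> {..<Suc q}"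
  proof
    fix e assume "e \<in> [{..<N}]\<^bsup>2\<^esup>"
    then obtain i j where ij: "e = {i, j}" "i < j" "j < N"
      by (elim nsets2_E) (metis insert_commute lessThan_iff linorder_neqE_nat)
    then show "f e \<in> {..<Suc q}" using len[of i j] unfolding f_def by (simp add: less_Suc_eq_le)
  qed
  then obtain r H where r: "r < Suc q" and H: "H \<in> nsets {..<N} (ks ! r)" "f ` (nsets H 2) \<subseteq> {r}"
    using partn_lstE[OF ramsey(1) _ ramsey(2)] ramsey(2) by metis
  define k where "k = ks ! r"
  have finH: "finite H" "card H = k" "H \<subseteq> {..<N}" using H(1) unfolding k_def nsets_def by auto
  define h where "h a = sorted_list_of_set H ! a" for a
  have hlen: "length (sorted_list_of_set H) = k" using finH by simp
  have hH: "h a \<in> H" if "a < k" for a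
    using nth_mem[of a "sorted_list_of_set H"] that hlen finH unfolding h_def by simp
  have hmono: "h a < h c" if "a < c" "c < k" for a c
    using that sorted_wrt_nth_less[OF strict_sorted_list_of_set[of H]] hlen unfolding h_def by simp
  have hN: "h a < N" if "a < k" for a using hH[OF that] finH by auto
  have lr: "length (P (h a) (h c)) = r" if "a < c" "c < k" for a c
  proof -
    have "{h a, h c} \<in> nsets H 2" using hH[of a] hH[of c] hmono[OF that] that by simp
    then have "f {h a, h c} = r" using H(2) by blast
    then show ?thesis using hmono[OF that] unfolding f_def by simp
  qed
  define \<phi> where "\<phi> x = (case x of Branch a \<Rightarrow> b (h a) | Inner a c p \<Rightarrow> P (h a) (h c) ! (p - 1))" for x
  have \<phi>: "\<phi> (subdivision_vertex r a c p) = (b (h a) # P (h a) (h c) @ [b (h c)]) ! p" if "a < c" "c < k" "p \<le> Suc r" for a c p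
    using that lr[of a c] by (cases p) (auto simp: subdivision_vertex_def \<phi>_def nth_append)
  have inner: "\<phi> (Inner a c p) \<in> set (P (h a) (h c))" if "a < c" "c < k" "1 \<le> p" "p \<le> r" for a c p
    using that lr[of a c] by (auto simp: \<phi>_def)
  have innerI: "\<phi> (Inner a c p) \<in> I {b (h a), b (h c)}" if "a < c" "c < k" "1 \<le> p" "p \<le> r" for a c p
    using inner[OF that] P[of "h a" "h c"] hmono[OF that(1,2)] hN[OF that(2)] by auto
  have hpair: "{b (h a), b (h c)} \<in> [B]\<^bsup>2\<^esup>" if "a < c" "c < k" for a c
    using pair[OF hmono[OF that] hN[OF that(2)]] .
  have branchB: "\<phi> (Branch a) \<in> B" if "a < k" for a using hN[OF that] bj by (auto simp: \<phi>_def)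
  have hinj: "a = c" if "h a = h c" "a < k" "c < k" for a c
    using that hmono[of a c] hmono[of c a] by (metis less_irrefl linorder_neqE_nat)
  have binj: "a = c" if "b (h a) = b (h c)" "a < k" "c < k" for a c
    using inj_onD[OF bj(1) that(1)] hN that hinj by simp
  have inj: "inj_on \<phi> (verts (subdivided_clique r k))"
  proof (rule inj_onI)
    fix x y assume a: "x \<in> verts (subdivided_clique r k)" "y \<in> verts (subdivided_clique r k)" "\<phi> x = \<phi> y"
    have nb: False if "a < k" "c < d" "d < k" "1 \<le> p" "p \<le> r" "\<phi> (Branch a) = \<phi> (Inner c d p)" for a c d p
      using branchB[OF that(1)] innerI[OF that(2-5)] m(4)[OF hpair[OF that(2,3)]] that(6) by auto
    show "x = y"
    proof (cases x)
      case x: (Branch a')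
      show ?thesis
      proof (cases y)
        case (Branch c)
        then show ?thesis using a x binj[of a' c] by (auto simp: subdivided_clique_def \<phi>_def)
      next
        case (Inner c d p)
        then show ?thesis using a x nb[of a' c d p] by (auto simp: subdivided_clique_def)
      qed
    next
      case x: (Inner a' c p)
      have ac: "a' < c" "c < k" "1 \<le> p" "p \<le> r" using a(1) x by (auto simp: subdivided_clique_def)
      show ?thesis
      proof (cases y)
        case (Branch d)
        then show ?thesis using a x ac nb[of d a' c p] by (auto simp: subdivided_clique_def)
      next
        case y: (Inner d e p')
        have de: "d < e" "e < k" "1 \<le> p'" "p' \<le> r" using a(2) y by (auto simp: subdivided_clique_def)
        have "I {b (h a'), b (h c)} \<inter> I {b (h d), b (h e)} \<noteq> {}" using innerI[OF ac] innerI[OF de] a(3) x y by auto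
        then have "{b (h a'), b (h c)} = {b (h d), b (h e)}" using m(5)[OF hpair[OF ac(1,2)] hpair[OF de(1,2)]] by blast
        then have eq: "a' = d \<and> c = e" 
          using binj[of a' d] binj[of a' e] binj[of c d] binj[of c e] ac de by (auto simp: doubleton_eq_iff)
        have "distinct (P (h a') (h c))" using P[of "h a'" "h c"] hmono[OF ac(1,2)] hN[OF ac(2)] by auto
        moreover have "P (h a') (h c) ! (p - 1) = P (h a') (h c) ! (p' - 1)" using a(3) eq x y by (simp add: \<phi>_def)
        ultimately have "p - 1 = p' - 1" using lr[OF ac(1,2)] ac de by (simp add: nth_eq_iff_index_eq)
        then show ?thesis using ac de eq x y by simp
      qed
    qed
  qed
  moreover have "\<phi> ` verts (subdivided_clique r k) \<subseteq> verts G"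
  proof
    fix y assume "y \<in> \<phi> ` verts (subdivided_clique r k)"
    then consider a where "a < k" "y = \<phi> (Branch a)" 
      | a c p where "a < c" "c < k" "1 \<le> p" "p \<le> r" "y = \<phi> (Inner a c p)"
      by (auto simp: subdivided_clique_def)
    then show "y \<in> verts G"
    proof cases
      case 1
      then show ?thesis using branchB B(2) by blast
    next
      case 2
      then have "walk (edges G) (b (h a) # P (h a) (h c) @ [b (h c)])" using P[of "h a" "h c"] hmono hN by blast
      from walk_subset(1)[OF this EG] show ?thesis using inner[OF 2(1-4)] 2(5) by auto
    qed
  qed
  moreover have "\<phi> ` e \<in> edges G" if e: "e \<in> edges (subdivided_clique r k)" for e
  proof -
    obtain a c p where acp: "e = {subdivision_vertex r a c p, subdivision_vertex r a c (p + 1)}" "a < c" "c < k" "p \<le> r"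
      using e by (auto simp: subdivided_clique_def)
    have "walk (edges G) (b (h a) # P (h a) (h c) @ [b (h c)])" 
      using P[of "h a" "h c"] hmono[OF acp(2,3)] hN[OF acp(3)] by blast
    from successively_nth[OF this, of p] show ?thesis
      unfolding acp(1) using \<phi>[OF acp(2,3), of p] \<phi>[OF acp(2,3), of "p + 1"] lr[OF acp(2,3)] acp(4) by simp
  qed
  ultimately have "contains_subgraph G (subdivided_clique r k)" unfolding contains_subgraph_def by blast
  then show ?thesis using r unfolding k_def by (intro exI[of _ r]) simp
qed

text \<open>If every vertex of a set has a fan of size of order \<open>x ^ 3\<close>, there is a shallow minor of density \<open>x\<close>. For
  \<open>x\<close> of order \<open>n powr \<delta>\<close> this minor, and with it the graph, contains a shallow subdivision of a large
  clique, which is excluded. So some vertex of the set has only fans of size below the order of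
  \<open>n powr (3 * \<delta>)\<close>.\<close>

theorem nowhere_dense_fan_bounded:
  fixes C :: "'a graph set" and \<epsilon> :: real
  assumes "\<forall>G\<in>C. simple_graph G" "nowhere_dense C" "\<epsilon> > 0"
  shows "\<exists>c. \<forall>G\<in>C. verts G \<noteq> {} \<longrightarrow> 
    (\<exists>k. fan_bounded (edges G) (verts G) r k \<and> real k \<le> c * real (card (verts G)) powr \<epsilon>)"
proof -
  define \<delta> where "\<delta> = min (\<epsilon> / 3) (1 / 2)"
  have \<delta>: "0 < \<delta>" "\<delta> \<le> 1/2" "3 * \<delta> \<le> \<epsilon>" using assms(3) unfolding \<delta>_def by auto
  obtain q where q: "\<forall>t. \<exists>A>0. \<forall>(V :: 'a set) E. finite V \<and> V \<noteq> {} \<and> E \<subseteq> [V]\<^bsup>2\<^esup> \<and> 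
    real (card E) \<ge> A * real (card V) powr (1 + \<delta>) \<longrightarrow>
    (\<exists>B I. B \<subseteq> V \<and> card B = t \<and> subdivision_model q E B ([B]\<^bsup>2\<^esup>) I)"
    using dense_graph_clique_subdivision[OF \<delta>(1,2)] by blast
  define Q where "Q = q + 2 ^ (q + 2) * (2 * r)"
  obtain kf where kf: "\<And>i G. G \<in> C \<Longrightarrow> \<not> contains_subgraph G (subdivided_clique i (kf i))"
    using assms(2) unfolding nowhere_dense_def by metis
  define ks where "ks = map kf [0..<Suc Q]"
  obtain N :: nat where N: "partn_lst {..<N} ks 2" using ramsey_full[of ks 2] by blast
  obtain A where A: "A > 0" "\<And>(V :: 'a set) E. finite V \<Longrightarrow> V \<noteq> {} \<Longrightarrow> E \<subseteq> [V]\<^bsup>2\<^esup> \<Longrightarrow>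
    real (card E) \<ge> A * real (card V) powr (1 + \<delta>) \<Longrightarrow>
    \<exists>B I. B \<subseteq> V \<and> card B = N \<and> subdivision_model q E B ([B]\<^bsup>2\<^esup>) I"
    using q[rule_format, of N] by metis
  define c where "c = 20 * (2 * real r + 1) * (A + 1) ^ 3"
  show ?thesis
  proof (intro exI[of _ c] ballI impI)
    fix G assume G: "G \<in> C" "verts G \<noteq> {}"
    define V where "V = verts G"
    define E where "E = edges G"
    have V: "finite V" "E \<subseteq> [V]\<^bsup>2\<^esup>" "V \<noteq> {}" using assms(1) G unfolding simple_graph_def V_def E_def by auto
    define n where "n = real (card V)"
    have n1: "n \<ge> 1" unfolding n_def using V by (simp add: Suc_leI card_gt_0_iff)
    have nd: "n powr \<delta> \<ge> 1" using n1 \<delta> by (intro ge_one_powr_ge_zero) auto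
    define x where "x = nat \<lceil>A * n powr \<delta>\<rceil>"
    have "A * n powr \<delta> > 0" using mult_pos_pos[OF A(1), of "n powr \<delta>"] nd by linarith
    then have x: "x \<ge> 1" "real x \<ge> A * n powr \<delta>" "real x \<le> A * n powr \<delta> + 1" unfolding x_def by linarith+
    define k where "k = 20 * (2 * r + 1) * x ^ 3"
    have "fan_bounded E V r k"
    proof (rule ccontr)
      assume "\<not> fan_bounded E V r k"
      then obtain S where S: "S \<subseteq> V" "S \<noteq> {}" "\<And>v. v \<in> S \<Longrightarrow> \<exists>F. fan E r (S - {v}) v F \<and> card F \<ge> k"
        unfolding fan_bounded_def by (metis not_le)
      obtain B' H' I' where 1: "B' \<subseteq> V" "B' \<noteq> {}" "subdivision_model (2 * r) E B' H' I'" "card H' \<ge> x * card B'"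
        using fans_give_dense_minor[OF V(1,2) S(1,2) x(1) _ S(3)] unfolding k_def by blast
      have finB': "finite B'" using finite_subset[OF 1(1) V(1)] .
      have H': "H' \<subseteq> [B']\<^bsup>2\<^esup>" using subdivision_modelD(1)[OF 1(3)] .
      let ?b = "real (card B')"
      have b0: "?b > 0" using 1(2) finB' by (simp add: card_gt_0_iff)
      have "A * ?b powr (1 + \<delta>) = A * ?b powr \<delta> * ?b" using b0 by (simp add: powr_mult_base[symmetric])
      also have "\<dots> \<le> A * n powr \<delta> * ?b"
        using A(1) \<delta> card_mono[OF V(1) 1(1)] unfolding n_def 
        by (intro mult_right_mono mult_left_mono powr_mono2) auto
      also have "\<dots> \<le> real x * ?b" using x(2) by (intro mult_right_mono) auto
      also have "\<dots> \<le> real (card H')" using 1(4) by (metis of_nat_le_iff of_nat_mult)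
      finally obtain B I where 2: "B \<subseteq> B'" "card B = N" "subdivision_model q H' B ([B]\<^bsup>2\<^esup>) I"
        using A(2)[OF finB' 1(2) H'] by blast
      have "\<exists>J. subdivision_model Q E B ([B]\<^bsup>2\<^esup>) J" unfolding Q_def
        using subdivision_model_compose[OF 1(3) subdivision_model_restrict[OF 2(3) H'] 2(1)] by blast
      then obtain J where "subdivision_model Q (edges G) B ([B]\<^bsup>2\<^esup>) J" unfolding E_def by blast
      moreover have "finite B" "B \<subseteq> verts G" using 1(1) 2(1) finB' finite_subset unfolding V_def by auto
      moreover have "length ks = Suc Q" unfolding ks_def by simp
      ultimately obtain i where i: "i \<le> Q" "contains_subgraph G (subdivided_clique i (ks ! i))"
        using model_gives_subdivided_clique[of G B N Q J ks] assms(1) G(1) 2(2) N by blast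
      have "ks ! i = kf i" unfolding ks_def using i(1) by (simp del: upt_Suc)
      then show False using kf[OF G(1), of i] i(2) by simp
    qed
    moreover have "real k \<le> c * n powr \<epsilon>"
    proof -
      have "real x \<le> (A + 1) * n powr \<delta>" using x(3) nd by (simp add: algebra_simps)
      then have "real x ^ 3 \<le> ((A + 1) * n powr \<delta>) ^ 3" by (intro power_mono) auto
      also have "\<dots> = (A + 1) ^ 3 * n powr (3 * \<delta>)"
      proof -
        have "(n powr \<delta>) ^ 3 = (n powr \<delta>) powr 3" using nd by (intro powr_numeral[symmetric]) linarith
        then show ?thesis by (simp add: power_mult_distrib powr_powr mult.commute)
      qed
      also have "\<dots> \<le> (A + 1) ^ 3 * n powr \<epsilon>" using A(1) n1 \<delta> by (intro mult_left_mono powr_mono) auto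
      finally have "20 * (2 * real r + 1) * real x ^ 3 \<le> 20 * (2 * real r + 1) * ((A + 1) ^ 3 * n powr \<epsilon>)"
        by (rule mult_left_mono) simp
      then show ?thesis unfolding k_def c_def
        by (simp only: mult.assoc of_nat_mult of_nat_power of_nat_add of_nat_numeral of_nat_1)
    qed
    ultimately show "\<exists>k. fan_bounded (edges G) (verts G) r k \<and> real k \<le> c * real (card (verts G)) powr \<epsilon>"
      unfolding E_def V_def n_def by blast
  qed
qed

section \<open>Upper bounds for merge-width and flip-width\<close>

subsection \<open>Neighbourhood traces in graphs without large bicliques\<close>

definition biclique_free :: "nat \<Rightarrow> 'a set set \<Rightarrow> bool" where
  "biclique_free t E \<longleftrightarrow> \<not> (\<exists>A B. finite A \<and> finite B \<and> card A = t \<and> card B = t \<and> A \<inter> B = {} \<and>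
     (\<forall>a\<in>A. \<forall>b\<in>B. {a, b} \<in> E))"

text \<open>A set with at most \<open>t\<close> elements is given by a list of length \<open>t\<close> over \<open>D\<close> and one blank symbol.\<close>

lemma card_small_subsets:
  assumes "finite D"
  shows "card {T. T \<subseteq> D \<and> card T \<le> t} \<le> (card D + 1) ^ t"
proof -
  let ?A = "insert None (Some ` D)"
  let ?L = "{xs. set xs \<subseteq> ?A \<and> length xs = t}"
  have sub: "{T. T \<subseteq> D \<and> card T \<le> t} \<subseteq> (\<lambda>xs. {x. Some x \<in> set xs}) ` ?L"
  proof
    fix T assume "T \<in> {T. T \<subseteq> D \<and> card T \<le> t}"
    then have T: "T \<subseteq> D" "card T \<le> t" "finite T" using finite_subset[OF _ assms] by auto
    obtain ys where ys: "set ys = T" "distinct ys" using finite_distinct_list[OF T(3)] by blast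
    let ?xs = "map Some ys @ replicate (t - card T) None"
    have "length ys = card T" using distinct_card[OF ys(2)] ys(1) by simp
    then have "?xs \<in> ?L" using T ys by auto
    moreover have "{x. Some x \<in> set ?xs} = T" using ys by auto
    ultimately show "T \<in> (\<lambda>xs. {x. Some x \<in> set xs}) ` ?L" by blast
  qed
  have "finite ?L" using assms by (intro finite_lists_length_eq) simp
  then have "card {T. T \<subseteq> D \<and> card T \<le> t} \<le> card ?L" using sub by (rule surj_card_le)
  also have "\<dots> = card ?A ^ t" using assms by (intro card_lists_length_eq) simp
  also have "card ?A = card D + 1" using assms by (simp add: card_image)
  finally show ?thesis .
qed

text \<open>A trace of size at least \<open>t\<close> contains a set of size \<open>t\<close>, and fewer than \<open>t\<close> traces can
  share it.\<close>

lemma card_traces: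
  assumes "biclique_free t E" "finite D" "finite W"
    and W: "\<And>w. w \<in> W \<Longrightarrow> w \<notin> D"
  shows "card ((\<lambda>w. {u \<in> D. {u, w} \<in> E}) ` W) \<le> (t + 1) * (card D + 1) ^ t"
proof -
  define tr where "tr w = {u \<in> D. {u, w} \<in> E}" for w
  define S where "S = {T. T \<subseteq> D \<and> card T \<le> t}"
  have finS: "finite S" unfolding S_def using assms(2) by auto
  have cS: "card S \<le> (card D + 1) ^ t" unfolding S_def by (rule card_small_subsets[OF assms(2)])
  define G where "G T = {X \<in> tr ` W. T \<subseteq> X}" for T
  have finG: "finite (G T)" for T unfolding G_def using assms(3) by simp
  have G: "card (G T) \<le> t" if T: "T \<in> S" "card T = t" for T
  proof (rule ccontr)
    assume "\<not> card (G T) \<le> t"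
    then have "t \<le> card (G T)" by simp
    then obtain Y where Y: "Y \<subseteq> G T" "card Y = t" "finite Y" using obtain_subset_with_card_n by metis
    define f where "f = inv_into W tr"
    have f: "f X \<in> W" "tr (f X) = X" if "X \<in> Y" for X
    proof -
      have "X \<in> tr ` W" using that Y(1) unfolding G_def by blast
      then show "f X \<in> W" "tr (f X) = X" unfolding f_def by (rule inv_into_into, rule f_inv_into_f)
    qed
    have "inj_on f Y" using f(2) by (metis inj_onI)
    then have cf: "card (f ` Y) = t" using Y(2) by (simp add: card_image)
    have "{a, b} \<in> E" if ab: "a \<in> T" "b \<in> f ` Y" for a b
    proof -
      obtain X where X: "X \<in> Y" "b = f X" using ab(2) by blast
      then have "a \<in> tr b" using f(2)[OF X(1)] Y(1) ab(1) unfolding G_def by auto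
      then show ?thesis unfolding tr_def by simp
    qed
    moreover have "T \<inter> f ` Y = {}" using T(1) W f(1) unfolding S_def by blast
    moreover have "finite T" using T(1) assms(2) finite_subset unfolding S_def by auto
    ultimately show False using assms(1) T(2) cf Y(3) unfolding biclique_free_def by blast
  qed
  have "tr ` W \<subseteq> S \<union> (\<Union>T\<in>{T \<in> S. card T = t}. G T)"
  proof
    fix X assume X: "X \<in> tr ` W"
    then have XD: "X \<subseteq> D" unfolding tr_def by auto
    show "X \<in> S \<union> (\<Union>T\<in>{T \<in> S. card T = t}. G T)"
    proof (cases "card X \<le> t")
      case True
      then show ?thesis using XD unfolding S_def by simp
    next
      case False
      then obtain T where "T \<subseteq> X" "card T = t" by (meson linear obtain_subset_with_card_n)
      moreover from this have "T \<in> {T \<in> S. card T = t}" using XD unfolding S_def by auto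
      ultimately have "X \<in> G T" "T \<in> {T \<in> S. card T = t}" using X unfolding G_def by auto
      then show ?thesis by blast
    qed
  qed
  then have "card (tr ` W) \<le> card (S \<union> (\<Union>T\<in>{T \<in> S. card T = t}. G T))"
    using finS finG by (intro card_mono) auto
  also have "\<dots> \<le> card S + card (\<Union>T\<in>{T \<in> S. card T = t}. G T)" by (rule card_Un_le)
  also have "card (\<Union>T\<in>{T \<in> S. card T = t}. G T) \<le> (\<Sum>T\<in>{T \<in> S. card T = t}. card (G T))"
    using finS by (intro card_UN_le) simp
  also have "\<dots> \<le> (\<Sum>T\<in>{T \<in> S. card T = t}. t)" using G by (intro sum_mono) auto
  also have "\<dots> \<le> card S * t" using finS by (simp add: card_mono)
  finally have "card (tr ` W) \<le> (t + 1) * card S" by (simp add: mult.commute)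
  also have "\<dots> \<le> (t + 1) * (card D + 1) ^ t" using cS by (rule mult_le_mono2)
  finally show ?thesis unfolding tr_def .
qed

subsection \<open>Walks and distances\<close>

lemma within_distD:
  assumes "within_dist G r u v"
  obtains ys where "length ys \<le> r" "walk (edges G) (u # ys)" "last (u # ys) = v" "u \<in> verts G" "v \<in> verts G"
    "set ys \<subseteq> verts G"
proof -
  obtain xs where xs: "is_path G xs" "hd xs = u" "last xs = v" "length xs - 1 \<le> r"
    using assms unfolding within_dist_def by blast
  then have "xs = u # tl xs" unfolding is_path_def by (metis list.collapse)
  moreover have "last xs \<in> verts G" using xs(1) unfolding is_path_def by (meson last_in_set subsetD)
  ultimately show ?thesis using that[of "tl xs"] xs unfolding is_path_def
    by (metis insert_subset length_tl list.simps(15))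
qed

lemma within_dist_Graph:
  "within_dist (Graph V F) r u v \<Longrightarrow>
    \<exists>ys. length ys \<le> r \<and> walk F (u # ys) \<and> last (u # ys) = v \<and> u \<in> V \<and> v \<in> V \<and> set ys \<subseteq> V"
  by (erule within_distD) auto

lemma within_distI:
  assumes "length ys \<le> r" "walk (edges G) (u # ys)" "last (u # ys) = v" "set (u # ys) \<subseteq> verts G"
  shows "within_dist G r u v"
proof -
  obtain zs where zs: "walk (edges G) zs" "distinct zs" "zs \<noteq> []" "hd zs = u" "last zs = v"
    "set zs \<subseteq> set (u # ys)" "length zs \<le> length (u # ys)"
    using walk_shorten[OF assms(2)] assms(3) by auto
  have "is_path G zs" unfolding is_path_def using zs assms(4) by blast
  moreover have "length zs - 1 \<le> r" using zs(7) assms(1) by simp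
  ultimately show ?thesis unfolding within_dist_def using zs(4,5) by blast
qed

subsection \<open>Construction sequences\<close>

definition refines :: "'a set set \<Rightarrow> 'a set set \<Rightarrow> bool" where
  "refines P Q \<longleftrightarrow> (\<forall>A\<in>P. \<exists>B\<in>Q. A \<subseteq> B)"

definition narrow :: "'a set \<Rightarrow> nat \<Rightarrow> nat \<Rightarrow> 'a cstate \<Rightarrow> bool" where
  "narrow V r k s \<longleftrightarrow> (\<forall>v\<in>V. card (reachable_parts V r s v) \<le> k)"

definition narrow_step :: "'a set \<Rightarrow> nat \<Rightarrow> nat \<Rightarrow> 'a cstate \<Rightarrow> 'a cstate \<Rightarrow> bool" where
  "narrow_step V r k s s' \<longleftrightarrow> construction_step s s' \<and> narrow V r k s'"

text \<open>A part of the coarser partition is reachable only if it contains a reachable part of the finer one. Hence along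
  a sequence of merges, or of resolutions, only the finest partition and the largest set of
  resolved pairs matter.\<close>

lemma narrow_mono:
  assumes P: "partition_on V P" "partition_on V P'" "finite V" "refines P P'"
    and E: "E' \<union> N' \<subseteq> E \<union> N" and narrow: "narrow V r k (P, E, N, U)"
  shows "narrow V r k (P', E', N', U')"
  unfolding narrow_def
proof
  fix v assume v: "v \<in> V"
  let ?R = "reachable_parts V r (P, E, N, U) v" and ?R' = "reachable_parts V r (P', E', N', U') v"
  obtain g where g: "\<And>A. A \<in> P \<Longrightarrow> g A \<in> P' \<and> A \<subseteq> g A" using P(4) unfolding refines_def by metis
  have "?R' \<subseteq> g ` ?R"
  proof
    fix B assume "B \<in> ?R'"
    then obtain w where w: "B \<in> P'" "w \<in> B" "within_dist (Graph V (E' \<union> N')) r v w" unfolding reachable_parts_def by auto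
    obtain ys where ys: "length ys \<le> r" "walk (E' \<union> N') (v # ys)" "last (v # ys) = w" "w \<in> V" "set ys \<subseteq> V"
      using within_dist_Graph[OF w(3)] by blast
    then have d: "within_dist (Graph V (E \<union> N)) r v w" using v walk_mono[OF _ E] by (intro within_distI) auto
    obtain A where A: "A \<in> P" "w \<in> A" using ys(4) P(1) unfolding partition_on_def by blast
    have "g A = B" using g[OF A(1)] A(2) w(1,2) P(2) unfolding partition_on_def disjoint_def by (metis disjoint_iff subsetD)
    moreover have "A \<in> ?R" unfolding reachable_parts_def using A d by auto
    ultimately show "B \<in> g ` ?R" by blast
  qed
  moreover have "finite ?R" using finite_elements[OF P(3,1)] unfolding reachable_parts_def by simp
  ultimately have "card ?R' \<le> card ?R" by (meson surj_card_le)
  also have "\<dots> \<le> k" using narrow v unfolding narrow_def by blast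
  finally show "card ?R' \<le> k" .
qed

lemma partition_on_merge:
  assumes "partition_on V P" "A \<in> P" "B \<in> P" "A \<noteq> B"
  shows "partition_on V (insert (A \<union> B) (P - {A, B}))"
proof (rule partition_onI)
  show "\<Union> (insert (A \<union> B) (P - {A, B})) = V" using assms unfolding partition_on_def by blast
  show "{} \<notin> insert (A \<union> B) (P - {A, B})" using assms unfolding partition_on_def by blast
  show "disjnt p q" if "p \<in> insert (A \<union> B) (P - {A, B})" "q \<in> insert (A \<union> B) (P - {A, B})" "p \<noteq> q" for p q
    using that assms unfolding partition_on_def disjoint_def disjnt_def by auto
qed

text \<open>Parts inside a common part of \<open>Q\<close> are merged one pair at a time, so all partitions on the way are coarser
  than \<open>P\<close>.\<close>

lemma merge_to_coarser:
  assumes "finite V" "partition_on V Q"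
    and narrow: "narrow V r k (P, E, N, U)" and "partition_on V P" "refines P Q"
  shows "(narrow_step V r k)\<^sup>*\<^sup>* (P, E, N, U) (Q, E, N, U)"
  using narrow assms(4,5)
proof (induction "card P" arbitrary: P rule: less_induct)
  case less
  have finP: "finite P" using finite_elements[OF assms(1)] less by blast
  show ?case
  proof (cases "Q \<subseteq> P")
    case True
    have "P \<subseteq> Q"
    proof
      fix A assume A: "A \<in> P"
      then obtain B where B: "B \<in> Q" "A \<subseteq> B" using less.prems unfolding refines_def by blast
      then have "B \<in> P" "A \<noteq> {}" using True less.prems A unfolding partition_on_def by auto
      then have "A = B" using A B less.prems unfolding partition_on_def disjoint_def by blast
      then show "A \<in> Q" using B by simp
    qed
    then show ?thesis using True by simp
  next
    case False
    then obtain B where B: "B \<in> Q" "B \<notin> P" by blast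
    have "B \<noteq> {}" using B(1) partition_onD3[OF assms(2)] by auto
    then obtain x where x: "x \<in> B" by blast
    have BV: "B \<subseteq> V" using B(1) assms(2) unfolding partition_on_def by blast
    have inB: "A \<subseteq> B" if "A \<in> P" "y \<in> A" "y \<in> B" for A y
    proof -
      obtain B' where "B' \<in> Q" "A \<subseteq> B'" using less.prems(3) \<open>A \<in> P\<close> unfolding refines_def by blast
      then show ?thesis using that B(1) assms(2) unfolding partition_on_def disjoint_def by blast
    qed
    obtain A1 where A1: "A1 \<in> P" "x \<in> A1" using x BV less.prems(2) unfolding partition_on_def by blast
    have "A1 \<subseteq> B" "A1 \<noteq> B" using inB[OF A1 x] A1 B by auto
    then obtain y where y: "y \<in> B" "y \<notin> A1" by blast
    obtain A2 where A2: "A2 \<in> P" "y \<in> A2" using y BV less.prems(2) unfolding partition_on_def by blast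
    have ne: "A1 \<noteq> A2" using y A2 by auto
    define P' where "P' = insert (A1 \<union> A2) (P - {A1, A2})"
    have p': "partition_on V P'" unfolding P'_def by (rule partition_on_merge[OF less.prems(2) A1(1) A2(1) ne])
    have ref: "refines P P'" unfolding refines_def P'_def by auto
    have ref': "refines P' Q" 
      using less.prems(3) B(1) \<open>A1 \<subseteq> B\<close> inB[OF A2 y(1)] unfolding refines_def P'_def by auto
    have n': "narrow V r k (P', E, N, U)" by (rule narrow_mono[OF less.prems(2) p' assms(1) ref _ less.prems(1)]) simp
    have "card P' < card P"
    proof -
      have "card P' \<le> Suc (card (P - {A1, A2}))" unfolding P'_def using finP by (simp add: card_insert_le_m1)
      also have "card (P - {A1, A2}) = card P - 2" using A1(1) A2(1) ne finP by (simp add: card_Diff_subset)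
      also have "card P \<ge> 2" using card_mono[of P "{A1, A2}"] A1(1) A2(1) ne finP by simp
      then have "Suc (card P - 2) < card P" by linarith
      finally show ?thesis .
    qed
    from less.hyps[OF this n' p' ref'] 
    have "(narrow_step V r k)\<^sup>*\<^sup>* (P', E, N, U) (Q, E, N, U)" .
    moreover have "narrow_step V r k (P, E, N, U) (P', E, N, U)"
      unfolding narrow_step_def using n' construction_step.merge[OF A1(1) A2(1) ne] unfolding P'_def by blast
    ultimately show ?thesis by (rule converse_rtranclp_into_rtranclp[rotated])
  qed
qed

lemma resolve_pairs_positively:
  assumes "finite V" "partition_on V P" "finite D" "D \<subseteq> P \<times> P"
    and "narrow V r k (P, E \<union> (U \<inter> (\<Union>(A, B)\<in>D. pairs_between A B)), N, U0)"
  shows "(narrow_step V r k)\<^sup>*\<^sup>* (P, E, N, U)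
    (P, E \<union> (U \<inter> (\<Union>(A, B)\<in>D. pairs_between A B)), N, U - (\<Union>(A, B)\<in>D. pairs_between A B))"
  using assms(3,4,5)
proof (induction D rule: finite_induct)
  case empty
  then show ?case by simp
next
  case (insert p D)
  obtain A B where p: "p = (A, B)" by (metis surj_pair)
  define X where "X = (\<Union>(A, B)\<in>D. pairs_between A B)"
  define Y where "Y = pairs_between A B"
  have XY: "(\<Union>(A, B)\<in>insert p D. pairs_between A B) = Y \<union> X" unfolding X_def Y_def p by simp
  have refl: "refines P P" unfolding refines_def by blast
  note prem = insert.prems(2)[unfolded XY]
  have n1: "narrow V r k (P, E \<union> (U \<inter> X), N, U0)"
    by (rule narrow_mono[OF assms(2,2,1) refl _ prem]) blast
  then have 1: "(narrow_step V r k)\<^sup>*\<^sup>* (P, E, N, U) (P, E \<union> (U \<inter> X), N, U - X)"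
    using insert unfolding X_def by auto
  have "construction_step (P, E \<union> (U \<inter> X), N, U - X) 
    (P, (E \<union> (U \<inter> X)) \<union> ((U - X) \<inter> Y), N, (U - X) - Y)"
    unfolding Y_def using insert.prems(1) p by (intro construction_step.resolve_positively) auto
  moreover have "(E \<union> (U \<inter> X)) \<union> ((U - X) \<inter> Y) = E \<union> (U \<inter> (Y \<union> X))" by blast
  moreover have "(U - X) - Y = U - (Y \<union> X)" by blast
  moreover have "narrow V r k (P, E \<union> (U \<inter> (Y \<union> X)), N, U - (Y \<union> X))"
    by (rule narrow_mono[OF assms(2,2,1) refl _ prem]) blast
  ultimately have "narrow_step V r k (P, E \<union> (U \<inter> X), N, U - X) (P, E \<union> (U \<inter> (Y \<union> X)), N, U - (Y \<union> X))"
    unfolding narrow_step_def by simp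
  then show ?case unfolding XY by (rule rtranclp.rtrancl_into_rtrancl[OF 1])
qed

lemma rtranclp_list:
  assumes "R\<^sup>*\<^sup>* a b"
  shows "\<exists>ss. ss \<noteq> [] \<and> hd ss = a \<and> last ss = b \<and> successively R ss"
  using assms
proof (induction rule: rtranclp_induct)
  case base
  show ?case by (intro exI[of _ "[a]"]) simp
next
  case (step y z)
  then obtain ss where "ss \<noteq> [] \<and> hd ss = a \<and> last ss = y \<and> successively R ss" by blast
  then show ?case using step(2) by (intro exI[of _ "ss @ [z]"]) (simp add: successively_append_iff)
qed

lemma narrow_sequence:
  assumes init: "narrow V r k s" and "(narrow_step V r k)\<^sup>*\<^sup>* s s'"
  shows "\<exists>ss. ss \<noteq> [] \<and> hd ss = s \<and> last ss = s' \<and> successively construction_step ss \<and> (\<forall>x\<in>set ss. narrow V r k x)"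
proof -
  obtain ss where ss: "ss \<noteq> []" "hd ss = s" "last ss = s'" "successively (narrow_step V r k) ss"
    using rtranclp_list[OF assms(2)] by blast
  have "successively construction_step ss" 
    using ss(4) by (rule successively_mono) (simp add: narrow_step_def)
  moreover have "narrow V r k (ss ! i)" if "i < length ss" for i
  proof (cases i)
    case 0
    then show ?thesis using ss(1,2) init by (simp add: hd_conv_nth)
  next
    case (Suc j)
    then show ?thesis using successively_nth[OF ss(4), of j] that unfolding narrow_step_def by simp
  qed
  then have "\<forall>x\<in>set ss. narrow V r k x" by (metis in_set_conv_nth)
  ultimately show ?thesis using ss by blast
qed

definition parts_by :: "'a set \<Rightarrow> ('a \<Rightarrow> 'b) \<Rightarrow> 'a set set" where
  "parts_by V f = (\<lambda>x. {y \<in> V. f y = f x}) ` V"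

lemma partition_parts_by: "partition_on V (parts_by V f)"
proof (rule partition_onI)
  show "disjnt p q" if "p \<in> parts_by V f" "q \<in> parts_by V f" "p \<noteq> q" for p q
    using that unfolding parts_by_def disjnt_def by auto
qed (auto simp: parts_by_def)

lemma refines_parts_by:
  assumes "\<And>x y. x \<in> V \<Longrightarrow> y \<in> V \<Longrightarrow> f x = f y \<Longrightarrow> g x = g y"
  shows "refines (parts_by V f) (parts_by V g)"
  unfolding refines_def
proof
  fix A assume "A \<in> parts_by V f"
  then obtain x where x: "x \<in> V" "A = {y \<in> V. f y = f x}" unfolding parts_by_def by blast
  have "A \<subseteq> {y \<in> V. g y = g x}"
  proof
    fix y assume "y \<in> A"
    then show "y \<in> {y \<in> V. g y = g x}" using assms[of y x] x by simp
  qed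
  then show "\<exists>B\<in>parts_by V g. A \<subseteq> B" using x unfolding parts_by_def by blast
qed

subsection \<open>A construction sequence from an ordering\<close>

text \<open>The vertices are removed from the ordering from its end. While the prefix \<open>L\<close> is left, the
  partition separates the vertices of \<open>L\<close> and groups the other vertices by their neighbourhood
  in \<open>L\<close>, and exactly the edges outside \<open>L\<close> are resolved.\<close>

definition prefix_key :: "'a set set \<Rightarrow> 'a set \<Rightarrow> 'a \<Rightarrow> 'a + 'a set" where
  "prefix_key E L x = (if x \<in> L then Inl x else Inr {u \<in> L. {u, x} \<in> E})"

text \<open>A neighbour in \<open>L\<close> of a vertex reached from \<open>v\<close> is reached with one more step. Apart from the part of
  \<open>u\<close>, the reachable parts are therefore determined by traces on a set with at most \<open>K + 1\<close> elements.\<close>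

lemma merge_width_stage_narrow:
  assumes V: "finite V" "E \<subseteq> [V]\<^bsup>2\<^esup>" and L: "insert u L \<subseteq> V" "u \<notin> L"
    and free: "biclique_free t E"
    and K: "\<And>v. v \<in> V - L \<Longrightarrow> card (reach E (Suc r) L v) \<le> K"
  shows "narrow V r ((t + 1) * (K + 2) ^ t + 1)
    (parts_by V (prefix_key E (insert u L)), {e \<in> E. e \<subseteq> V - L}, {}, U)"
  unfolding narrow_def
proof
  fix v assume v: "v \<in> V"
  let ?F = "{e \<in> E. e \<subseteq> V - L}" and ?key = "prefix_key E (insert u L)"
  let ?R = "reachable_parts V r (parts_by V ?key, ?F, {}, U) v"
  have F: "?F \<subseteq> [V - L]\<^bsup>2\<^esup>" "?F \<subseteq> E" using V(2) by (auto simp: nsets_def)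
  have R: "\<exists>w. w \<in> V \<and> A = {y \<in> V. ?key y = ?key w} \<and> within_dist (Graph V ?F) r v w" if A: "A \<in> ?R" for A
  proof -
    obtain w where w: "A \<in> parts_by V ?key" "w \<in> A" "within_dist (Graph V ?F) r v w"
      using A unfolding reachable_parts_def by auto
    then show ?thesis unfolding parts_by_def by auto
  qed
  show "card ?R \<le> (t + 1) * (K + 2) ^ t + 1"
  proof (cases "v \<in> L")
    case True
    have "w = v" if d: "within_dist (Graph V ?F) r v w" for w
    proof -
      obtain ys where ys: "walk ?F (v # ys)" "last (v # ys) = w" using within_dist_Graph[OF d] by blast
      have "ys = []" using walk_Cons_subset(1)[OF ys(1) _ F(1)] True by blast
      then show ?thesis using ys(2) by simp
    qed
    then have "?R \<subseteq> {{y \<in> V. ?key y = ?key v}}" using R by blast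
    then have "card ?R \<le> 1" using card_mono[of "{{y \<in> V. ?key y = ?key v}}" ?R] by simp
    then show ?thesis by linarith
  next
    case False
    define D where "D = reach E (Suc r) L v"
    define Z where "Z = {w \<in> V - insert u L. within_dist (Graph V ?F) r v w}"
    have D: "D \<subseteq> L" unfolding D_def reach_def by auto
    have finL: "finite L" using L(1) V(1) finite_subset by auto
    then have finD: "finite D" using D finite_subset by blast
    have finZ: "finite Z" unfolding Z_def using V(1) by simp
    have tr: "{x \<in> insert u L. {x, w} \<in> E} = {x \<in> insert u D. {x, w} \<in> E}" if w: "w \<in> Z" for w
    proof -
      have "x \<in> D" if x: "x \<in> L" "{x, w} \<in> E" for x
      proof -
        have d: "within_dist (Graph V ?F) r v w" using w unfolding Z_def by simp
        obtain ys where ys: "length ys \<le> r" "walk ?F (v # ys)" "last (v # ys) = w"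
          using within_dist_Graph[OF d] by blast
        have "set ys \<subseteq> V - L" using walk_Cons_subset(2)[OF ys(2) _ F(1)] by (cases "ys = []") auto
        moreover have "walk E ((v # ys) @ [x])"
          unfolding successively_append_iff using walk_mono[OF ys(2) F(2)] ys(3) x(2) by (auto simp: insert_commute)
        ultimately show ?thesis unfolding D_def reach_def using x(1) ys(1)
          by (auto intro!: exI[of _ "ys @ [x]"])
      qed
      then show ?thesis using D by blast
    qed
    have "?R \<subseteq> insert {y \<in> V. ?key y = ?key u} ((\<lambda>T. {y \<in> V. ?key y = Inr T}) ` ((\<lambda>w. {x \<in> insert u D. {x, w} \<in> E}) ` Z))"
      (is "_ \<subseteq> insert _ (?f ` ?T)")
    proof
      fix A assume "A \<in> ?R"
      then obtain w where w: "w \<in> V" "A = {y \<in> V. ?key y = ?key w}" "within_dist (Graph V ?F) r v w" using R by blast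
      have "w \<in> V - L"
      proof -
        obtain ys where ys: "walk ?F (v # ys)" "last (v # ys) = w" using within_dist_Graph[OF w(3)] by blast
        show ?thesis
        proof (cases "ys = []")
          case True
          then show ?thesis using ys v False by simp
        next
          case ne: False
          then have "last ys = w" using ys by simp
          then show ?thesis using walk_Cons_subset(2)[OF ys(1) ne F(1)] last_in_set[OF ne] by auto
        qed
      qed
      show "A \<in> insert {y \<in> V. ?key y = ?key u} (?f ` ?T)"
      proof (cases "w = u")
        case True
        then show ?thesis using w by simp
      next
        case False
        then have wZ: "w \<in> Z" using \<open>w \<in> V - L\<close> w(3) unfolding Z_def by simp
        then have "?key w = Inr {x \<in> insert u D. {x, w} \<in> E}" using tr[OF wZ] unfolding prefix_key_def Z_def by simp
        then show ?thesis using w(2) wZ by auto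
      qed
    qed
    then have "card ?R \<le> card (insert {y \<in> V. ?key y = ?key u} (?f ` ?T))"
      using finZ by (intro card_mono) auto
    also have "\<dots> \<le> Suc (card (?f ` ?T))" by (rule card_insert_le_m1[of "Suc _", simplified]) simp
    also have "card (?f ` ?T) \<le> card ?T" using finZ by (intro card_image_le) simp
    also have "card ?T \<le> (t + 1) * (card (insert u D) + 1) ^ t"
      using free finD finZ D by (intro card_traces) (auto simp: Z_def)
    also have "\<dots> \<le> (t + 1) * (K + 2) ^ t"
    proof -
      have "card (insert u D) \<le> K + 1" using K[of v] v False card_insert_le_m1[of "K + 1" D u] unfolding D_def by simp
      then show ?thesis by (intro mult_le_mono2 power_mono) auto
    qed
    finally show ?thesis by simp
  qed
qed

text \<open>To pass from the prefix \<open>L (Suc i)\<close> to \<open>L i\<close>, resolve positively the removed vertex with the parts of its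
  neighbours and merge the parts that are no longer distinguished. The nonedges are resolved at the very end, since
  resolving them earlier could make almost everything reachable.\<close>

lemma merge_width_sequence:
  assumes G: "simple_graph G" and vs: "set vs = verts G" "distinct vs" and free: "biclique_free t (edges G)"
    and K: "\<And>i v. v \<in> verts G - set (take i vs) \<Longrightarrow> card (reach (edges G) (Suc r) (set (take i vs)) v) \<le> K"
    and ne: "verts G \<noteq> {}"
  shows "\<exists>ss. construction_sequence G ss \<and> (\<forall>s\<in>set ss. narrow (verts G) r ((t + 1) * (K + 2) ^ t + 1) s)"
proof -
  define V where "V = verts G"
  define E where "E = edges G"
  define n where "n = length vs"
  define k where "k = (t + 1) * (K + 2) ^ t + 1"
  define L where "L i = set (take i vs)" for i
  define F where "F i = {e \<in> E. e \<subseteq> V - L i}" for i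
  define P where "P i = parts_by V (prefix_key E (L i))" for i
  define stage where "stage i = (P i, F i, {} :: 'a set set, [V]\<^bsup>2\<^esup> - F i)" for i
  have V: "finite V" "E \<subseteq> [V]\<^bsup>2\<^esup>" using G unfolding simple_graph_def V_def E_def by auto
  have LV: "L i \<subseteq> V" for i unfolding L_def V_def using vs(1) set_take_subset by metis
  have n0: "n > 0" unfolding n_def using vs(1) ne by auto
  have Lsuc: "L (Suc i) = insert (vs ! i) (L i)" "vs ! i \<notin> L i" if "i < n" for i
  proof -
    show "L (Suc i) = insert (vs ! i) (L i)" unfolding L_def using that by (simp add: take_Suc_conv_app_nth n_def)
    show "vs ! i \<notin> L i"
    proof
      assume "vs ! i \<in> L i"
      then obtain j where "j < i" "vs ! j = vs ! i" unfolding L_def by (auto simp: in_set_conv_nth)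
      then show False using vs(2) that unfolding n_def by (simp add: nth_eq_iff_index_eq)
    qed
  qed
  have Pp: "partition_on V (P i)" for i unfolding P_def by (rule partition_parts_by)
  have nar: "narrow V r k (P (Suc i), F i, {}, U)" if "i < n" for i U
    unfolding k_def P_def F_def Lsuc(1)[OF that]
  proof (rule merge_width_stage_narrow[OF V _ Lsuc(2)[OF that]])
    show "insert (vs ! i) (L i) \<subseteq> V" using LV[of "Suc i"] Lsuc(1)[OF that] by simp
    show "biclique_free t E" using free unfolding E_def .
    show "card (reach E (Suc r) (L i) v) \<le> K" if "v \<in> V - L i" for v using K that unfolding V_def E_def L_def by blast
  qed
  have refl: "refines Q Q" for Q :: "'a set set" unfolding refines_def by blast
  have Fmono: "F (Suc i) \<subseteq> F i" if "i < n" for i unfolding F_def using Lsuc(1)[OF that] by auto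
  have init: "narrow V r k (stage n)"
  proof -
    obtain m where m: "n = Suc m" "m < n" using n0 by (cases n) auto
    show ?thesis unfolding stage_def m(1) by (rule narrow_mono[OF Pp Pp V(1) refl _ nar[OF m(2)]]) (use Fmono[OF m(2)] in auto)
  qed
  have step: "(narrow_step V r k)\<^sup>*\<^sup>* (stage (Suc i)) (stage i)" if i: "i < n" for i
  proof -
    define u where "u = vs ! i"
    note Ls = Lsuc[OF i, folded u_def]
    have u: "u \<in> V" using LV[of "Suc i"] Ls(1) by simp
    define D where "D = {({u}, A) | A. A \<in> P (Suc i) \<and> A \<inter> L (Suc i) = {} \<and> (\<forall>w\<in>A. {u, w} \<in> E)}"
    define X where "X = (\<Union>(A, B)\<in>D. pairs_between A B)"
    have pu: "{u} \<in> P (Suc i)"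
    proof -
      have "{y \<in> V. prefix_key E (L (Suc i)) y = prefix_key E (L (Suc i)) u} = {u}"
        using u Ls(1) by (auto simp: prefix_key_def)
      then show ?thesis unfolding P_def parts_by_def using u by blast
    qed
    have finP: "finite (P (Suc i))" using finite_elements[OF V(1) Pp] .
    have D: "D \<subseteq> P (Suc i) \<times> P (Suc i)" "finite D"
    proof -
      show "D \<subseteq> P (Suc i) \<times> P (Suc i)" unfolding D_def using pu by auto
      then show "finite D" using finP finite_subset by blast
    qed
    have X: "X \<inter> ([V]\<^bsup>2\<^esup> - F (Suc i)) \<union> F (Suc i) = F i"
    proof
      show "X \<inter> ([V]\<^bsup>2\<^esup> - F (Suc i)) \<union> F (Suc i) \<subseteq> F i"
      proof
        fix e assume e: "e \<in> X \<inter> ([V]\<^bsup>2\<^esup> - F (Suc i)) \<union> F (Suc i)"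
        show "e \<in> F i"
        proof (cases "e \<in> F (Suc i)")
          case True
          then show ?thesis using Fmono[OF i] by blast
        next
          case False
          then have "e \<in> X" using e by blast
          then obtain A w where A: "A \<in> P (Suc i)" "A \<inter> L (Suc i) = {}" "\<forall>w\<in>A. {u, w} \<in> E" "w \<in> A" "e = {u, w}" "u \<noteq> w"
            unfolding X_def D_def pairs_between_def by auto
          have "w \<notin> L i" using A(2,4) Ls(1) by blast
          moreover have "w \<in> V" using A(1,4) Pp[of "Suc i"] unfolding partition_on_def by blast
          ultimately show ?thesis using A u Ls(2) unfolding F_def by auto
        qed
      qed
    next
      show "F i \<subseteq> X \<inter> ([V]\<^bsup>2\<^esup> - F (Suc i)) \<union> F (Suc i)"
      proof
        fix e assume e: "e \<in> F i"
        have e2: "e \<in> [V]\<^bsup>2\<^esup>" using e V(2) unfolding F_def by auto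
        show "e \<in> X \<inter> ([V]\<^bsup>2\<^esup> - F (Suc i)) \<union> F (Suc i)"
        proof (cases "e \<in> F (Suc i)")
          case False
          then have "u \<in> e" using e Ls(1) unfolding F_def by auto
          obtain a b where ab: "e = {a, b}" "a \<noteq> b" using e2 by (auto elim: nsets2_E)
          obtain w where w: "e = {u, w}" "u \<noteq> w"
          proof (cases "a = u")
            case True
            then show ?thesis using that[of b] ab by auto
          next
            case False
            then show ?thesis using that[of a] ab \<open>u \<in> e\<close> by auto
          qed
          have wV: "w \<in> V" "w \<notin> L (Suc i)" "{u, w} \<in> E" using e w Ls(1) unfolding F_def by auto
          define A where "A = {y \<in> V. prefix_key E (L (Suc i)) y = prefix_key E (L (Suc i)) w}"
          have "A \<in> P (Suc i)" unfolding A_def P_def parts_by_def using wV by blast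
          moreover have AL: "A \<inter> L (Suc i) = {}" unfolding A_def using wV(2) by (auto simp: prefix_key_def)
          moreover have "\<forall>y\<in>A. {u, y} \<in> E"
          proof
            fix y assume y: "y \<in> A"
            then have "y \<notin> L (Suc i)" using AL by blast
            then have "{x \<in> L (Suc i). {x, y} \<in> E} = {x \<in> L (Suc i). {x, w} \<in> E}"
              using y wV(2) unfolding A_def by (simp add: prefix_key_def)
            moreover have "u \<in> {x \<in> L (Suc i). {x, w} \<in> E}" using wV(3) Ls(1) by simp
            ultimately show "{u, y} \<in> E" by blast
          qed
          ultimately have "({u}, A) \<in> D" unfolding D_def by blast
          moreover have "w \<in> A" unfolding A_def using wV by simp
          then have "e \<in> pairs_between {u} A" unfolding pairs_between_def using w by auto
          ultimately have "e \<in> X" unfolding X_def by blast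
          then show ?thesis using e2 False by blast
        qed simp
      qed
    qed
    let ?U = "[V]\<^bsup>2\<^esup> - F (Suc i)"
    have eq: "F (Suc i) \<union> (?U \<inter> X) = F i" "?U - X = [V]\<^bsup>2\<^esup> - F i" using X by blast+
    have "narrow V r k (P (Suc i), F (Suc i) \<union> (?U \<inter> X), {}, ?U)" unfolding eq by (rule nar[OF i])
    from resolve_pairs_positively[OF V(1) Pp D(2,1) this[unfolded X_def]]
    have 1: "(narrow_step V r k)\<^sup>*\<^sup>* (stage (Suc i)) (P (Suc i), F i, {}, [V]\<^bsup>2\<^esup> - F i)"
      unfolding X_def[symmetric] eq stage_def .
    have "refines (P (Suc i)) (P i)" unfolding P_def
    proof (rule refines_parts_by)
      fix x y assume xy: "x \<in> V" "y \<in> V" "prefix_key E (L (Suc i)) x = prefix_key E (L (Suc i)) y"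
      show "prefix_key E (L i) x = prefix_key E (L i) y"
      proof (cases "x = y")
        case False
        then have "x \<notin> L (Suc i)" "y \<notin> L (Suc i)"
          and tr: "{z \<in> L (Suc i). {z, x} \<in> E} = {z \<in> L (Suc i). {z, y} \<in> E}"
          using xy(3) by (auto simp: prefix_key_def split: if_splits)
        moreover from tr have "{z \<in> L i. {z, x} \<in> E} = {z \<in> L i. {z, y} \<in> E}" unfolding Ls(1) using Ls(2) by blast
        ultimately show ?thesis using Ls(1) by (simp add: prefix_key_def)
      qed simp
    qed
    from merge_to_coarser[OF V(1) Pp nar[OF i] Pp this]
    have "(narrow_step V r k)\<^sup>*\<^sup>* (P (Suc i), F i, {}, [V]\<^bsup>2\<^esup> - F i) (stage i)" unfolding stage_def .
    with 1 show ?thesis by (rule rtranclp_trans)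
  qed
  have all: "(narrow_step V r k)\<^sup>*\<^sup>* (stage n) (stage (n - i))" if "i \<le> n" for i
    using that
  proof (induction i)
    case (Suc i)
    then have "Suc (n - Suc i) = n - i" "n - Suc i < n" by auto
    then have "(narrow_step V r k)\<^sup>*\<^sup>* (stage (n - i)) (stage (n - Suc i))" using step[of "n - Suc i"] by simp
    then show ?case using Suc by (meson Suc_leD rtranclp_trans)
  qed simp
  have "P 0 = {V}" unfolding P_def parts_by_def L_def prefix_key_def using ne V_def by auto
  moreover have "F 0 = E" unfolding F_def L_def using V(2) by (auto simp: nsets_def)
  ultimately have s0: "stage 0 = ({V}, E, {}, [V]\<^bsup>2\<^esup> - E)" unfolding stage_def by simp
  let ?U = "[V]\<^bsup>2\<^esup> - E"
  have "?U \<subseteq> pairs_between V V" unfolding pairs_between_def by (auto elim!: nsets2_E)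
  then have U0: "?U - pairs_between V V = {}" by blast
  have "construction_step ({V}, E, {}, ?U) ({V}, E, {} \<union> (?U \<inter> pairs_between V V), {})"
    using construction_step.resolve_negatively[of V "{V}" V E "{}" ?U, unfolded U0] by simp
  moreover have "narrow V r k ({V}, E, N, U)" for N U
  proof -
    have "reachable_parts V r ({V}, E, N, U) v \<subseteq> {V}" for v unfolding reachable_parts_def by auto
    then have "card (reachable_parts V r ({V}, E, N, U) v) \<le> 1" for v
      using card_mono[of "{V}" "reachable_parts V r ({V}, E, N, U) v"] by simp
    moreover have "1 \<le> k" unfolding k_def by simp
    ultimately show ?thesis unfolding narrow_def using le_trans by blast
  qed
  ultimately have "narrow_step V r k (stage 0) ({V}, E, {} \<union> (?U \<inter> pairs_between V V), {})"
    unfolding narrow_step_def s0 by blast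
  then have "(narrow_step V r k)\<^sup>*\<^sup>* (stage n) ({V}, E, {} \<union> (?U \<inter> pairs_between V V), {})"
    using all[of n] by (simp add: rtranclp.rtrancl_into_rtrancl)
  from narrow_sequence[OF init this] obtain ss where ss: "ss \<noteq> []" "hd ss = stage n" 
    "last ss = ({V}, E, {} \<union> (?U \<inter> pairs_between V V), {})" "successively construction_step ss" 
    "\<forall>x\<in>set ss. narrow V r k x" by blast
  have Ln: "L n = V" unfolding L_def n_def V_def using vs(1) by simp
  have "P n = (\<lambda>v. {v}) ` V" unfolding P_def parts_by_def Ln by (intro image_cong refl) (auto simp: prefix_key_def)
  moreover have "F n = {}" unfolding F_def Ln using V(2) by (auto simp: nsets_def)
  ultimately have "stage n = initial_state V" unfolding stage_def initial_state_def by simp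
  then have "construction_sequence G ss" unfolding construction_sequence_def
    using ss(1-4) unfolding V_def[symmetric] E_def[symmetric] by auto
  then show ?thesis using ss(5) unfolding V_def k_def by blast
qed

lemma merge_width_le:
  assumes "construction_sequence G ss" "\<forall>s\<in>set ss. narrow (verts G) r k s"
  shows "merge_width r G \<le> k"
proof -
  have "merge_width r G \<le> sequence_width (verts G) r ss"
    unfolding merge_width_def using assms(1) by (intro Least_le) blast
  also have "\<dots> \<le> k"
    unfolding sequence_width_def using assms(2) by (intro Least_le) (auto simp: narrow_def)
  finally show ?thesis .
qed

subsection \<open>A strategy of flipper from an ordering\<close>

text \<open>The vertices of \<open>S\<close> are made parts of their own, and the others are grouped by their neighbourhood in \<open>S\<close>.
  Then the edges between a vertex of \<open>S\<close> and another part are all or none of the pairs, so that a flip can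
  remove them.\<close>

lemma isolating_flip:
  assumes G: "simple_graph G" and free: "biclique_free t (edges G)" and S: "S \<subseteq> verts G" "card S \<le> s"
  shows "k_flip (s + (t + 1) * (s + 1) ^ t) G (Graph (verts G) {e \<in> edges G. e \<inter> S = {}})"
proof -
  define V where "V = verts G"
  define E where "E = edges G"
  define G' where "G' = Graph V {e \<in> E. e \<inter> S = {}}"
  have V: "finite V" "E \<subseteq> [V]\<^bsup>2\<^esup>" using G unfolding simple_graph_def V_def E_def by auto
  have finS: "finite S" using finite_subset[OF S(1)] V(1) unfolding V_def by simp
  define P where "P = parts_by V (prefix_key E S)"
  have p: "partition_on V P" unfolding P_def by (rule partition_parts_by)
  have "P \<subseteq> (\<lambda>u. {y \<in> V. prefix_key E S y = Inl u}) ` S \<union>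
    (\<lambda>T. {y \<in> V. prefix_key E S y = Inr T}) ` (\<lambda>w. {u \<in> S. {u, w} \<in> E}) ` (V - S)" (is "_ \<subseteq> ?f ` S \<union> ?g ` ?T")
  proof
    fix A assume "A \<in> P"
    then obtain w where w: "w \<in> V" "A = {y \<in> V. prefix_key E S y = prefix_key E S w}" unfolding P_def parts_by_def by blast
    show "A \<in> ?f ` S \<union> ?g ` ?T"
    proof (cases "w \<in> S")
      case True
      then have "A = ?f w" using w(2) by (simp add: prefix_key_def)
      then show ?thesis using True by blast
    next
      case False
      then have "A = ?g {u \<in> S. {u, w} \<in> E}" using w(2) by (simp add: prefix_key_def)
      then show ?thesis using False w(1) by blast
    qed
  qed
  then have "card P \<le> card (?f ` S \<union> ?g ` ?T)" using finS V(1) by (intro card_mono) auto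
  also have "\<dots> \<le> card (?f ` S) + card (?g ` ?T)" by (rule card_Un_le)
  also have "card (?f ` S) \<le> s" using card_image_le[OF finS, of ?f] S(2) by linarith
  also have "card (?g ` ?T) \<le> card ?T" using V(1) by (intro card_image_le) simp
  also have "card ?T \<le> (t + 1) * (card S + 1) ^ t"
    using free V(1) finS unfolding E_def by (intro card_traces) auto
  also have "\<dots> \<le> (t + 1) * (s + 1) ^ t" using S(2) by (intro mult_le_mono2 power_mono) auto
  finally have "card P \<le> s + (t + 1) * (s + 1) ^ t" by simp
  moreover have "partition_flip G P G'"
    unfolding partition_flip_def
  proof (intro conjI ballI)
    show "simple_graph G'" unfolding simple_graph_def G'_def using V by auto
    show "verts G' = verts G" unfolding G'_def V_def by simp
    fix A B assume AB: "A \<in> P" "B \<in> P"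
    have single: "edges G \<inter> pairs_between A B = {} \<or> pairs_between A B \<subseteq> edges G" and empty: "edges G' \<inter> pairs_between A B = {}"
      if ab: "A \<in> P" "B \<in> P" "a \<in> A" "a \<in> S" for A B a
    proof -
      obtain w where "A = {y \<in> V. prefix_key E S y = prefix_key E S w}" using ab(1) unfolding P_def parts_by_def by blast
      then have A: "A = {a}" using ab(3,4) by (auto simp: prefix_key_def split: if_splits)
      then show "edges G' \<inter> pairs_between A B = {}" using ab(4) unfolding G'_def pairs_between_def by auto
      obtain z where B: "B = {y \<in> V. prefix_key E S y = prefix_key E S z}" using ab(2) unfolding P_def parts_by_def by blast
      have "{a, x} \<in> E \<longleftrightarrow> {a, y} \<in> E" if xy: "x \<in> B" "y \<in> B" for x y
      proof (cases "x = y")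
        case False
        have k: "prefix_key E S x = prefix_key E S y" using xy B by simp
        then have "{u \<in> S. {u, x} \<in> E} = {u \<in> S. {u, y} \<in> E}" using False by (auto simp: prefix_key_def split: if_splits)
        then show ?thesis using \<open>a \<in> S\<close> by blast
      qed simp
      then show "edges G \<inter> pairs_between A B = {} \<or> pairs_between A B \<subseteq> edges G"
        unfolding A E_def pairs_between_def by blast
    qed
    have comm: "pairs_between A B = pairs_between B A" unfolding pairs_between_def by (auto simp: insert_commute)
    show "edges G' \<inter> pairs_between A B = edges G \<inter> pairs_between A B \<or>
        edges G' \<inter> pairs_between A B = pairs_between A B - edges G"
    proof (cases "\<exists>a\<in>S. a \<in> A \<or> a \<in> B")
      case True
      then have "edges G' \<inter> pairs_between A B = {}" 
        "edges G \<inter> pairs_between A B = {} \<or> pairs_between A B \<subseteq> edges G"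
        using single[OF AB] empty[OF AB] single[OF AB(2,1)] empty[OF AB(2,1)] comm by metis+
      then show ?thesis by blast
    next
      case False
      then have "edges G' \<inter> pairs_between A B = edges G \<inter> pairs_between A B"
        unfolding G'_def E_def pairs_between_def by auto
      then show ?thesis by blast
    qed
  qed
  ultimately show ?thesis using p unfolding k_flip_def G'_def V_def E_def by blast
qed

lemma path_prefix_within_dist:
  assumes "length ys \<le> r" "walk (edges G) (u # ys)" "set (u # ys) \<subseteq> verts G" "y \<in> set (u # ys)"
  shows "within_dist G r u y"
proof -
  obtain as bs where ab: "u # ys = as @ y # bs" using assms(4) by (meson split_list)
  show ?thesis
  proof (cases as)
    case Nil
    then have "y = u" using ab by simp
    then show ?thesis using assms(3) by (intro within_distI[of "[]"]) auto
  next
    case (Cons a as')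
    then have ab': "a = u" "ys = as' @ y # bs" using ab by auto
    then have "walk (edges G) (u # as' @ [y])" using assms(2) walk_append[of _ "u # as'" y bs] by simp
    then show ?thesis using assms(1,3) ab' by (intro within_distI[of "as' @ [y]"]) auto
  qed
qed

text \<open>In round \<open>t + 1\<close> flipper isolates the next vertex of the ordering and everything that
  runner could reach from her position among the first \<open>t\<close> vertices within two moves. Thus
  runner is confined to an ever smaller final segment of the ordering.\<close>

lemma flipper_wins_ordering:
  assumes G: "simple_graph G" and vs: "set vs = verts G" "distinct vs" and free: "biclique_free t (edges G)"
    and K: "\<And>i v. v \<in> verts G - set (take i vs) \<Longrightarrow> card (reach (edges G) (2 * r) (set (take i vs)) v) \<le> K"
  shows "flipper_wins r (Suc K + (t + 1) * (Suc K + 1) ^ t) G"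
proof -
  define V where "V = verts G"
  define E where "E = edges G"
  define n where "n = length vs"
  define L where "L i = set (take i vs)" for i
  have V: "finite V" "E \<subseteq> [V]\<^bsup>2\<^esup>" using G unfolding simple_graph_def V_def E_def by auto
  have LV: "L i \<subseteq> V" for i unfolding L_def V_def using vs(1) set_take_subset by metis
  define legal where "legal h \<longleftrightarrow> h \<noteq> [] \<and> length h \<le> n \<and> last h \<in> V - L (length h - 1)" for h
  define S where "S h = (if legal h
    then insert (vs ! (length h - 1)) (reach E (2 * r) (L (length h - 1)) (last h)) else {})" for h
  define \<sigma> where "\<sigma> h = Graph V {e \<in> E. e \<inter> S h = {}}" for h
  have "S h \<subseteq> V \<and> card (S h) \<le> Suc K" for h
  proof (cases "legal h")
    case True
    then have "length h - 1 < n" unfolding legal_def by (cases h) auto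
    moreover have "last h \<in> V - L (length h - 1)" "S h = insert (vs ! (length h - 1)) (reach E (2 * r) (L (length h - 1)) (last h))"
      using True unfolding legal_def S_def by auto
    ultimately have l: "length h - 1 < n" "last h \<in> V - L (length h - 1)" "S h = insert (vs ! (length h - 1)) (reach E (2 * r) (L (length h - 1)) (last h))"
      by blast+
    have "vs ! (length h - 1) \<in> V" using l(1) nth_mem vs(1) unfolding n_def V_def by blast
    moreover have "reach E (2 * r) (L (length h - 1)) (last h) \<subseteq> V" using LV unfolding reach_def by auto
    moreover have "card (reach E (2 * r) (L (length h - 1)) (last h)) \<le> K"
      using K l(2) unfolding L_def E_def V_def by blast
    then have "card (S h) \<le> Suc K" unfolding l(3) by (rule card_insert_le_m1[of "Suc K", simplified])
    ultimately show ?thesis unfolding l(3) by simp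
  next
    case False
    then show ?thesis unfolding S_def by simp
  qed
  then have flip: "k_flip (Suc K + (t + 1) * (Suc K + 1) ^ t) G (\<sigma> h)" for h
    unfolding \<sigma>_def V_def E_def by (intro isolating_flip[OF G free]) auto
  have "\<exists>i\<ge>1. isolated (announced_graph G \<sigma> v i) (v i)"
    if v0: "v 0 \<in> V" and moves: "\<And>i. i \<ge> 1 \<Longrightarrow> within_dist (announced_graph G \<sigma> v (i - 1)) r (v (i - 1)) (v i)" for v
  proof (rule ccontr)
    assume no: "\<not> ?thesis"
    let ?G = "announced_graph G \<sigma> v"
    have ann: "verts (?G i) = V" "edges (?G i) \<subseteq> E" for i
      unfolding announced_graph_def \<sigma>_def V_def E_def by auto
    have vV: "v i \<in> V" for i
    proof (cases i)
      case 0
      then show ?thesis using v0 by simp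
    next
      case (Suc j)
      then show ?thesis using moves[of i] ann(1)[of j] by (auto elim: within_distD)
    qed
    have inv: "\<forall>w. within_dist (?G i) r (v i) w \<longrightarrow> w \<notin> L i" if "i \<le> n" for i
      using that
    proof (induction i)
      case 0
      then show ?case unfolding L_def by simp
    next
      case (Suc i)
      define x where "x = vs ! i"
      have Lsuc: "L (Suc i) = insert x (L i)" unfolding L_def x_def using Suc.prems by (simp add: take_Suc_conv_app_nth n_def)
      have IH: "w \<notin> L i" if "within_dist (?G i) r (v i) w" for w using Suc that by simp
      have "within_dist (?G i) r (v i) (v i)" using vV ann by (intro within_distI[of "[]"]) auto
      then have vi: "v i \<in> V - L i" using IH vV by simp
      define h where "h = map v [0..<Suc i]"
      have h: "length h = Suc i" "last h = v i" "h \<noteq> []" unfolding h_def by auto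
      then have "legal h" unfolding legal_def using Suc.prems vi by simp
      then have Sh: "S h = insert x (reach E (2 * r) (L i) (v i))" unfolding S_def using h x_def by simp
      have Gs: "?G (Suc i) = Graph V {e \<in> E. e \<inter> S h = {}}" unfolding announced_graph_def \<sigma>_def h_def by simp
      obtain xs where xs: "length xs \<le> r" "walk (edges (?G i)) (v i # xs)" "last (v i # xs) = v (Suc i)" "set xs \<subseteq> V"
        using moves[of "Suc i"] ann(1) by (auto elim: within_distD)
      have xsL: "y \<notin> L i" if "y \<in> set (v i # xs)" for y
        using path_prefix_within_dist[OF xs(1,2) _ that] xs(4) vi ann(1) IH by auto
      have vL: "v (Suc i) \<notin> L i" using xsL last_in_set[of "v i # xs"] xs(3) by auto
      have notS: "v (Suc i) \<notin> S h"
      proof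
        assume "v (Suc i) \<in> S h"
        then have "isolated (?G (Suc i)) (v (Suc i))" unfolding Gs isolated_def by auto
        then show False using no by auto
      qed
      show ?case
      proof (intro allI impI notI)
        fix w assume w: "within_dist (?G (Suc i)) r (v (Suc i)) w" "w \<in> L (Suc i)"
        obtain ys where ys: "length ys \<le> r" "walk {e \<in> E. e \<inter> S h = {}} (v (Suc i) # ys)" "last (v (Suc i) # ys) = w"
          using within_dist_Graph[OF w(1)[unfolded Gs]] by blast
        have edge: "y \<notin> S h" if yy: "y \<in> set ys" for y
        proof -
          obtain as bs where "ys = as @ y # bs" using yy by (meson split_list)
          then have "walk {e \<in> E. e \<inter> S h = {}} ((v (Suc i) # as) @ y # bs)" using ys(2) by simp
          then have "{last (v (Suc i) # as), y} \<in> {e \<in> E. e \<inter> S h = {}}" unfolding successively_append_iff by simp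
          then show ?thesis by auto
        qed
        have "w \<noteq> v (Suc i)" using w(2) vL notS Sh Lsuc by auto
        then have wy: "w \<in> set ys" using ys(3) by (cases "ys = []") auto
        then have "w \<noteq> x" using edge Sh by auto
        then have "\<exists>y\<in>set ys. y \<in> L i" using w(2) Lsuc wy by auto
        then obtain as y bs where y: "ys = as @ y # bs" "y \<in> L i" "\<forall>a\<in>set as. a \<notin> L i"
          by (rule split_list_first_propE)
        have "walk E (v (Suc i) # as @ [y])"
        proof -
          have "walk E ((v (Suc i) # as) @ y # bs)" using walk_mono[OF ys(2)] y(1) by auto
          then show ?thesis using walk_append[of E "v (Suc i) # as" y bs] by simp
        qed
        moreover have "walk E (v i # xs)" by (rule walk_mono[OF xs(2) ann(2)])
        ultimately have "walk E ((v i # xs) @ (as @ [y]))"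
          unfolding successively_append_iff[of _ "v i # xs"] using xs(3) by (auto simp: successively_Cons)
        moreover have "set (butlast (xs @ as @ [y])) \<inter> L i = {}" using xsL y(3) by (auto simp: butlast_append)
        moreover have "length (xs @ as @ [y]) \<le> 2 * r" using xs(1) ys(1) y(1) by simp
        ultimately have "y \<in> reach E (2 * r) (L i) (v i)" unfolding reach_def using y(2)
          by (auto intro!: exI[of _ "xs @ as @ [y]"])
        then show False using edge[of y] y(1) Sh by simp
      qed
    qed
    have "within_dist (?G n) r (v n) (v n)" using vV ann by (intro within_distI[of "[]"]) auto
    then have "v n \<notin> L n" using inv[of n] by blast
    then show False using vV[of n] vs(1) unfolding L_def n_def V_def by simp
  qed
  then show ?thesis unfolding flipper_wins_def using flip unfolding V_def by blast
qed

lemma flip_width_le: "flipper_wins r k G \<Longrightarrow> flip_width r G \<le> k"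
  unfolding flip_width_def by (rule Least_le)

section \<open>Lower bounds for merge-width and flip-width\<close>

subsection \<open>Bounded walks inside a vertex set\<close>

definition nearin :: "'a set set \<Rightarrow> 'a set \<Rightarrow> nat \<Rightarrow> 'a \<Rightarrow> 'a \<Rightarrow> bool" where
  "nearin E W d x y \<longleftrightarrow> (\<exists>ys. length ys \<le> d \<and> walk E (x # ys) \<and> last (x # ys) = y \<and> set (x # ys) \<subseteq> W)"

lemma nearin_mono: "nearin E W d x y \<Longrightarrow> E \<subseteq> E' \<Longrightarrow> W \<subseteq> W' \<Longrightarrow> d \<le> d' \<Longrightarrow> nearin E' W' d' x y"
  unfolding nearin_def by (elim exE conjE, intro exI conjI, erule (1) le_trans, erule (1) walk_mono, assumption, erule (1) subset_trans)

lemma nearin_refl: "x \<in> W \<Longrightarrow> nearin E W d x x"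
  unfolding nearin_def by (intro exI[of _ "[]"]) simp

lemma nearin_edge: "{x, y} \<in> E \<Longrightarrow> x \<in> W \<Longrightarrow> y \<in> W \<Longrightarrow> nearin E W 1 x y"
  unfolding nearin_def by (intro exI[of _ "[y]"]) simp

lemma nearin_ends: "nearin E W d x y \<Longrightarrow> x \<in> W \<and> y \<in> W"
  unfolding nearin_def by (metis insert_subset last_in_set list.distinct(1) list.simps(15) subsetD)

lemma nearin_trans:
  assumes "nearin E W a x y" "nearin E W b y z"
  shows "nearin E W (a + b) x z"
proof -
  obtain ys where ys: "length ys \<le> a" "walk E (x # ys)" "last (x # ys) = y" "set (x # ys) \<subseteq> W"
    using assms(1) unfolding nearin_def by blast
  obtain zs where zs: "length zs \<le> b" "walk E (y # zs)" "last (y # zs) = z" "set (y # zs) \<subseteq> W"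
    using assms(2) unfolding nearin_def by blast
  have "walk E ((x # ys) @ zs)"
    unfolding successively_append_iff using ys zs by (auto simp: successively_Cons)
  moreover have "last (x # ys @ zs) = z" using ys(3) zs(3) by (cases "zs = []") auto
  ultimately show ?thesis unfolding nearin_def using ys zs by (intro exI[of _ "ys @ zs"]) auto
qed

lemma nearin_sym:
  assumes "nearin E W d x y"
  shows "nearin E W d y x"
proof -
  obtain ys where ys: "length ys \<le> d" "walk E (x # ys)" "last (x # ys) = y" "set (x # ys) \<subseteq> W"
    using assms unfolding nearin_def by blast
  define zs where "zs = tl (rev (x # ys))"
  have eq: "rev (x # ys) = y # zs" unfolding zs_def using ys(3) by (metis hd_Cons_tl hd_rev list.distinct(1) rev_is_Nil_conv)
  have "walk E (y # zs)" unfolding eq[symmetric] using ys(2) walk_rev by blast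
  moreover have "last (y # zs) = x" unfolding eq[symmetric] by simp
  moreover have "set (y # zs) \<subseteq> W" unfolding eq[symmetric] using ys(4) by simp
  moreover have "length zs \<le> d" unfolding zs_def using ys(1) by simp
  ultimately show ?thesis unfolding nearin_def by blast
qed

lemma nearin_Suc:
  assumes "nearin E W (Suc d) x y"
  shows "nearin E W d x y \<or> (\<exists>z. nearin E W d x z \<and> {z, y} \<in> E \<and> y \<in> W)"
proof -
  obtain ys where ys: "length ys \<le> Suc d" "walk E (x # ys)" "last (x # ys) = y" "set (x # ys) \<subseteq> W"
    using assms unfolding nearin_def by blast
  show ?thesis
  proof (cases "ys = []")
    case True
    then show ?thesis using ys nearin_refl by auto
  next
    case False
    then have eq: "ys = butlast ys @ [y]" using ys(3) by (metis append_butlast_last_id last_ConsR)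
    then have "walk E ((x # butlast ys) @ [y])" using ys(2) by simp
    then have w: "walk E (x # butlast ys)" "{last (x # butlast ys), y} \<in> E"
      unfolding successively_append_iff by auto
    have "set (butlast ys) \<subseteq> set ys" by (auto dest: in_set_butlastD)
    then have "nearin E W d x (last (x # butlast ys))"
      unfolding nearin_def using w(1) ys(1,4) by (intro exI[of _ "butlast ys"]) auto
    moreover have "y \<in> W" using assms nearin_ends by metis
    ultimately show ?thesis using w(2) by blast
  qed
qed

lemma nearin_stretch:
  assumes "nearin E W d x y" "W \<subseteq> V"
    and "\<And>x y. {x, y} \<in> E \<Longrightarrow> x \<in> W \<Longrightarrow> y \<in> W \<Longrightarrow> nearin X V c x y"
  shows "nearin X V (c * d) x y"
  using assms(1)
proof (induction d arbitrary: y)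
  case 0
  then have "x = y" "x \<in> V" using assms(2) unfolding nearin_def by auto
  then show ?case using nearin_refl[of x V] by simp
next
  case (Suc d)
  from nearin_Suc[OF Suc.prems] show ?case
  proof (elim disjE exE conjE)
    assume "nearin E W d x y"
    from Suc.IH[OF this] show ?thesis by (rule nearin_mono) auto
  next
    fix z assume z: "nearin E W d x z" "{z, y} \<in> E" "y \<in> W"
    have "nearin X V (c * d + c) x y"
      using nearin_trans[OF Suc.IH[OF z(1)] assms(3)[OF z(2) _ z(3)]] nearin_ends[OF z(1)] by blast
    then show ?thesis by (rule nearin_mono) auto
  qed
qed

lemma nearin_prefix:
  assumes "length ys \<le> d" "walk E (x # ys)" "set (x # ys) \<subseteq> W" "y \<in> set (x # ys)"
  shows "nearin E W d x y"
proof -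
  have "within_dist (Graph W E) d x y" by (rule path_prefix_within_dist) (use assms in auto)
  from within_dist_Graph[OF this] show ?thesis unfolding nearin_def by auto
qed

lemma nearin_within_dist: "nearin E V d x y \<Longrightarrow> within_dist (Graph V E) d x y"
  unfolding nearin_def using within_distI[of _ d "Graph V E" x y] by auto

subsection \<open>Obstructions\<close>

definition nonneighbours :: "'a set set \<Rightarrow> 'a set \<Rightarrow> 'a \<Rightarrow> 'a set" where
  "nonneighbours E A v = {a \<in> A. a \<noteq> v \<and> {a, v} \<notin> E}"

definition dominating :: "'a set set \<Rightarrow> 'a set \<Rightarrow> nat \<Rightarrow> 'a set \<Rightarrow> 'a set" where
  "dominating E V t A = {v \<in> V. card (nonneighbours E A v) < 2 * t}"

lemma biclique_free_pos: "biclique_free t E \<Longrightarrow> t > 0"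
  unfolding biclique_free_def by (rule ccontr) force

text \<open>Otherwise \<open>t\<close> dominating vertices would have \<open>t\<close> common neighbours in \<open>A\<close>.\<close>

lemma card_dominating:
  assumes "biclique_free t E" "finite V" "finite A" "card A \<ge> t * (2 * t + 2)"
  shows "card (dominating E V t A) \<le> t"
proof (rule ccontr)
  assume "\<not> ?thesis"
  then have "t \<le> card (dominating E V t A)" by simp
  then obtain T where T: "T \<subseteq> dominating E V t A" "card T = t" "finite T" using obtain_subset_with_card_n by metis
  define M where "M = T \<union> (\<Union>v\<in>T. nonneighbours E A v)"
  have finM: "finite M" unfolding M_def nonneighbours_def using T(3) assms(3) by auto
  have "card M \<le> card T + card (\<Union>v\<in>T. nonneighbours E A v)" unfolding M_def by (rule card_Un_le)
  also have "card (\<Union>v\<in>T. nonneighbours E A v) \<le> (\<Sum>v\<in>T. card (nonneighbours E A v))" by (rule card_UN_le[OF T(3)])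
  also have "\<dots> \<le> (\<Sum>v\<in>T. 2 * t)"
  proof (rule sum_mono)
    fix v assume "v \<in> T"
    then have "v \<in> dominating E V t A" using T(1) by blast
    then show "card (nonneighbours E A v) \<le> 2 * t" unfolding dominating_def by simp
  qed
  also have "\<dots> = t * (2 * t)" using T(2) by simp
  finally have "card M \<le> t + t * (2 * t)" using T(2) by simp
  moreover have "card A - card M \<le> card (A - M)" by (rule diff_card_le_card_Diff[OF finM])
  moreover have "t * (2 * t + 2) = t * (2 * t) + t + t" by (simp add: algebra_simps)
  ultimately have "t \<le> card (A - M)" using assms(4) by linarith
  then obtain Y where Y: "Y \<subseteq> A - M" "card Y = t" "finite Y" using obtain_subset_with_card_n by metis
  have "{a, b} \<in> E" if "a \<in> T" "b \<in> Y" for a b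
  proof -
    have "b \<in> A" "b \<noteq> a" "b \<notin> nonneighbours E A a" using that Y(1) unfolding M_def by auto
    then show ?thesis unfolding nonneighbours_def by (auto simp: insert_commute)
  qed
  moreover have "T \<inter> Y = {}" using Y(1) unfolding M_def by auto
  ultimately show False using assms(1) T Y unfolding biclique_free_def by blast
qed

lemma nonadjacent_pair:
  assumes "biclique_free t E" "finite X" "finite Y" "card X \<ge> 2 * t" "card Y \<ge> 2 * t"
  shows "\<exists>x\<in>X. \<exists>y\<in>Y. x \<noteq> y \<and> {x, y} \<notin> E"
proof -
  have "t \<le> card X" using assms(4) by simp
  then obtain X0 where X0: "X0 \<subseteq> X" "card X0 = t" "finite X0" using obtain_subset_with_card_n by metis
  have "card Y - card X0 \<le> card (Y - X0)" by (rule diff_card_le_card_Diff[OF X0(3)])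
  then have "t \<le> card (Y - X0)" using assms(5) X0(2) by linarith
  then obtain Y0 where Y0: "Y0 \<subseteq> Y - X0" "card Y0 = t" "finite Y0" using obtain_subset_with_card_n by metis
  have "X0 \<inter> Y0 = {}" using Y0 by blast
  then obtain x y where xy: "x \<in> X0" "y \<in> Y0" "{x, y} \<notin> E" using assms(1) X0 Y0 unfolding biclique_free_def by blast
  then have "x \<in> X" "y \<in> Y" "x \<noteq> y" using X0(1) Y0(1) by auto
  then show ?thesis using xy(3) by blast
qed

text \<open>If a vertex of \<open>K\<close> is not obstructed, its part contains many vertices of \<open>K\<close>, and every vertex that is not
  obstructed has many nonneighbours among these. If few parts meet \<open>K\<close>, the obstruction is small.\<close>

definition obstruction :: "'a set set \<Rightarrow> 'a set \<Rightarrow> nat \<Rightarrow> 'a set set \<Rightarrow> 'a set \<Rightarrow> 'a set" where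
  "obstruction E V t P K = (\<Union>A\<in>{A \<in> P. A \<inter> K \<noteq> {}}.
     if card (A \<inter> K) < t * (2 * t + 2) then A \<inter> K else dominating E V t (A \<inter> K))"

lemma card_obstruction:
  assumes "biclique_free t E" "finite V" "K \<subseteq> V" "finite P" "card {A \<in> P. A \<inter> K \<noteq> {}} \<le> k"
  shows "finite (obstruction E V t P K)" "card (obstruction E V t P K) \<le> k * (t * (2 * t + 2) + t)"
proof -
  let ?Q = "{A \<in> P. A \<inter> K \<noteq> {}}"
  let ?f = "\<lambda>A. if card (A \<inter> K) < t * (2 * t + 2) then A \<inter> K else dominating E V t (A \<inter> K)"
  have finK: "finite K" by (rule finite_subset[OF assms(3,2)])
  have finQ: "finite ?Q" using assms(4) by simp
  have f: "card (?f A) \<le> t * (2 * t + 2) + t" for A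
    using card_dominating[OF assms(1,2), of "A \<inter> K"] finK by auto
  show "finite (obstruction E V t P K)" unfolding obstruction_def
    using finQ finK assms(2) by (auto simp: dominating_def)
  have "card (obstruction E V t P K) \<le> (\<Sum>A\<in>?Q. card (?f A))" unfolding obstruction_def by (rule card_UN_le[OF finQ])
  also have "\<dots> \<le> (\<Sum>A\<in>?Q. t * (2 * t + 2) + t)" using f by (rule sum_mono)
  also have "\<dots> = card ?Q * (t * (2 * t + 2) + t)" by simp
  also have "\<dots> \<le> k * (t * (2 * t + 2) + t)" using assms(5) by (rule mult_le_mono1)
  finally show "card (obstruction E V t P K) \<le> k * (t * (2 * t + 2) + t)" .
qed

lemma not_obstructed:
  assumes "A \<in> P" "u \<in> A" "u \<in> K" "u \<notin> obstruction E V t P K"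
  shows "w \<in> V \<Longrightarrow> w \<notin> obstruction E V t P K \<Longrightarrow> card (nonneighbours E (A \<inter> K) w) \<ge> 2 * t"
proof -
  have Q: "A \<in> {A \<in> P. A \<inter> K \<noteq> {}}" using assms by blast
  have "\<not> card (A \<inter> K) < t * (2 * t + 2)"
  proof
    assume "card (A \<inter> K) < t * (2 * t + 2)"
    then have "A \<inter> K \<subseteq> obstruction E V t P K" unfolding obstruction_def using Q by (intro subsetI UN_I[OF Q]) simp
    then show False using assms by blast
  qed
  then have "dominating E V t (A \<inter> K) \<subseteq> obstruction E V t P K" unfolding obstruction_def by (intro subsetI UN_I[OF Q]) simp
  then show "w \<in> V \<Longrightarrow> w \<notin> obstruction E V t P K \<Longrightarrow> card (nonneighbours E (A \<inter> K) w) \<ge> 2 * t"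
    unfolding dominating_def by (auto simp: not_less)
qed

text \<open>An edge that a flip or the unresolved pairs have removed between two large parts is
  replaced by a path of three nonedges.\<close>

lemma unobstructed_edge_detour:
  assumes "biclique_free t E" "finite V" and KV: "K \<subseteq> V"
    and u: "A \<in> P" "u \<in> A" "u \<in> K" "u \<notin> obstruction E V t P K"
    and v: "B \<in> P" "v \<in> B" "v \<in> K" "v \<notin> obstruction E V t P K"
    and X: "\<And>a b. a \<in> A \<Longrightarrow> b \<in> B \<Longrightarrow> a \<in> V \<Longrightarrow> b \<in> V \<Longrightarrow> a \<noteq> b \<Longrightarrow> {a, b} \<notin> E \<Longrightarrow> {a, b} \<in> X"
  shows "nearin X V 3 u v"
proof -
  have finK: "finite K" by (rule finite_subset[OF KV assms(2)])
  have uv: "u \<in> V" "v \<in> V" using u v KV by auto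
  have "card (nonneighbours E (A \<inter> K) v) \<ge> 2 * t" using not_obstructed[OF u uv(2) v(4)] .
  moreover have "card (nonneighbours E (B \<inter> K) u) \<ge> 2 * t" using not_obstructed[OF v uv(1) u(4)] .
  moreover have "finite (nonneighbours E (A \<inter> K) v)" "finite (nonneighbours E (B \<inter> K) u)"
    using finK unfolding nonneighbours_def by auto
  ultimately obtain a b where ab: "a \<in> nonneighbours E (A \<inter> K) v" "b \<in> nonneighbours E (B \<inter> K) u" "a \<noteq> b" "{a, b} \<notin> E"
    using nonadjacent_pair[OF assms(1)] by blast
  have m: "a \<in> A" "a \<in> V" "b \<in> B" "b \<in> V" "a \<noteq> v" "b \<noteq> u" "{a, v} \<notin> E" "{b, u} \<notin> E"
    using ab KV unfolding nonneighbours_def by auto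
  have "{u, b} \<in> X" using X[of u b] u m uv by (auto simp: insert_commute)
  moreover have "{b, a} \<in> X" using X[of a b] m ab by (auto simp: insert_commute)
  moreover have "{a, v} \<in> X" using X[of a v] v m uv by auto
  ultimately show ?thesis unfolding nearin_def using m uv by (intro exI[of _ "[b, a, v]"]) auto
qed

subsection \<open>Subdivided cliques with few vertices deleted\<close>

locale sparse_subdivided_clique =
  fixes V :: "'a set" and E :: "'a set set" and B :: "'a set" and I :: "'a set \<Rightarrow> 'a set" and r t :: nat
  assumes finV: "finite V" and EV: "E \<subseteq> [V]\<^bsup>2\<^esup>" and BV: "B \<subseteq> V"
    and model: "subdivision_model r E B ([B]\<^bsup>2\<^esup>) I"
    and free: "biclique_free t E"
begin

text \<open>A path that replaces an edge of the clique has at most \<open>r + 1\<close> edges. So the core contains the branch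
  vertices outside \<open>T\<close> and the paths between them that avoid \<open>T\<close>.\<close>

definition core :: "'a set \<Rightarrow> 'a set" where
  "core T = {x. \<exists>b\<in>B - T. nearin E (- T) (r + 1) b x}"

lemma finite_B: "finite B" by (rule finite_subset[OF BV finV])

lemma core_antimono: "T \<subseteq> T' \<Longrightarrow> core T' \<subseteq> core T"
proof
  fix x assume "T \<subseteq> T'" "x \<in> core T'"
  then obtain b where b: "b \<in> B - T'" "nearin E (- T') (r + 1) b x" unfolding core_def by blast
  have "nearin E (- T) (r + 1) b x" using b(2) by (rule nearin_mono) (use \<open>T \<subseteq> T'\<close> in auto)
  then show "x \<in> core T" unfolding core_def using b(1) \<open>T \<subseteq> T'\<close> by blast
qed

lemma core_disjoint: "x \<in> core T \<Longrightarrow> x \<notin> T"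
  unfolding core_def by (auto dest: nearin_ends)

lemma B_core: "b \<in> B - T \<Longrightarrow> b \<in> core T"
  unfolding core_def using nearin_refl[of b "- T"] by blast

lemma core_V: "core T \<subseteq> V"
proof
  fix x assume "x \<in> core T"
  then obtain b ys where b: "b \<in> B" "walk E (b # ys)" "last (b # ys) = x" unfolding core_def nearin_def by blast
  show "x \<in> V"
  proof (cases "ys = []")
    case True
    then show ?thesis using b BV by auto
  next
    case False
    then show ?thesis using walk_Cons_subset(2)[OF b(2) False EV] b(3) last_in_set[OF False] by auto
  qed
qed

lemma core_nearin:
  assumes "x \<in> core T"
  shows "\<exists>b\<in>B - T. nearin E (core T) (r + 1) b x"
proof -
  obtain b ys where b: "b \<in> B - T" "length ys \<le> r + 1" "walk E (b # ys)" "last (b # ys) = x" "set (b # ys) \<subseteq> - T"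
    using assms unfolding core_def nearin_def by blast
  have "set (b # ys) \<subseteq> core T"
  proof
    fix y assume "y \<in> set (b # ys)"
    from nearin_prefix[OF b(2,3,5) this] show "y \<in> core T" unfolding core_def using b(1) by blast
  qed
  then show ?thesis unfolding nearin_def using b by blast
qed

text \<open>The paths that start at \<open>b\<close> are disjoint outside \<open>b\<close>.\<close>

lemma card_blocked:
  assumes "finite T" "b \<in> B"
  shows "card {c \<in> B - {b}. I {b, c} \<inter> T \<noteq> {}} \<le> card T"
proof -
  let ?C = "{c \<in> B - {b}. I {b, c} \<inter> T \<noteq> {}}"
  define f where "f c = (SOME x. x \<in> I {b, c} \<inter> T)" for c
  have f: "f c \<in> I {b, c} \<inter> T" if "c \<in> ?C" for c
    unfolding f_def by (rule someI_ex) (use that in auto)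
  have "inj_on f ?C"
  proof (rule inj_onI, rule ccontr)
    fix c d assume a: "c \<in> ?C" "d \<in> ?C" "f c = f d" "c \<noteq> d"
    then have "{b, c} \<in> [B]\<^bsup>2\<^esup>" "{b, d} \<in> [B]\<^bsup>2\<^esup>" "{b, c} \<noteq> {b, d}" using assms(2) by (auto simp: doubleton_eq_iff)
    then have "I {b, c} \<inter> I {b, d} = {}" using subdivision_modelD(5)[OF model] by blast
    then show False using f[OF a(1)] f[OF a(2)] a(3) by auto
  qed
  then show ?thesis by (rule card_inj_on_le) (use f assms(1) in auto)
qed

lemma hub_path:
  assumes "b \<in> B - T" "c \<in> B - T" "b \<noteq> c" "I {b, c} \<inter> T = {}"
  shows "nearin E (core T) (r + 1) b c"
proof -
  have bc: "{b, c} \<in> [B]\<^bsup>2\<^esup>" using assms by simp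
  note m = subdivision_modelD[OF model]
  have "linked E (I {b, c}) b c" "b \<notin> I {b, c}" "c \<notin> I {b, c}" using m(4)[OF bc] m(6)[OF bc] assms(1,2) by auto
  then obtain xs where xs: "set xs \<subseteq> I {b, c}" "distinct (b # xs @ [c])" "walk E (b # xs @ [c])"
    using linked_path assms(3) by metis
  have "length xs = card (set xs)" using xs(2) by (simp add: distinct_card)
  also have "\<dots> \<le> card (I {b, c})" by (rule card_mono[OF m(2)[OF bc] xs(1)])
  finally have len: "length (xs @ [c]) \<le> r + 1" using m(3)[OF bc] by simp
  have T: "set (b # xs @ [c]) \<subseteq> - T" using xs(1) assms by auto
  have "set (b # xs @ [c]) \<subseteq> core T"
  proof
    fix y assume "y \<in> set (b # xs @ [c])"
    from nearin_prefix[OF len xs(3) T this] show "y \<in> core T" unfolding core_def using assms(1) by blast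
  qed
  then show ?thesis unfolding nearin_def using len xs(3) by (intro exI[of _ "xs @ [c]"]) auto
qed

text \<open>Deleting few vertices leaves the surviving branch vertices connected through common
  neighbours in the clique.\<close>

lemma core_connected:
  assumes T: "finite T" "3 * card T + 2 < card B" and xy: "x \<in> core T" "y \<in> core T"
  shows "nearin E (core T) (4 * (r + 1)) x y"
proof -
  obtain b where b: "b \<in> B - T" "nearin E (core T) (r + 1) b x" using core_nearin[OF xy(1)] by blast
  obtain c where c: "c \<in> B - T" "nearin E (core T) (r + 1) c y" using core_nearin[OF xy(2)] by blast
  define Z where "Z = T \<union> {b, c} \<union> {d \<in> B - {b}. I {b, d} \<inter> T \<noteq> {}} \<union> {d \<in> B - {c}. I {c, d} \<inter> T \<noteq> {}}"
  have "card Z \<le> card T + card {b, c} + card {d \<in> B - {b}. I {b, d} \<inter> T \<noteq> {}} + card {d \<in> B - {c}. I {c, d} \<inter> T \<noteq> {}}"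
    unfolding Z_def by (intro order.trans[OF card_Un_le] add_mono order.refl)
  moreover have "card {b, c} \<le> 2" by (simp add: card_insert_if)
  ultimately have "card Z < card B" using T(2) card_blocked[OF T(1), of b] card_blocked[OF T(1), of c] b(1) c(1) by simp
  moreover have "finite Z" unfolding Z_def using T(1) finite_B by simp
  ultimately have "\<not> B \<subseteq> Z" using card_mono[of Z B] by linarith
  then obtain d where d: "d \<in> B" "d \<notin> Z" by blast
  have "nearin E (core T) (r + 1) b d" by (rule hub_path) (use b d in \<open>auto simp: Z_def\<close>)
  moreover have "nearin E (core T) (r + 1) c d" by (rule hub_path) (use c d in \<open>auto simp: Z_def\<close>)
  ultimately have "nearin E (core T) (((r + 1) + (r + 1)) + ((r + 1) + (r + 1))) x y"
    using nearin_trans[OF nearin_trans[OF nearin_sym[OF b(2)]] nearin_trans[OF nearin_sym c(2)]] by blast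
  then show ?thesis by (rule nearin_mono) auto
qed

end

subsection \<open>Runner evades few flips\<close>

context sparse_subdivided_clique
begin

text \<open>Runner is safe in \<open>H\<close> at the branch vertices outside \<open>S\<close>.\<close>

definition evades :: "'a graph \<Rightarrow> 'a set \<Rightarrow> bool" where
  "evades H S \<longleftrightarrow> verts H = V \<and> finite S \<and>
     (\<forall>x y. {x, y} \<in> E \<longrightarrow> x \<notin> S \<longrightarrow> y \<notin> S \<longrightarrow> nearin (edges H) V 3 x y)"

lemma flip_evades:
  assumes G: "verts G = V" "edges G = E" and "k_flip k G H"
  shows "\<exists>S. evades H S \<and> card S \<le> k * (t * (2 * t + 2) + t)"
proof -
  obtain P where P: "partition_on V P" "card P \<le> k" "partition_flip G P H"
    using assms(3) unfolding k_flip_def G by blast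
  have finP: "finite P" by (rule finite_elements[OF finV P(1)])
  define S where "S = obstruction E V t P V"
  have "card {A \<in> P. A \<inter> V \<noteq> {}} \<le> k" using card_mono[OF finP, of "{A \<in> P. A \<inter> V \<noteq> {}}"] P(2) by auto
  note S = card_obstruction[OF free finV subset_refl finP this, folded S_def]
  have "nearin (edges H) V 3 x y" if xy: "{x, y} \<in> E" "x \<notin> S" "y \<notin> S" for x y
  proof -
    have e: "x \<in> V" "y \<in> V" "x \<noteq> y" using edge_ends[OF EV xy(1)] by auto
    obtain A where A: "A \<in> P" "x \<in> A" using e(1) P(1) unfolding partition_on_def by blast
    obtain A' where A': "A' \<in> P" "y \<in> A'" using e(2) P(1) unfolding partition_on_def by blast
    have pair: "{x, y} \<in> pairs_between A A'" unfolding pairs_between_def using A A' e by blast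
    have "edges H \<inter> pairs_between A A' = E \<inter> pairs_between A A' \<or>
        edges H \<inter> pairs_between A A' = pairs_between A A' - E"
      using P(3) A(1) A'(1) unfolding partition_flip_def G by blast
    then show ?thesis
    proof
      assume "edges H \<inter> pairs_between A A' = E \<inter> pairs_between A A'"
      then have "{x, y} \<in> edges H" using xy(1) pair by blast
      then have "nearin (edges H) V 1 x y" using e by (intro nearin_edge)
      then show ?thesis by (rule nearin_mono) auto
    next
      assume comp: "edges H \<inter> pairs_between A A' = pairs_between A A' - E"
      show ?thesis
      proof (rule unobstructed_edge_detour[OF free finV subset_refl])
        show "A \<in> P" "x \<in> A" "x \<in> V" "A' \<in> P" "y \<in> A'" "y \<in> V" using A A' e by auto
        show "x \<notin> obstruction E V t P V" "y \<notin> obstruction E V t P V" using xy unfolding S_def by auto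
        fix a b assume ab: "a \<in> A" "b \<in> A'" "a \<noteq> b" "{a, b} \<notin> E"
        then have "{a, b} \<in> pairs_between A A' - E" unfolding pairs_between_def by blast
        then show "{a, b} \<in> edges H" using comp by blast
      qed
    qed
  qed
  moreover have "verts H = V" using P(3) unfolding partition_flip_def G by blast
  ultimately have "evades H S" unfolding evades_def using S(1) by blast
  then show ?thesis using S(2) by blast
qed

lemma evades_near:
  assumes "evades H S" "3 * card S + 2 < card B" "b \<in> B - S" "c \<in> B - S"
  shows "within_dist H (12 * (r + 1)) b c"
proof -
  have S: "finite S" "verts H = V" using assms(1) unfolding evades_def by auto
  have "nearin E (core S) (4 * (r + 1)) b c"
    by (rule core_connected[OF S(1) assms(2) B_core[OF assms(3)] B_core[OF assms(4)]])
  then have "nearin (edges H) V (3 * (4 * (r + 1))) b c"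
  proof (rule nearin_stretch[OF _ core_V])
    fix x y assume "{x, y} \<in> E" "x \<in> core S" "y \<in> core S"
    then show "nearin (edges H) V 3 x y" using assms(1) core_disjoint unfolding evades_def by blast
  qed
  from nearin_within_dist[OF this] have "within_dist (Graph V (edges H)) (12 * (r + 1)) b c" by simp
  then show ?thesis using S(2) by (metis graph.collapse)
qed

lemma evades_not_isolated:
  assumes "evades H S" "3 * card S + 2 < card B" "b \<in> B - S"
  shows "\<not> isolated H b"
proof
  assume iso: "isolated H b"
  have "finite S" using assms(1) unfolding evades_def by blast
  have "card (insert b S) < card B" using assms(2) card_insert_le_m1[of "Suc (card S)" S b] by simp
  then have "\<not> B \<subseteq> insert b S" using card_mono[of "insert b S" B] \<open>finite S\<close> by auto
  then obtain c where c: "c \<in> B - S" "c \<noteq> b" by blast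
  obtain ys where ys: "walk (edges H) (b # ys)" "last (b # ys) = c"
    using evades_near[OF assms(1,2,3) c(1)] by (elim within_distD) blast
  then obtain y zs where "ys = y # zs" using c(2) by (cases ys) auto
  then have "{b, y} \<in> edges H" using ys(1) by simp
  then show False using iso unfolding isolated_def by blast
qed

text \<open>Runner always moves to a branch vertex that is safe both in the current flip, so that she can get there, and in
  the announced flip, so that she is not isolated.\<close>

lemma flipper_wins_card:
  assumes G: "verts G = V" "edges G = E" and wins: "flipper_wins (12 * (r + 1)) k G"
  shows "card B \<le> 3 * (k * (t * (2 * t + 2) + t)) + 2"
proof (rule ccontr)
  assume no: "\<not> ?thesis"
  define \<tau> where "\<tau> = k * (t * (2 * t + 2) + t)"
  have large: "3 * \<tau> + 2 < card B" using no unfolding \<tau>_def by simp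
  obtain \<sigma> where \<sigma>: "\<And>h. k_flip k G (\<sigma> h)" and
    win: "\<And>v. v 0 \<in> verts G \<Longrightarrow> (\<And>i. i \<ge> 1 \<Longrightarrow> within_dist (announced_graph G \<sigma> v (i - 1)) (12 * (r + 1)) (v (i - 1)) (v i)) \<Longrightarrow>
      \<exists>i\<ge>1. isolated (announced_graph G \<sigma> v i) (v i)"
    using wins unfolding flipper_wins_def by blast
  define ann where "ann h = (if h = [] then G else \<sigma> h)" for h
  have "\<exists>S. evades (ann h) S \<and> card S \<le> \<tau>" for h
  proof (cases "h = []")
    case True
    have "nearin E V 3 x y" if "{x, y} \<in> E" for x y
      using nearin_edge[OF that, of V] edge_ends[OF EV that] nearin_mono[of E V 1 x y E V 3] by simp
    then have "evades G {}" unfolding evades_def G by simp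
    then show ?thesis using True unfolding ann_def by (intro exI[of _ "{}"]) simp
  next
    case False
    then show ?thesis using flip_evades[OF G \<sigma>[of h]] unfolding ann_def \<tau>_def by simp
  qed
  then obtain S where S: "\<And>h. evades (ann h) (S h)" "\<And>h. card (S h) \<le> \<tau>" by metis
  have finS: "finite (S h)" for h using S(1)[of h] unfolding evades_def by blast
  define pick where "pick h = (SOME b. b \<in> B - (S h \<union> S (butlast h)))" for h
  have pick: "pick h \<in> B - (S h \<union> S (butlast h))" for h
    unfolding pick_def
  proof (rule someI_ex)
    have "card (S h \<union> S (butlast h)) \<le> \<tau> + \<tau>"
      using card_Un_le[of "S h" "S (butlast h)"] S(2)[of h] S(2)[of "butlast h"] by linarith
    then have "\<not> B \<subseteq> S h \<union> S (butlast h)"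
      using card_mono[of "S h \<union> S (butlast h)" B] finS large by auto
    then show "\<exists>b. b \<in> B - (S h \<union> S (butlast h))" by blast
  qed
  \<comment> \<open>\<open>hist i\<close> lists the positions before round \<open>i\<close>.\<close>
  define hist where "hist = rec_nat [] (\<lambda>_ h. h @ [pick h])"
  have hist: "hist 0 = []" "hist (Suc i) = hist i @ [pick (hist i)]" for i unfolding hist_def by simp_all
  define v where "v i = pick (hist i)" for i
  have "map v [0..<i] = hist i" for i
    by (induction i) (simp_all add: hist v_def)
  then have ann: "announced_graph G \<sigma> v i = ann (hist i)" for i
    unfolding announced_graph_def ann_def by (cases i) (simp_all add: hist del: upt_Suc)
  have bound: "3 * card (S h) + 2 < card B" for h using S(2)[of h] large by linarith
  have "\<exists>i\<ge>1. isolated (announced_graph G \<sigma> v i) (v i)"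
  proof (rule win)
    show "v 0 \<in> verts G" using pick[of "hist 0"] BV unfolding G v_def by auto
    fix i :: nat assume "i \<ge> 1"
    then obtain j where j: "i = Suc j" by (cases i) auto
    have "v j \<in> B - S (hist j)" using pick[of "hist j"] unfolding v_def by blast
    moreover have "v i \<in> B - S (hist j)" using pick[of "hist i"] unfolding v_def j by (simp add: hist)
    ultimately show "within_dist (announced_graph G \<sigma> v (i - 1)) (12 * (r + 1)) (v (i - 1)) (v i)"
      unfolding ann j diff_Suc_1 by (rule evades_near[OF S(1) bound])
  qed
  then obtain i where "isolated (ann (hist i)) (v i)" unfolding ann by blast
  moreover have "v i \<in> B - S (hist i)" using pick[of "hist i"] unfolding v_def by blast
  ultimately show False using evades_not_isolated[OF S(1) bound] by blast
qed

end

subsection \<open>Construction sequences are wide\<close>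

definition wf_state :: "'a set \<Rightarrow> 'a cstate \<Rightarrow> bool" where
  "wf_state V s \<longleftrightarrow> (case s of (P, E, N, U) \<Rightarrow> partition_on V P \<and> E \<union> N \<union> U = [V]\<^bsup>2\<^esup> \<and>
     E \<inter> N = {} \<and> E \<inter> U = {} \<and> N \<inter> U = {})"

text \<open>Unresolved pairs between two parts will be resolved together. So in a state from which a graph with the edge
  set \<open>E\<close> can be completed, they are all edges or all nonedges.\<close>

definition builds :: "'a set set \<Rightarrow> 'a cstate \<Rightarrow> bool" where
  "builds E s \<longleftrightarrow> (case s of (P, E', N, U) \<Rightarrow> E' \<subseteq> E \<and> N \<inter> E = {} \<and>
     (\<forall>A\<in>P. \<forall>B\<in>P. U \<inter> pairs_between A B \<subseteq> E \<or> U \<inter> pairs_between A B \<inter> E = {}))"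

lemma wf_state_step:
  assumes "construction_step s s'" "wf_state V s"
  shows "wf_state V s'"
  using assms
proof cases
  case (merge A P B E N U)
  then show ?thesis using assms(2) partition_on_merge[of V P A B] unfolding wf_state_def by auto
qed (use assms(2) in \<open>auto simp: wf_state_def\<close>)

lemma pairs_between_mono: "A \<subseteq> A' \<Longrightarrow> B \<subseteq> B' \<Longrightarrow> pairs_between A B \<subseteq> pairs_between A' B'"
  unfolding pairs_between_def by blast

lemma pairs_between_parts:
  assumes P: "partition_on V P" and "A \<in> P" "B \<in> P" "X \<in> P" "Y \<in> P"
    and "e \<in> pairs_between A B" "e \<in> pairs_between X Y"
  shows "pairs_between X Y = pairs_between A B"
proof -
  obtain a b x y where ab: "e = {a, b}" "a \<in> A" "b \<in> B" and xy: "e = {x, y}" "x \<in> X" "y \<in> Y"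
    using assms(6,7) unfolding pairs_between_def by blast
  have eq: "C = D" if "C \<in> P" "D \<in> P" "z \<in> C" "z \<in> D" for C D z
    using that P unfolding partition_on_def disjoint_def by blast
  have "x = a \<and> y = b \<or> x = b \<and> y = a" using ab(1) xy(1) by (auto simp: doubleton_eq_iff)
  then have "X = A \<and> Y = B \<or> X = B \<and> Y = A" using eq assms(2-5) ab xy by metis
  moreover have "pairs_between B A = pairs_between A B" unfolding pairs_between_def by (auto simp: insert_commute)
  ultimately show ?thesis by auto
qed

lemma homogeneous_before_resolving:
  assumes P: "partition_on V P" "A \<in> P" "B \<in> P"
    and resolved: "U \<inter> pairs_between A B \<subseteq> E \<or> U \<inter> pairs_between A B \<inter> E = {}"
    and after: "\<forall>X\<in>P. \<forall>Y\<in>P. (U - pairs_between A B) \<inter> pairs_between X Y \<subseteq> E \<or>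
      (U - pairs_between A B) \<inter> pairs_between X Y \<inter> E = {}"
  shows "\<forall>X\<in>P. \<forall>Y\<in>P. U \<inter> pairs_between X Y \<subseteq> E \<or> U \<inter> pairs_between X Y \<inter> E = {}"
proof (intro ballI)
  fix X Y assume XY: "X \<in> P" "Y \<in> P"
  show "U \<inter> pairs_between X Y \<subseteq> E \<or> U \<inter> pairs_between X Y \<inter> E = {}"
  proof (cases "\<exists>e. e \<in> pairs_between A B \<and> e \<in> pairs_between X Y")
    case True
    then have "pairs_between X Y = pairs_between A B" using pairs_between_parts[OF P] XY by metis
    then show ?thesis using resolved by simp
  next
    case False
    then have "(U - pairs_between A B) \<inter> pairs_between X Y = U \<inter> pairs_between X Y" by blast
    then show ?thesis using after XY by metis
  qed
qed

lemma builds_step: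
  assumes step: "construction_step s s'" and wf: "wf_state V s" and b: "builds E s'"
  shows "builds E s"
  using step
proof cases
  case (merge A P B E' N U)
  have "U \<inter> pairs_between X Y \<subseteq> E \<or> U \<inter> pairs_between X Y \<inter> E = {}" if XY: "X \<in> P" "Y \<in> P" for X Y
  proof -
    let ?P' = "insert (A \<union> B) (P - {A, B})"
    have "\<exists>X'\<in>?P'. X \<subseteq> X'" "\<exists>Y'\<in>?P'. Y \<subseteq> Y'" using XY by auto
    then obtain X' Y' where *: "X' \<in> ?P'" "Y' \<in> ?P'" "X \<subseteq> X'" "Y \<subseteq> Y'" by blast
    have all: "\<forall>X\<in>?P'. \<forall>Y\<in>?P'. U \<inter> pairs_between X Y \<subseteq> E \<or> U \<inter> pairs_between X Y \<inter> E = {}"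
      using b unfolding builds_def merge(2) prod.case by (elim conjE)
    have "U \<inter> pairs_between X' Y' \<subseteq> E \<or> U \<inter> pairs_between X' Y' \<inter> E = {}"
      by (rule bspec[OF bspec[OF all *(1)] *(2)])
    then show ?thesis using pairs_between_mono[OF *(3,4)] by blast
  qed
  then show ?thesis using b unfolding builds_def merge by simp
next
  case (resolve_positively A P B E' N U)
  have "E' \<union> (U \<inter> pairs_between A B) \<subseteq> E" "N \<inter> E = {}"
    using b unfolding builds_def resolve_positively(2) by auto
  moreover have "\<forall>X\<in>P. \<forall>Y\<in>P. U \<inter> pairs_between X Y \<subseteq> E \<or> U \<inter> pairs_between X Y \<inter> E = {}"
  proof (rule homogeneous_before_resolving[OF _ resolve_positively(3,4)])
    show "partition_on V P" using wf unfolding wf_state_def resolve_positively(1) by simp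
    show "U \<inter> pairs_between A B \<subseteq> E \<or> U \<inter> pairs_between A B \<inter> E = {}"
      using b unfolding builds_def resolve_positively(2) by auto
  qed (use b in \<open>simp add: builds_def resolve_positively(2)\<close>)
  ultimately show ?thesis unfolding builds_def resolve_positively(1) by simp
next
  case (resolve_negatively A P B E' N U)
  have "E' \<subseteq> E" "(N \<union> (U \<inter> pairs_between A B)) \<inter> E = {}"
    using b unfolding builds_def resolve_negatively(2) by auto
  moreover have "\<forall>X\<in>P. \<forall>Y\<in>P. U \<inter> pairs_between X Y \<subseteq> E \<or> U \<inter> pairs_between X Y \<inter> E = {}"
  proof (rule homogeneous_before_resolving[OF _ resolve_negatively(3,4)])
    show "partition_on V P" using wf unfolding wf_state_def resolve_negatively(1) by simp
    show "U \<inter> pairs_between A B \<subseteq> E \<or> U \<inter> pairs_between A B \<inter> E = {}"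
      using b unfolding builds_def resolve_negatively(2) by auto
  qed (use b in \<open>simp add: builds_def resolve_negatively(2)\<close>)
  ultimately show ?thesis unfolding builds_def resolve_negatively(1) by auto
qed

context sparse_subdivided_clique
begin

text \<open>The pairs \<open>{u, v}\<close> and \<open>{a, v}\<close> lie between the same two parts, but only the first one is an edge; so they
  cannot both be unresolved.\<close>

lemma crossing:
  assumes s: "s = (P, E1, N1, U1)" "wf_state V s" "builds E s"
    and A: "A \<in> P" "u \<in> A" "a \<in> A" "a \<noteq> v" "{a, v} \<notin> E" and uv: "{u, v} \<in> E"
  shows "{u, v} \<in> E1 \<or> {a, v} \<in> N1"
proof -
  have P: "partition_on V P" and un: "E1 \<union> N1 \<union> U1 = [V]\<^bsup>2\<^esup>" using s(2) unfolding wf_state_def s(1) by auto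
  have bl: "E1 \<subseteq> E" "N1 \<inter> E = {}" using s(3) unfolding builds_def s(1) by auto
  have e: "u \<in> V" "v \<in> V" "u \<noteq> v" using edge_ends[OF EV uv] by auto
  obtain B' where B': "B' \<in> P" "v \<in> B'" using e(2) P unfolding partition_on_def by blast
  have aV: "a \<in> V" using A(1,3) P unfolding partition_on_def by blast
  have "{u, v} \<in> [V]\<^bsup>2\<^esup>" "{a, v} \<in> [V]\<^bsup>2\<^esup>" using e aV A(4) by auto
  then have "{u, v} \<in> E1 \<union> U1" "{a, v} \<in> N1 \<union> U1" using un bl uv A(5) by blast+
  moreover have "\<not> ({u, v} \<in> U1 \<and> {a, v} \<in> U1)"
  proof
    assume U: "{u, v} \<in> U1 \<and> {a, v} \<in> U1"
    have "{u, v} \<in> pairs_between A B'" "{a, v} \<in> pairs_between A B'"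
      unfolding pairs_between_def using A B' e by blast+
    moreover have "U1 \<inter> pairs_between A B' \<subseteq> E \<or> U1 \<inter> pairs_between A B' \<inter> E = {}"
      using s(3) A(1) B'(1) unfolding builds_def s(1) by simp
    ultimately show False using U uv A(5) by blast
  qed
  ultimately show ?thesis by blast
qed

text \<open>The vertices of the core are close to each other by resolved pairs. This is carried backwards through a
  construction sequence.\<close>

definition clustered :: "nat \<Rightarrow> 'a cstate \<Rightarrow> bool" where
  "clustered \<tau> s \<longleftrightarrow> (case s of (P, E1, N1, U1) \<Rightarrow> \<exists>T. finite T \<and> card T \<le> \<tau> \<and>
     (\<forall>x\<in>core T. \<forall>y\<in>core T. nearin (E1 \<union> N1) V (12 * (r + 1)) x y))"

lemma unobstructed_edge_near:
  assumes s: "s = (P, E1, N1, U1)" "wf_state V s" "builds E s" and KV: "K \<subseteq> V"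
    and uv: "{u, v} \<in> E" "u \<in> K" "v \<in> K" "u \<notin> obstruction E V t P K" "v \<notin> obstruction E V t P K"
  shows "nearin (E1 \<union> N1) V 3 u v"
proof (cases "{u, v} \<in> E1")
  case True
  then have "nearin (E1 \<union> N1) V 1 u v" using uv KV by (intro nearin_edge) auto
  then show ?thesis by (rule nearin_mono) auto
next
  case False
  have P: "partition_on V P" and un: "E1 \<union> N1 \<union> U1 = [V]\<^bsup>2\<^esup>" using s(2) unfolding wf_state_def s(1) by auto
  have bl: "E1 \<subseteq> E" "N1 \<inter> E = {}" using s(3) unfolding builds_def s(1) by auto
  have e: "u \<in> V" "v \<in> V" "u \<noteq> v" using edge_ends[OF EV uv(1)] by auto
  obtain A where A: "A \<in> P" "u \<in> A" using e(1) P unfolding partition_on_def by blast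
  obtain A' where A': "A' \<in> P" "v \<in> A'" using e(2) P unfolding partition_on_def by blast
  have "{u, v} \<in> [V]\<^bsup>2\<^esup>" using e by simp
  then have U: "{u, v} \<in> U1" using un bl uv(1) False by blast
  have hom: "U1 \<inter> pairs_between A A' \<subseteq> E \<or> U1 \<inter> pairs_between A A' \<inter> E = {}"
    using s(3) A(1) A'(1) unfolding builds_def s(1) by simp
  have "{u, v} \<in> pairs_between A A'" unfolding pairs_between_def using A A' e by blast
  then have hom': "U1 \<inter> pairs_between A A' \<subseteq> E" using hom U uv(1) by blast
  show ?thesis
  proof (rule unobstructed_edge_detour[OF free finV KV A uv(2,4) A' uv(3,5)])
    fix a b assume ab: "a \<in> A" "b \<in> A'" "a \<in> V" "b \<in> V" "a \<noteq> b" "{a, b} \<notin> E"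
    then have "{a, b} \<in> [V]\<^bsup>2\<^esup>" "{a, b} \<in> pairs_between A A'" unfolding pairs_between_def by auto
    then show "{a, b} \<in> E1 \<union> N1" using un hom' ab(6) by blast
  qed
qed

text \<open>Few parts meet the core of the later state, so at the earlier state all but few of its
  vertices are still close to each other. The deleted set would grow with every step, but it can
  be replaced: the parts near the surviving core are few by the width bound alone, and outside
  their obstructions any walk of the graph that starts in the core stays near it.\<close>

lemma clustered_step:
  fixes k :: nat
  defines "\<kappa> \<equiv> t * (2 * t + 2) + t"
  defines "\<tau> \<equiv> (4 * (r + 1) + 1) * (k * \<kappa>)"
  assumes step: "construction_step s s'" and wf: "wf_state V s" and bl: "builds E s"
    and narrow: "narrow V (16 * (r + 1)) k s" "narrow V (16 * (r + 1)) k s'"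
    and large: "3 * (\<tau> + (k + 2) * \<kappa>) + 2 < card B"
    and cl: "clustered \<tau> s'"
  shows "clustered \<tau> s"
proof -
  obtain P E1 N1 U1 where s: "s = (P, E1, N1, U1)" by (metis surj_pair)
  obtain P' E2 N2 U2 where s': "s' = (P', E2, N2, U2)" by (metis surj_pair)
  define l where "l = 4 * (r + 1)"
  have P: "partition_on V P" using wf unfolding wf_state_def s by simp
  have finP: "finite P" by (rule finite_elements[OF finV P])
  have "wf_state V s'" by (rule wf_state_step[OF step wf])
  then have "partition_on V P'" unfolding wf_state_def s' by simp
  then have finP': "finite P'" by (rule finite_elements[OF finV])
  obtain A0 B0 where PP': "P \<subseteq> P' \<union> {A0, B0}"
    using step unfolding s s' by cases auto
  have exB: "\<exists>b. b \<in> B - T" if "finite T" "card T < card B" for T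
    using card_mono[OF that(1), of B] that(2) by (meson DiffI not_le subsetI)
  have parts: "card {A \<in> Q. A \<inter> K \<noteq> {}} \<le> k"
    if nq: "narrow V (16 * (r + 1)) k (Q, F, N, U)" and Q: "finite Q" and b: "b \<in> V"
      and K: "\<And>x. x \<in> K \<Longrightarrow> nearin (F \<union> N) V (16 * (r + 1)) b x" for Q F N U b K
  proof -
    have "{A \<in> Q. A \<inter> K \<noteq> {}} \<subseteq> reachable_parts V (16 * (r + 1)) (Q, F, N, U) b"
      unfolding reachable_parts_def using nearin_within_dist[OF K] by auto
    moreover have "finite (reachable_parts V (16 * (r + 1)) (Q, F, N, U) b)" unfolding reachable_parts_def using Q by simp
    ultimately have "card {A \<in> Q. A \<inter> K \<noteq> {}} \<le> card (reachable_parts V (16 * (r + 1)) (Q, F, N, U) b)"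
      by (intro card_mono)
    also have "\<dots> \<le> k" using nq b unfolding narrow_def by blast
    finally show ?thesis .
  qed
  obtain T' where T': "finite T'" "card T' \<le> \<tau>"
    and near': "\<And>x y. x \<in> core T' \<Longrightarrow> y \<in> core T' \<Longrightarrow> nearin (E2 \<union> N2) V (12 * (r + 1)) x y"
    using cl unfolding clustered_def s' by auto
  define K where "K = core T'"
  have KV: "K \<subseteq> V" unfolding K_def by (rule core_V)
  obtain b' where b': "b' \<in> B - T'" using exB[OF T'(1)] T'(2) large by auto
  have "card {A \<in> P'. A \<inter> K \<noteq> {}} \<le> k"
  proof (rule parts[OF narrow(2)[unfolded s'] finP'])
    show "b' \<in> V" using b' BV by auto
    fix x assume "x \<in> K"
    then have "nearin (E2 \<union> N2) V (12 * (r + 1)) b' x" using near'[OF B_core[OF b']] unfolding K_def by blast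
    then show "nearin (E2 \<union> N2) V (16 * (r + 1)) b' x" by (rule nearin_mono) auto
  qed
  moreover have "{A \<in> P. A \<inter> K \<noteq> {}} \<subseteq> {A \<in> P'. A \<inter> K \<noteq> {}} \<union> {A0, B0}" using PP' by auto
  then have "card {A \<in> P. A \<inter> K \<noteq> {}} \<le> card ({A \<in> P'. A \<inter> K \<noteq> {}} \<union> {A0, B0})" using finP' by (intro card_mono) auto
  moreover have "card ({A \<in> P'. A \<inter> K \<noteq> {}} \<union> {A0, B0}) \<le> card {A \<in> P'. A \<inter> K \<noteq> {}} + card {A0, B0}" by (rule card_Un_le)
  moreover have "card {A0, B0} \<le> 2" by (simp add: card_insert_if)
  ultimately have "card {A \<in> P. A \<inter> K \<noteq> {}} \<le> k + 2" by linarith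
  note T1 = card_obstruction[OF free finV KV finP this, folded \<kappa>_def]
  define T2 where "T2 = T' \<union> obstruction E V t P K"
  have finT2: "finite T2" unfolding T2_def using T'(1) T1(1) by simp
  have cT2: "card T2 \<le> \<tau> + (k + 2) * \<kappa>"
    unfolding T2_def using card_Un_le[of T' "obstruction E V t P K"] T'(2) T1(2) by linarith
  have K2K: "core T2 \<subseteq> K" unfolding K_def T2_def by (rule core_antimono) simp
  have bound2: "3 * card T2 + 2 < card B" 
    by (rule le_less_trans[OF add_right_mono[OF mult_le_mono2[OF cT2]] large])
  have near2: "nearin (E1 \<union> N1) V (12 * (r + 1)) x y" if xy: "x \<in> core T2" "y \<in> core T2" for x y
  proof -
    have "nearin E (core T2) (4 * (r + 1)) x y" by (rule core_connected[OF finT2 bound2 xy])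
    then have "nearin (E1 \<union> N1) V (3 * (4 * (r + 1))) x y"
    proof (rule nearin_stretch[OF _ core_V])
      fix u v assume uv: "{u, v} \<in> E" "u \<in> core T2" "v \<in> core T2"
      then have "u \<notin> obstruction E V t P K" "v \<notin> obstruction E V t P K" using core_disjoint unfolding T2_def by blast+
      then show "nearin (E1 \<union> N1) V 3 u v"
        using unobstructed_edge_near[OF s wf bl KV uv(1)] uv(2,3) K2K by blast
    qed
    then show ?thesis by simp
  qed
  define N where "N j = {y. \<exists>x\<in>core T2. nearin (E1 \<union> N1) V j x y}" for j
  have NV: "N j \<subseteq> V" for j unfolding N_def by (auto dest: nearin_ends)
  obtain b2 where b2: "b2 \<in> B - T2" using exB[OF finT2] cT2 large by auto
  have Nparts: "card {A \<in> P. A \<inter> N j \<noteq> {}} \<le> k" if "j \<le> l" for j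
  proof (rule parts[OF narrow(1)[unfolded s] finP])
    show "b2 \<in> V" using b2 BV by auto
    fix x assume "x \<in> N j"
    then obtain z where z: "z \<in> core T2" "nearin (E1 \<union> N1) V j z x" unfolding N_def by blast
    have "nearin (E1 \<union> N1) V (12 * (r + 1) + j) b2 x" by (rule nearin_trans[OF near2[OF B_core[OF b2] z(1)] z(2)])
    then show "nearin (E1 \<union> N1) V (16 * (r + 1)) b2 x" by (rule nearin_mono) (use that l_def in auto)
  qed
  note Nobs = card_obstruction[OF free finV NV finP Nparts, folded \<kappa>_def]
  define T where "T = (\<Union>j\<le>l. obstruction E V t P (N j))"
  have finT: "finite T" unfolding T_def using Nobs(1) by simp
  have "card T \<le> (\<Sum>j\<le>l. card (obstruction E V t P (N j)))" unfolding T_def by (rule card_UN_le) simp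
  also have "\<dots> \<le> (\<Sum>j\<le>l. k * \<kappa>)" using Nobs(2) by (intro sum_mono) simp
  also have "\<dots> = \<tau>" unfolding \<tau>_def l_def by simp
  finally have cT: "card T \<le> \<tau>" .
  have "card (T2 \<union> T) \<le> 3 * (\<tau> + (k + 2) * \<kappa>)"
    using order.trans[OF card_Un_le[of T2 T] add_mono[OF cT2 cT]] by simp
  then have "card (T2 \<union> T) < card B" using large by linarith
  then obtain c where c: "c \<in> B - (T2 \<union> T)" using exB[of "T2 \<union> T"] finT2 finT by blast
  have cc: "c \<in> core T2" "c \<in> core T" using c B_core by auto
  have mono: "N j \<subseteq> N j'" if "j \<le> j'" for j j'
    unfolding N_def using that by (auto elim!: nearin_mono)
  have spread: "x \<in> N j" if "nearin E (core T) j c x" "j \<le> l" for j x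
    using that
  proof (induction j arbitrary: x)
    case 0
    then have "x = c" unfolding nearin_def by auto
    then show ?case unfolding N_def using cc(1) nearin_refl[of c V] core_V by blast
  next
    case (Suc j)
    from nearin_Suc[OF Suc.prems(1)] show ?case
    proof (elim disjE exE conjE)
      assume "nearin E (core T) j c x"
      then show ?thesis using Suc.IH[of x] Suc.prems(2) mono[of j "Suc j"] by auto
    next
      fix y assume y: "nearin E (core T) j c y" "{y, x} \<in> E" "x \<in> core T"
      have yN: "y \<in> N j" using Suc.IH[OF y(1)] Suc.prems(2) by simp
      have yT: "y \<in> core T" using nearin_ends[OF y(1)] by blast
      have "obstruction E V t P (N j) \<subseteq> T" unfolding T_def using Suc.prems(2) by (intro UN_upper) simp
      then have obs: "y \<notin> obstruction E V t P (N j)" "x \<notin> obstruction E V t P (N j)"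
        using core_disjoint yT y(3) by blast+
      have yx: "y \<in> V" "x \<in> V" using edge_ends[OF EV y(2)] by auto
      obtain A where A: "A \<in> P" "y \<in> A" using yx(1) P unfolding partition_on_def by blast
      have "card (nonneighbours E (A \<inter> N j) x) \<ge> 2 * t" by (rule not_obstructed[OF A yN obs(1) yx(2) obs(2)])
      then have "nonneighbours E (A \<inter> N j) x \<noteq> {}" using biclique_free_pos[OF free] by auto
      then obtain a where a: "a \<in> A" "a \<in> N j" "a \<noteq> x" "{a, x} \<notin> E" unfolding nonneighbours_def by blast
      have "\<exists>w\<in>N j. {w, x} \<in> E1 \<union> N1"
        using crossing[OF s wf bl A a(1,3,4) y(2)] yN a(2) by blast
      then obtain w z where w: "z \<in> core T2" "nearin (E1 \<union> N1) V j z w" "{w, x} \<in> E1 \<union> N1" unfolding N_def by blast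
      have "nearin (E1 \<union> N1) V (j + 1) z x"
        using nearin_trans[OF w(2) nearin_edge[OF w(3)]] nearin_ends[OF w(2)] yx(2) by blast
      then show ?thesis unfolding N_def using w(1) by auto
    qed
  qed
  have "card T \<le> \<tau> + (k + 2) * \<kappa>" using cT by simp
  then have bound: "3 * card T + 2 < card B"
    by (rule le_less_trans[OF add_right_mono[OF mult_le_mono2] large])
  have sub: "core T \<subseteq> N l"
    using spread[of l] core_connected[OF finT bound cc(2)] unfolding l_def by blast
  have "nearin (E1 \<union> N1) V (12 * (r + 1)) x y" if xy: "x \<in> core T" "y \<in> core T" for x y
  proof -
    have "nearin (E1 \<union> N1) V (3 * (4 * (r + 1))) x y"
    proof (rule nearin_stretch[OF core_connected[OF finT bound xy] core_V])
      fix u v assume uv: "{u, v} \<in> E" "u \<in> core T" "v \<in> core T"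
      have "obstruction E V t P (N l) \<subseteq> T" unfolding T_def by (intro UN_upper) simp
      then have "u \<notin> obstruction E V t P (N l)" "v \<notin> obstruction E V t P (N l)" using core_disjoint uv by blast+
      then show "nearin (E1 \<union> N1) V 3 u v"
        using unobstructed_edge_near[OF s wf bl NV uv(1)] uv(2,3) sub by blast
    qed
    then show ?thesis by simp
  qed
  then show ?thesis unfolding clustered_def s using finT cT by auto
qed

text \<open>At the end of the sequence any two vertices form a resolved pair. If the width were small, the core would remain
  close together back to the first state, where no pairs are resolved.\<close>

lemma construction_sequence_card:
  assumes G: "verts G = V" "edges G = E" and ss: "construction_sequence G ss"
    and narrow: "\<forall>s\<in>set ss. narrow V (16 * (r + 1)) k s"
  shows "card B \<le> 3 * (((4 * (r + 1) + 1) * k + (k + 2)) * (t * (2 * t + 2) + t)) + 2"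
proof (rule ccontr)
  assume no: "\<not> ?thesis"
  define \<kappa> where "\<kappa> = t * (2 * t + 2) + t"
  define \<tau> where "\<tau> = (4 * (r + 1) + 1) * (k * \<kappa>)"
  have large: "3 * (\<tau> + (k + 2) * \<kappa>) + 2 < card B" 
    using no unfolding \<tau>_def \<kappa>_def[symmetric] by (simp add: algebra_simps)
  obtain P N where ne: "ss \<noteq> []" and hd: "hd ss = initial_state V" and st: "successively construction_step ss"
    and last: "last ss = (P, E, N, {})" using ss unfolding construction_sequence_def G by blast
  have step: "construction_step (ss ! i) (ss ! Suc i)" if "Suc i < length ss" for i
    using successively_nth[OF st that] .
  have wf: "wf_state V (ss ! i)" if "i < length ss" for i
    using that
  proof (induction i)
    case 0
    have "partition_on V ((\<lambda>v. {v}) ` V)" by (intro partition_onI) (auto simp: disjnt_def)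
    then show ?case using hd ne unfolding hd_conv_nth[OF ne] wf_state_def initial_state_def by simp
  next
    case (Suc i)
    then show ?case using wf_state_step[OF step] by simp
  qed
  define n where "n = length ss - 1"
  have n: "n < length ss" "ss ! n = (P, E, N, {})" unfolding n_def using ne last by (auto simp: last_conv_nth)
  have "builds E (ss ! (n - j)) \<and> clustered \<tau> (ss ! (n - j))" if "j \<le> n" for j
    using that
  proof (induction j)
    case 0
    have w: "E \<union> N = [V]\<^bsup>2\<^esup>" "E \<inter> N = {}" using wf[OF n(1)] unfolding n(2) wf_state_def by auto
    have "nearin (E \<union> N) V (12 * (r + 1)) x y" if "x \<in> V" "y \<in> V" for x y
    proof (cases "x = y")
      case True
      then show ?thesis using nearin_refl[OF that(1)] by simp
    next
      case False
      then have "nearin (E \<union> N) V 1 x y" using that w(1) by (intro nearin_edge) auto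
      then show ?thesis by (rule nearin_mono) auto
    qed
    then have "\<forall>x\<in>core {}. \<forall>y\<in>core {}. nearin (E \<union> N) V (12 * (r + 1)) x y" using core_V[of "{}"] by blast
    then have "clustered \<tau> (P, E, N, {})" unfolding clustered_def prod.case
      by (intro exI[of _ "{}"] conjI) simp_all
    moreover have "builds E (P, E, N, {})" unfolding builds_def using w(2) by auto
    ultimately show ?case using n(2) by simp
  next
    case (Suc j)
    define i where "i = n - Suc j"
    have i: "Suc i = n - j" "Suc i < length ss" unfolding i_def using Suc.prems n(1) by auto
    have IH: "builds E (ss ! Suc i)" "clustered \<tau> (ss ! Suc i)" using Suc i(1) by auto
    have w: "wf_state V (ss ! i)" using wf i(2) by simp
    have b: "builds E (ss ! i)" by (rule builds_step[OF step[OF i(2)] w IH(1)])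
    have nar: "narrow V (16 * (r + 1)) k (ss ! i)" "narrow V (16 * (r + 1)) k (ss ! Suc i)"
      using narrow i(2) nth_mem[of i ss] nth_mem[of "Suc i" ss] by auto
    have "clustered \<tau> (ss ! i)"
      using clustered_step[OF step[OF i(2)] w b nar] large IH(2) unfolding \<tau>_def \<kappa>_def by blast
    then show ?case using b unfolding i_def by blast
  qed
  from this[of n] have "clustered \<tau> (initial_state V)" using hd unfolding hd_conv_nth[OF ne] by simp
  then obtain T where T: "finite T" "card T \<le> \<tau>" and near: "\<And>x y. x \<in> core T \<Longrightarrow> y \<in> core T \<Longrightarrow> nearin {} V (12 * (r + 1)) x y"
    unfolding clustered_def initial_state_def by auto
  have eq: "x = y" if xy: "x \<in> core T" "y \<in> core T" for x y
  proof -
    obtain ys where "walk {} (x # ys)" "last (x # ys) = y" using near[OF xy] unfolding nearin_def by blast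
    then show ?thesis by (cases ys) auto
  qed
  have "card (B - T) \<ge> card B - card T" by (rule diff_card_le_card_Diff[OF T(1)])
  moreover have "\<tau> \<le> 3 * (\<tau> + (k + 2) * \<kappa>)" by simp
  ultimately have "card (B - T) \<ge> 2" using T(2) large by linarith
  then obtain b c where "b \<in> B - T" "c \<in> B - T" "b \<noteq> c"
    by (metis card_le_Suc0_iff_eq finite_B finite_Diff not_less_eq_eq numeral_2_eq_2)
  then show False using eq B_core by blast
qed

end

section \<open>The equivalence\<close>

lemma weakly_sparse_biclique_free:
  assumes "weakly_sparse C"
  shows "\<exists>t. \<forall>G\<in>C. simple_graph G \<longrightarrow> biclique_free t (edges G)"
proof -
  obtain t where t: "\<And>G. G \<in> C \<Longrightarrow> \<not> contains_subgraph G (biclique t)" using assms unfolding weakly_sparse_def by blast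
  have "biclique_free t (edges G)" if G: "G \<in> C" "simple_graph G" for G
    unfolding biclique_free_def
  proof
    assume "\<exists>A B. finite A \<and> finite B \<and> card A = t \<and> card B = t \<and> A \<inter> B = {} \<and> (\<forall>a\<in>A. \<forall>b\<in>B. {a, b} \<in> edges G)"
    then obtain A B where AB: "finite A" "finite B" "card A = t" "card B = t" "A \<inter> B = {}"
      and E: "\<And>a b. a \<in> A \<Longrightarrow> b \<in> B \<Longrightarrow> {a, b} \<in> edges G" by metis
    have EG: "edges G \<subseteq> [verts G]\<^bsup>2\<^esup>" using G(2) unfolding simple_graph_def by blast
    obtain f where f: "bij_betw f {..<t} A" using ex_bij_betw_nat_finite[OF AB(1)] AB(3) by (auto simp: atLeast0LessThan)
    obtain g where g: "bij_betw g {..<t} B" using ex_bij_betw_nat_finite[OF AB(2)] AB(4) by (auto simp: atLeast0LessThan)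
    define h where "h = (\<lambda>(c, i). if c then g i else f i)"
    have fA: "f i \<in> A" and gB: "g i \<in> B" if "i < t" for i
      using that f g unfolding bij_betw_def by auto
    have "inj_on h (verts (biclique t))"
    proof (rule inj_onI)
      fix x y assume a: "x \<in> verts (biclique t)" "y \<in> verts (biclique t)" "h x = h y"
      obtain c i d j where xy: "x = (c, i)" "y = (d, j)" by (metis surj_pair)
      have ij: "i < t" "j < t" using a xy unfolding biclique_def by auto
      have "c = d" using a(3) fA[OF ij(1)] fA[OF ij(2)] gB[OF ij(1)] gB[OF ij(2)] AB(5)
        unfolding xy h_def by (cases c; cases d) auto
      moreover have "i = j" using a(3) ij f g \<open>c = d\<close> unfolding xy h_def bij_betw_def inj_on_def by (cases c) auto
      ultimately show "x = y" unfolding xy by simp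
    qed
    moreover have "h ` verts (biclique t) \<subseteq> verts G"
    proof
      fix y assume "y \<in> h ` verts (biclique t)"
      then obtain c i where ci: "y = h (c, i)" "i < t" unfolding biclique_def by auto
      have "{f i, g i} \<in> edges G" using E fA gB ci(2) by blast
      from edge_ends[OF EG this] show "y \<in> verts G" unfolding ci(1) h_def by (cases c) auto
    qed
    moreover have "h ` e \<in> edges G" if e: "e \<in> edges (biclique t)" for e
    proof -
      obtain i j where "e = {(False, i), (True, j)}" "i < t" "j < t" using e unfolding biclique_def by auto
      then show ?thesis using E[OF fA gB] unfolding h_def by simp
    qed
    ultimately have "contains_subgraph G (biclique t)" unfolding contains_subgraph_def by blast
    then show False using t G(1) by blast
  qed
  then show ?thesis by blast
qed

subsection \<open>Nowhere dense classes\<close>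

text \<open>All dependencies on the bound for fans are collected in a single power.\<close>

lemma poly_bound:
  assumes "K \<le> (k * (R + 1)) ^ R"
  shows "a + K + (t + 1) * (K + b) ^ t \<le> (a + 1 + (t + 1) * (b + 1) ^ t) * ((Suc k) * (R + 1)) ^ (R * (t + 1))"
proof -
  define x where "x = ((Suc k) * (R + 1)) ^ R"
  have x1: "x \<ge> 1" unfolding x_def by simp
  have Kx: "K \<le> x" unfolding x_def by (rule order.trans[OF assms power_mono]) auto
  have xt: "x \<le> x ^ (t + 1)" "x ^ t \<le> x ^ (t + 1)" "1 \<le> x ^ (t + 1)"
    using x1 by (auto intro: self_le_power power_increasing simp del: power_Suc)
  have "b * 1 \<le> b * x" by (rule mult_le_mono2[OF x1])
  then have "K + b \<le> x + b * x" using Kx by linarith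
  then have "K + b \<le> (b + 1) * x" by simp
  then have "(K + b) ^ t \<le> ((b + 1) * x) ^ t" by (rule power_mono) simp
  also have "\<dots> = (b + 1) ^ t * x ^ t" by (rule power_mult_distrib)
  also have "\<dots> \<le> (b + 1) ^ t * x ^ (t + 1)" using xt(2) by (rule mult_le_mono2)
  finally have "(t + 1) * (K + b) ^ t \<le> (t + 1) * ((b + 1) ^ t * x ^ (t + 1))" by (rule mult_le_mono2)
  moreover have "a \<le> a * x ^ (t + 1)" using mult_le_mono2[OF xt(3), of a] by simp
  moreover have "K \<le> x ^ (t + 1)" using Kx xt(1) by linarith
  ultimately have "a + K + (t + 1) * (K + b) ^ t \<le> a * x ^ (t + 1) + x ^ (t + 1) + (t + 1) * ((b + 1) ^ t * x ^ (t + 1))"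
    by linarith
  also have "\<dots> = (a + 1 + (t + 1) * (b + 1) ^ t) * x ^ (t + 1)" by (simp add: algebra_simps)
  also have "x ^ (t + 1) = ((Suc k) * (R + 1)) ^ (R * (t + 1))" unfolding x_def by (simp only: power_mult)
  finally show ?thesis .
qed

lemma widths_le_fan_bound:
  assumes G: "simple_graph G" "verts G \<noteq> {}" and free: "biclique_free t (edges G)"
    and fan: "fan_bounded (edges G) (verts G) (2 * r + 1) k"
  shows "merge_width r G \<le> (2 + (t + 1) * 3 ^ t) * ((Suc k) * (2 * r + 2)) ^ ((2 * r + 1) * (t + 1))"
    and "flip_width r G \<le> (2 + (t + 1) * 3 ^ t) * ((Suc k) * (2 * r + 2)) ^ ((2 * r + 1) * (t + 1))"
proof -
  have V: "finite (verts G)" "edges G \<subseteq> [verts G]\<^bsup>2\<^esup>" using G(1) unfolding simple_graph_def by auto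
  define K where "K = (k * (2 * r + 1 + 1)) ^ (2 * r + 1)"
  obtain vs where vs: "set vs = verts G" "distinct vs"
    and reach: "\<And>i v. v \<in> verts G - set (take i vs) \<Longrightarrow> card (reach (edges G) (2 * r + 1) (set (take i vs)) v) \<le> K"
    using fan_bounded_reach_ordering[OF V fan] unfolding K_def by blast
  have shorter: "card (reach (edges G) q (set (take i vs)) v) \<le> K" if "q \<le> 2 * r + 1" "v \<in> verts G - set (take i vs)" for q i v
  proof -
    have "finite (reach (edges G) (2 * r + 1) (set (take i vs)) v)"
      by (rule finite_subset[OF reach_subset]) simp
    from card_mono[OF this reach_mono[OF that(1)]] reach[OF that(2)] show ?thesis by (rule order.trans)
  qed
  have K: "K \<le> (k * (2 * r + 1 + 1)) ^ (2 * r + 1)" unfolding K_def by simp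
  note poly = poly_bound[OF K]
  have "\<exists>ss. construction_sequence G ss \<and> (\<forall>s\<in>set ss. narrow (verts G) r ((t + 1) * (K + 2) ^ t + 1) s)"
    by (rule merge_width_sequence[OF G(1) vs free _ G(2)]) (rule shorter, simp_all)
  then obtain ss where "construction_sequence G ss" "\<forall>s\<in>set ss. narrow (verts G) r ((t + 1) * (K + 2) ^ t + 1) s"
    by blast
  then have "merge_width r G \<le> (t + 1) * (K + 2) ^ t + 1" by (rule merge_width_le)
  then show "merge_width r G \<le> (2 + (t + 1) * 3 ^ t) * ((Suc k) * (2 * r + 2)) ^ ((2 * r + 1) * (t + 1))"
    using poly[of 1 t 2] by simp
  have "flipper_wins r (Suc K + (t + 1) * (Suc K + 1) ^ t) G"
    by (rule flipper_wins_ordering[OF G(1) vs free]) (rule shorter, simp_all)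
  then have "flip_width r G \<le> Suc K + (t + 1) * (Suc K + 1) ^ t" by (rule flip_width_le)
  then show "flip_width r G \<le> (2 + (t + 1) * 3 ^ t) * ((Suc k) * (2 * r + 2)) ^ ((2 * r + 1) * (t + 1))"
    using poly[of 1 t 2] by simp
qed

lemma empty_graph_widths:
  assumes "simple_graph G" "verts G = {}"
  shows "merge_width r G = 0" "flip_width r G = 0"
proof -
  have e: "edges G = {}" using assms unfolding simple_graph_def by (simp add: nsets_eq_empty)
  have "construction_sequence G [initial_state (verts G)]"
    unfolding construction_sequence_def initial_state_def assms(2) e by (simp add: nsets_eq_empty)
  then have "merge_width r G \<le> 0" by (rule merge_width_le) (simp add: narrow_def assms(2))
  then show "merge_width r G = 0" by simp
  have "k_flip 0 G G" unfolding k_flip_def partition_flip_def using assms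
    by (intro exI[of _ "{}"]) (simp add: partition_on_def)
  then have "flipper_wins r 0 G" unfolding flipper_wins_def assms(2) by (intro exI[of _ "\<lambda>_. G"]) simp
  then show "flip_width r G = 0" using flip_width_le by fastforce
qed

lemma nowhere_dense_almost_bounded:
  assumes C: "\<forall>G\<in>C. simple_graph G" "weakly_sparse C" "nowhere_dense C"
  shows "almost_bounded_merge_width C \<and> almost_bounded_flip_width C"
proof -
  obtain t where t: "\<And>G. G \<in> C \<Longrightarrow> biclique_free t (edges G)" using weakly_sparse_biclique_free[OF C(2)] C(1) by blast
  have "\<exists>c::real. \<forall>G\<in>C. real (merge_width r G) \<le> c * real (card (verts G)) powr \<epsilon> \<and>
      real (flip_width r G) \<le> c * real (card (verts G)) powr \<epsilon>" if eps: "\<epsilon> > 0" for r and \<epsilon> :: real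
  proof -
    define p where "p = (2 * r + 1) * (t + 1)"
    define a where "a = 2 + (t + 1) * 3 ^ t"
    define b where "b = 2 * r + 2"
    have p0: "p > 0" unfolding p_def by simp
    then have "\<epsilon> / real p > 0" using eps by simp
    from nowhere_dense_fan_bounded[OF C(1,3) this, of "2 * r + 1"] obtain c where
      c: "\<And>G. G \<in> C \<Longrightarrow> verts G \<noteq> {} \<Longrightarrow> \<exists>k. fan_bounded (edges G) (verts G) (2 * r + 1) k \<and>
        real k \<le> c * real (card (verts G)) powr (\<epsilon> / real p)" by blast
    define c' where "c' = real a * ((\<bar>c\<bar> + 1) * real b) ^ p"
    have "real (merge_width r G) \<le> c' * real (card (verts G)) powr \<epsilon> \<and>
      real (flip_width r G) \<le> c' * real (card (verts G)) powr \<epsilon>" if G: "G \<in> C" for G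
    proof (cases "verts G = {}")
      case True
      then show ?thesis using empty_graph_widths[of G r] C(1) G by simp
    next
      case False
      let ?n = "real (card (verts G))"
      have "finite (verts G)" using C(1) G unfolding simple_graph_def by blast
      then have n1: "?n \<ge> 1" using False by (simp add: Suc_leI card_gt_0_iff)
      obtain k where k: "fan_bounded (edges G) (verts G) (2 * r + 1) k" "real k \<le> c * ?n powr (\<epsilon> / real p)"
        using c[OF G False] by blast
      define y where "y = ?n powr (\<epsilon> / real p)"
      have y1: "y \<ge> 1" unfolding y_def using n1 eps by (intro ge_one_powr_ge_zero) auto
      have "real k \<le> \<bar>c\<bar> * y" using k(2) y1 mult_right_mono[of c "\<bar>c\<bar>" y] unfolding y_def[symmetric] by linarith
      then have "real (Suc k) \<le> (\<bar>c\<bar> + 1) * y" using y1 by (simp add: algebra_simps)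
      then have "real (Suc k) * real b \<le> (\<bar>c\<bar> + 1) * y * real b" by (rule mult_right_mono) simp
      also have "\<dots> = (\<bar>c\<bar> + 1) * real b * y" by (simp only: ac_simps)
      finally have "real (Suc k) * real b \<le> (\<bar>c\<bar> + 1) * real b * y" .
      then have "(real (Suc k) * real b) ^ p \<le> ((\<bar>c\<bar> + 1) * real b * y) ^ p" by (intro power_mono) auto
      also have "\<dots> = ((\<bar>c\<bar> + 1) * real b) ^ p * y ^ p" by (rule power_mult_distrib)
      also have "y ^ p = ?n powr \<epsilon>"
      proof -
        have "y ^ p = y powr real p" using y1 by (simp add: powr_realpow)
        then show ?thesis unfolding y_def using p0 by (simp add: powr_powr)
      qed
      finally have "real a * (real (Suc k) * real b) ^ p \<le> real a * (((\<bar>c\<bar> + 1) * real b) ^ p * ?n powr \<epsilon>)"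
        by (rule mult_left_mono) simp
      then have bound: "real (a * ((Suc k) * b) ^ p) \<le> c' * ?n powr \<epsilon>"
        unfolding c'_def by (simp only: of_nat_mult of_nat_power mult.assoc)
      have "simple_graph G" using C(1) G by blast
      from widths_le_fan_bound[OF this False t[OF G] k(1)]
      have "merge_width r G \<le> a * ((Suc k) * b) ^ p" "flip_width r G \<le> a * ((Suc k) * b) ^ p"
        unfolding a_def b_def p_def by blast+
      then have "real (merge_width r G) \<le> real (a * ((Suc k) * b) ^ p)" "real (flip_width r G) \<le> real (a * ((Suc k) * b) ^ p)"
        by (simp_all only: of_nat_le_iff)
      then show ?thesis using bound by linarith
    qed
    then show ?thesis by blast
  qed
  then show ?thesis unfolding almost_bounded_merge_width_def almost_bounded_flip_width_def by meson
qed

subsection \<open>Somewhere dense classes\<close>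

text \<open>With the trivial bound on \<open>reach\<close> by the number of all vertices, any ordering provides a winning
  strategy and a construction sequence, so the least widths are attained.\<close>

lemma widths_attained:
  assumes G: "simple_graph G" "verts G \<noteq> {}" and free: "biclique_free t (edges G)"
  shows "flipper_wins r (flip_width r G) G"
    and "\<exists>ss. construction_sequence G ss \<and> (\<forall>s\<in>set ss. narrow (verts G) r (merge_width r G) s)"
proof -
  have V: "finite (verts G)" "edges G \<subseteq> [verts G]\<^bsup>2\<^esup>" using G(1) unfolding simple_graph_def by auto
  obtain vs where vs: "set vs = verts G" "distinct vs" using finite_distinct_list[OF V(1)] by blast
  have K: "card (reach (edges G) q (set (take i vs)) v) \<le> card (verts G)" for q i v
  proof -
    have "reach (edges G) q (set (take i vs)) v \<subseteq> verts G"
      using reach_subset[of "edges G" q "set (take i vs)" v] set_take_subset[of i vs] vs(1) by blast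
    then show ?thesis by (rule card_mono[OF V(1)])
  qed
  have "\<exists>k. flipper_wins r k G" using flipper_wins_ordering[OF G(1) vs free K] by blast
  then show "flipper_wins r (flip_width r G) G" unfolding flip_width_def by (rule LeastI_ex)
  obtain ss0 where ss0: "construction_sequence G ss0" using merge_width_sequence[OF G(1) vs free K G(2)] by blast
  have "\<exists>ss. construction_sequence G ss \<and> sequence_width (verts G) r ss = merge_width r G"
    unfolding merge_width_def by (rule LeastI_ex) (use ss0 in blast)
  then obtain ss where ss: "construction_sequence G ss" "sequence_width (verts G) r ss = merge_width r G" by blast
  define m where "m = Max (insert 0 ((\<lambda>(s, v). card (reachable_parts (verts G) r s v)) ` (set ss \<times> verts G)))"
  have "\<exists>k. \<forall>s\<in>set ss. \<forall>v\<in>verts G. card (reachable_parts (verts G) r s v) \<le> k"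
  proof (intro exI[of _ m] ballI)
    fix s v assume "s \<in> set ss" "v \<in> verts G"
    then show "card (reachable_parts (verts G) r s v) \<le> m" unfolding m_def using V(1) by (intro Max_ge) auto
  qed
  from LeastI_ex[OF this] have "\<forall>s\<in>set ss. \<forall>v\<in>verts G. card (reachable_parts (verts G) r s v) \<le> merge_width r G"
    unfolding ss(2)[symmetric] sequence_width_def .
  then show "\<exists>ss. construction_sequence G ss \<and> (\<forall>s\<in>set ss. narrow (verts G) r (merge_width r G) s)"
    using ss(1) unfolding narrow_def by blast
qed

text \<open>Heredity allows restricting to the vertices of the subdivided clique. Their number is quadratic in \<open>m\<close>, so a
  lower bound that is linear in \<open>m\<close> is polynomial in the number of vertices.\<close>

lemma spanning_subdivided_clique:
  assumes C: "\<forall>G\<in>C. simple_graph G" "hereditary C" and G: "G \<in> C" "contains_subgraph G (subdivided_clique r m)"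
  shows "\<exists>H\<in>C. \<exists>B I. B \<subseteq> verts H \<and> card B = m \<and> subdivision_model r (edges H) B ([B]\<^bsup>2\<^esup>) I \<and>
    card (verts H) \<le> m + r * (m * m)"
proof -
  let ?D = "subdivided_clique r m"
  obtain f where f: "inj_on f (verts ?D)" "f ` verts ?D \<subseteq> verts G" "\<And>e. e \<in> edges ?D \<Longrightarrow> f ` e \<in> edges G"
    using G(2) unfolding contains_subgraph_def by blast
  define H where "H = induced_subgraph G (f ` verts ?D)"
  have HC: "H \<in> C" using C(2) G(1) f(2) unfolding hereditary_def H_def by blast
  define B where "B = (\<lambda>i. f (Branch i)) ` {..<m}"
  have vD: "Branch i \<in> verts ?D" if "i < m" for i using that unfolding subdivided_clique_def by simp
  have vI: "Inner i j p \<in> verts ?D" if "i < j" "j < m" "1 \<le> p" "p \<le> r" for i j p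
    using that unfolding subdivided_clique_def by auto
  have inj: "x = y" if "f x = f y" "x \<in> verts ?D" "y \<in> verts ?D" for x y using inj_onD[OF f(1) that] .
  have "inj_on (\<lambda>i. f (Branch i)) {..<m}"
  proof (rule inj_onI)
    fix i j assume "i \<in> {..<m}" "j \<in> {..<m}" "f (Branch i) = f (Branch j)"
    then show "i = j" using inj[of "Branch i" "Branch j"] vD by simp
  qed
  then have cB: "card B = m" unfolding B_def by (simp add: card_image)
  define inner where "inner i j = (\<lambda>p. f (Inner i j p)) ` {1..r}" for i j
  define I where "I e = (\<Union>(i, j)\<in>{(i, j). i < j \<and> j < m \<and> e = {f (Branch i), f (Branch j)}}. inner i j)" for e
  have I: "I {f (Branch i), f (Branch j)} = inner i j" if ij: "i < j" "j < m" for i j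
  proof -
    have "a = i \<and> b = j" if "a < b" "b < m" "{f (Branch i), f (Branch j)} = {f (Branch a), f (Branch b)}" for a b
    proof -
      have "f (Branch i) = f (Branch a) \<and> f (Branch j) = f (Branch b) \<or> f (Branch i) = f (Branch b) \<and> f (Branch j) = f (Branch a)"
        using that(3) by (auto simp: doubleton_eq_iff)
      then have "i = a \<and> j = b \<or> i = b \<and> j = a"
        using inj[of "Branch i" "Branch a"] inj[of "Branch j" "Branch b"] inj[of "Branch i" "Branch b"] inj[of "Branch j" "Branch a"]
          vD[of i] vD[of j] vD[of a] vD[of b] ij that(1,2) by auto
      then show ?thesis using ij that(1) by auto
    qed
    then have "{(a, b). a < b \<and> b < m \<and> {f (Branch i), f (Branch j)} = {f (Branch a), f (Branch b)}} = {(i, j)}"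
      using ij by auto
    then show ?thesis unfolding I_def by simp
  qed
  have pair: "\<exists>i j. i < j \<and> j < m \<and> e = {f (Branch i), f (Branch j)}" if "e \<in> [B]\<^bsup>2\<^esup>" for e
  proof -
    obtain i j where ij: "e = {f (Branch i), f (Branch j)}" "i < m" "j < m" "f (Branch i) \<noteq> f (Branch j)"
      using \<open>e \<in> [B]\<^bsup>2\<^esup>\<close> unfolding B_def by (elim nsets2_E) auto
    then have "i < j \<or> j < i" by (metis linorder_neqE_nat)
    then show ?thesis using ij by (metis insert_commute)
  qed
  have edge: "{f (subdivision_vertex r i j p), f (subdivision_vertex r i j (p + 1))} \<in> edges H"
    if "i < j" "j < m" "p \<le> r" for i j p
  proof -
    let ?e = "{subdivision_vertex r i j p, subdivision_vertex r i j (p + 1)}"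
    have "?e \<in> edges ?D" using that unfolding subdivided_clique_def by auto
    then have "f ` ?e \<in> edges G" by (rule f(3))
    moreover have "subdivision_vertex r i j p \<in> verts ?D" if "p \<le> r + 1" for p
      using that \<open>i < j\<close> \<open>j < m\<close> unfolding subdivision_vertex_def subdivided_clique_def by auto
    then have "f ` ?e \<subseteq> f ` verts ?D" using that(3) by auto
    ultimately show ?thesis unfolding H_def induced_subgraph_def by simp
  qed
  have "subdivision_model r (edges H) B ([B]\<^bsup>2\<^esup>) I"
    unfolding subdivision_model_def
  proof (intro conjI ballI impI allI)
    show "[B]\<^bsup>2\<^esup> \<subseteq> [B]\<^bsup>2\<^esup>" by simp
  next
    fix e assume "e \<in> [B]\<^bsup>2\<^esup>"
    then obtain i j where ij: "i < j" "j < m" "e = {f (Branch i), f (Branch j)}" using pair by blast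
    show "finite (I e)" unfolding ij(3) I[OF ij(1,2)] inner_def by simp
    show "card (I e) \<le> r" unfolding ij(3) I[OF ij(1,2)] inner_def using card_image_le[of "{1..r}"] by simp
    show "I e \<inter> B = {}"
    proof (rule ccontr)
      assume "I e \<inter> B \<noteq> {}"
      then obtain p a where "f (Inner i j p) = f (Branch a)" "1 \<le> p" "p \<le> r" "a < m"
        unfolding ij(3) I[OF ij(1,2)] inner_def B_def by auto
      then show False using inj[of "Inner i j p" "Branch a"] vI[OF ij(1,2)] vD by simp
    qed
  next
    fix e g assume eg: "e \<in> [B]\<^bsup>2\<^esup>" "g \<in> [B]\<^bsup>2\<^esup>" "e \<noteq> g"
    obtain i j where ij: "i < j" "j < m" "e = {f (Branch i), f (Branch j)}" using pair[OF eg(1)] by blast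
    obtain a b where ab: "a < b" "b < m" "g = {f (Branch a), f (Branch b)}" using pair[OF eg(2)] by blast
    show "I e \<inter> I g = {}"
    proof (rule ccontr)
      assume "I e \<inter> I g \<noteq> {}"
      then obtain p q where "f (Inner i j p) = f (Inner a b q)" "1 \<le> p" "p \<le> r" "1 \<le> q" "q \<le> r"
        unfolding ij(3) ab(3) I[OF ij(1,2)] I[OF ab(1,2)] inner_def by auto
      then have "i = a" "j = b" using inj[of "Inner i j p" "Inner a b q"] vI[OF ij(1,2)] vI[OF ab(1,2)] by simp_all
      then show False using eg(3) ij(3) ab(3) by simp
    qed
  next
    fix u v assume uv: "{u, v} \<in> [B]\<^bsup>2\<^esup>"
    then obtain i j where ij: "i < j" "j < m" "{u, v} = {f (Branch i), f (Branch j)}" using pair by blast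
    define xs where "xs = map (\<lambda>p. f (Inner i j p)) [1..<r + 1]"
    have eq: "f (Branch i) # xs @ [f (Branch j)] = map (\<lambda>p. f (subdivision_vertex r i j p)) [0..<r + 2]"
    proof -
      have "[0..<r + 2] = 0 # [1..<r + 1] @ [r + 1]" by (simp add: upt_rec[of 0])
      moreover have "map (\<lambda>p. f (subdivision_vertex r i j p)) [1..<r + 1] = xs"
        unfolding xs_def by (intro map_cong) (auto simp: subdivision_vertex_def)
      ultimately show ?thesis by (simp add: subdivision_vertex_def)
    qed
    have "walk (edges H) (map (\<lambda>p. f (subdivision_vertex r i j p)) [0..<r + 2])"
      unfolding successively_conv_nth using edge[OF ij(1,2)] by (auto simp del: upt_Suc)
    then have "walk (edges H) (f (Branch i) # xs @ [f (Branch j)])" unfolding eq .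
    moreover have "set xs \<subseteq> inner i j" unfolding xs_def inner_def by auto
    ultimately have "linked (edges H) (I {u, v}) (f (Branch i)) (f (Branch j))"
      unfolding ij(3) I[OF ij(1,2)] linked_def by blast
    moreover have "u = f (Branch i) \<and> v = f (Branch j) \<or> u = f (Branch j) \<and> v = f (Branch i)"
      using ij(3) by (auto simp: doubleton_eq_iff)
    ultimately show "linked (edges H) (I {u, v}) u v" using linked_sym by fast
  qed
  moreover have "B \<subseteq> verts H" unfolding B_def H_def induced_subgraph_def using vD by auto
  moreover have "card (verts H) \<le> m + r * (m * m)"
  proof -
    let ?J = "(\<lambda>(i, j, p). Inner i j p) ` ({..<m} \<times> {..<m} \<times> {1..r})"
    have "Inner i j p \<in> ?J" if "i < j" "j < m" "1 \<le> p" "p \<le> r" for i j p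
      by (rule image_eqI[of _ _ "(i, j, p)"]) (use that in auto)
    then have "verts ?D \<subseteq> Branch ` {..<m} \<union> ?J" unfolding subdivided_clique_def by auto
    then have "card (verts ?D) \<le> card (Branch ` {..<m} \<union> ?J)" by (intro card_mono) auto
    also have "\<dots> \<le> card (Branch ` {..<m}) + card ?J" by (rule card_Un_le)
    also have "\<dots> \<le> card {..<m} + card ({..<m} \<times> {..<m} \<times> {1..r})" by (intro add_mono card_image_le) auto
    also have "\<dots> = m + r * (m * m)" by (simp add: card_cartesian_product algebra_simps)
    finally show ?thesis unfolding H_def induced_subgraph_def using card_image[OF f(1)] by simp
  qed
  ultimately show ?thesis using HC cB by blast
qed

text \<open>For the exponent \<open>1/4\<close> the width of a spanning subdivision of an \<open>m\<close>-clique is of order at most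
  \<open>sqrt m\<close>, which contradicts a linear lower bound.\<close>

lemma almost_bounded_nowhere_dense:
  fixes w :: "nat \<Rightarrow> 'a graph \<Rightarrow> nat"
  assumes C: "\<forall>G\<in>C. simple_graph G" "hereditary C"
    and bounded: "\<And>r (\<epsilon>::real). \<epsilon> > 0 \<Longrightarrow> \<exists>c. \<forall>G\<in>C. real (w r G) \<le> c * real (card (verts G)) powr \<epsilon>"
    and lower: "\<And>r. \<exists>q a. \<forall>G B I. G \<in> C \<longrightarrow> B \<subseteq> verts G \<longrightarrow> B \<noteq> {} \<longrightarrow>
      subdivision_model r (edges G) B ([B]\<^bsup>2\<^esup>) I \<longrightarrow> card B \<le> a * (w q G + 1)"
  shows "nowhere_dense C"
proof (rule ccontr)
  assume "\<not> nowhere_dense C"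
  then obtain r where r: "\<And>m. \<exists>G\<in>C. contains_subgraph G (subdivided_clique r m)" unfolding nowhere_dense_def by blast
  obtain q a where qa: "\<And>G B I. G \<in> C \<Longrightarrow> B \<subseteq> verts G \<Longrightarrow> B \<noteq> {} \<Longrightarrow>
      subdivision_model r (edges G) B ([B]\<^bsup>2\<^esup>) I \<Longrightarrow> card B \<le> a * (w q G + 1)" using lower[of r] by blast
  obtain c where c: "\<And>G. G \<in> C \<Longrightarrow> real (w q G) \<le> c * real (card (verts G)) powr (1/4)"
    using bounded[of "1/4" q] by auto
  define d where "d = real a * (\<bar>c\<bar> * (real r + 1) powr (1/4) + 1)"
  have d0: "d \<ge> 0" unfolding d_def by simp
  obtain m :: nat where m: "real m > d ^ 2 + 1" using reals_Archimedean2 by blast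
  have m1: "real m \<ge> 1" using m by (smt (verit) zero_le_power2)
  obtain G where "G \<in> C" "contains_subgraph G (subdivided_clique r m)" using r by blast
  from spanning_subdivided_clique[OF C this] obtain H B I where H: "H \<in> C" "B \<subseteq> verts H" "card B = m"
    "subdivision_model r (edges H) B ([B]\<^bsup>2\<^esup>) I" "card (verts H) \<le> m + r * (m * m)" by blast
  have "B \<noteq> {}" using H(3) m1 by auto
  from qa[OF H(1,2) this H(4)] have "m \<le> a * (w q H + 1)" unfolding H(3) .
  then have "real m \<le> real (a * (w q H + 1))" by (simp only: of_nat_le_iff)
  also have "\<dots> = real a * (real (w q H) + 1)" by (simp add: algebra_simps)
  also have "\<dots> \<le> real a * (\<bar>c\<bar> * (real r + 1) powr (1/4) * sqrt (real m) + sqrt (real m))"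
  proof (intro mult_left_mono add_mono)
    have "real (card (verts H)) \<le> real (m + r * (m * m))" using H(5) by (simp only: of_nat_le_iff)
    also have "\<dots> \<le> (real r + 1) * (real m * real m)" using m1 mult_right_mono[OF m1, of "real m"] by (simp add: algebra_simps)
    finally have n: "real (card (verts H)) \<le> (real r + 1) * (real m * real m)" .
    have "real (w q H) \<le> \<bar>c\<bar> * real (card (verts H)) powr (1/4)"
      by (rule order.trans[OF c[OF H(1)] mult_right_mono]) simp_all
    also have "\<dots> \<le> \<bar>c\<bar> * ((real r + 1) * (real m * real m)) powr (1/4)"
      using n by (intro mult_left_mono powr_mono2) auto
    also have "((real r + 1) * (real m * real m)) powr (1/4) = (real r + 1) powr (1/4) * (real m powr (1/4) * real m powr (1/4))"
      by (simp add: powr_mult)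
    also have "real m powr (1/4) * real m powr (1/4) = sqrt (real m)"
      using m1 by (simp add: powr_add[symmetric] powr_half_sqrt)
    finally show "real (w q H) \<le> \<bar>c\<bar> * (real r + 1) powr (1/4) * sqrt (real m)" by (simp add: mult.assoc)
    show "1 \<le> sqrt (real m)" using m1 by simp
  qed simp
  also have "\<dots> = d * sqrt (real m)" unfolding d_def by (simp add: algebra_simps)
  finally have "sqrt (real m) * sqrt (real m) \<le> d * sqrt (real m)" by simp
  then have "sqrt (real m) \<le> d" by (rule mult_right_le_imp_le) (use m1 in simp)
  then have "(sqrt (real m)) ^ 2 \<le> d ^ 2" by (rule power_mono) simp
  then show False using m by simp
qed

theorem corollary1p16:
  fixes C :: "'a graph set"
  assumes "\<forall>G\<in>C. simple_graph G"
    and "hereditary C"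
    and "weakly_sparse C"
  shows "(nowhere_dense C \<longleftrightarrow> almost_bounded_merge_width C) \<and>
         (almost_bounded_merge_width C \<longleftrightarrow> almost_bounded_flip_width C)"
proof -
  obtain t where t: "\<And>G. G \<in> C \<Longrightarrow> biclique_free t (edges G)"
    using weakly_sparse_biclique_free[OF assms(3)] assms(1) by blast
  define \<kappa> where "\<kappa> = t * (2 * t + 2) + t"
  have clique: "sparse_subdivided_clique (verts G) (edges G) B I r t"
    if "G \<in> C" "B \<subseteq> verts G" "subdivision_model r (edges G) B ([B]\<^bsup>2\<^esup>) I" for G B I r
    using assms(1) that t unfolding sparse_subdivided_clique_def simple_graph_def by blast
  have "nowhere_dense C" if "almost_bounded_merge_width C"
  proof (rule almost_bounded_nowhere_dense[OF assms(1,2), of merge_width])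
    show "\<exists>c. \<forall>G\<in>C. real (merge_width r G) \<le> c * real (card (verts G)) powr \<epsilon>" if "\<epsilon> > 0" for r and \<epsilon> :: real
      using \<open>almost_bounded_merge_width C\<close> that unfolding almost_bounded_merge_width_def by blast
    fix r
    define a where "a = 3 * ((4 * (r + 1) + 4) * \<kappa>) + 2"
    have "card B \<le> a * (merge_width (16 * (r + 1)) G + 1)"
      if G: "G \<in> C" "B \<subseteq> verts G" "B \<noteq> {}" "subdivision_model r (edges G) B ([B]\<^bsup>2\<^esup>) I" for G B I
    proof -
      interpret sparse_subdivided_clique "verts G" "edges G" B I r t by (rule clique[OF G(1,2,4)])
      let ?w = "merge_width (16 * (r + 1)) G"
      have "verts G \<noteq> {}" using G(2,3) by blast
      then obtain ss where "construction_sequence G ss" "\<forall>s\<in>set ss. narrow (verts G) (16 * (r + 1)) ?w s"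
        using widths_attained(2)[OF _ _ free] assms(1) G(1) by blast
      from construction_sequence_card[OF refl refl this]
      have "card B \<le> 3 * (((4 * (r + 1) + 1) * ?w + (?w + 2)) * \<kappa>) + 2" unfolding \<kappa>_def .
      also have "\<dots> \<le> 3 * (((4 * (r + 1) + 4) * (?w + 1)) * \<kappa>) + 2"
        by (intro add_right_mono mult_le_mono2 mult_le_mono1) (simp add: algebra_simps)
      also have "\<dots> \<le> a * (?w + 1)" unfolding a_def by (simp add: algebra_simps)
      finally show ?thesis .
    qed
    then show "\<exists>q a. \<forall>G B I. G \<in> C \<longrightarrow> B \<subseteq> verts G \<longrightarrow> B \<noteq> {} \<longrightarrow>
      subdivision_model r (edges G) B ([B]\<^bsup>2\<^esup>) I \<longrightarrow> card B \<le> a * (merge_width q G + 1)" by blast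
  qed
  moreover have "nowhere_dense C" if "almost_bounded_flip_width C"
  proof (rule almost_bounded_nowhere_dense[OF assms(1,2), of flip_width])
    show "\<exists>c. \<forall>G\<in>C. real (flip_width r G) \<le> c * real (card (verts G)) powr \<epsilon>" if "\<epsilon> > 0" for r and \<epsilon> :: real
      using \<open>almost_bounded_flip_width C\<close> that unfolding almost_bounded_flip_width_def by blast
    fix r
    have "card B \<le> (3 * \<kappa> + 2) * (flip_width (12 * (r + 1)) G + 1)"
      if G: "G \<in> C" "B \<subseteq> verts G" "B \<noteq> {}" "subdivision_model r (edges G) B ([B]\<^bsup>2\<^esup>) I" for G B I
    proof -
      interpret sparse_subdivided_clique "verts G" "edges G" B I r t by (rule clique[OF G(1,2,4)])
      have "verts G \<noteq> {}" using G(2,3) by blast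
      then have "flipper_wins (12 * (r + 1)) (flip_width (12 * (r + 1)) G) G"
        using widths_attained(1)[OF _ _ free] assms(1) G(1) by blast
      from flipper_wins_card[OF refl refl this]
      show ?thesis unfolding \<kappa>_def[symmetric] by (simp add: algebra_simps)
    qed
    then show "\<exists>q a. \<forall>G B I. G \<in> C \<longrightarrow> B \<subseteq> verts G \<longrightarrow> B \<noteq> {} \<longrightarrow>
      subdivision_model r (edges G) B ([B]\<^bsup>2\<^esup>) I \<longrightarrow> card B \<le> a * (flip_width q G + 1)" by blast
  qed
  ultimately show ?thesis using nowhere_dense_almost_bounded[OF assms(1,3)] by blast
qed

end
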